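(* Let $(M,\tau)$ be a diffuse tracial von Neumann algebra. Then $\mathfrak O(M)=1$ or $\mathfrak O(M)\ge\aleph_1$. Moreover, if $M$ is separable, then $\mathfrak O(M)=1$ or $\mathfrak O(M)=\mathfrak c$. Moreover, if $\mathfrak O(M)=1$, then $\mathfrak R(M)<\infty$.
   Context: A unitary $u$ is Haar if $\tau(u^n)=0$ for all $n\ge1$; $\mathcal H(M)$ is the set of Haar unitaries. Fix a free ultrafilter $\mathcal U$ on $\mathbb N$, $M^{\mathcal U}$ the tracial ultrapower containing $M$ diagonally. For $u,v\in\mathcal H(M)$: $p_M(u,u)=0$; for $u\neq v$, $p_M(u,v)$ is the least $k\ge1$ such that there exist $w_1,\ldots,w_{k-1}\in\mathcal H(M^{\mathcal U})$ with $[w_i,w_{i+1}]=0$ for $0\le i\le k-1$ where $w_0=u,w_k=v$; $p_M(u,v)=\infty$ if none exists. $u\sim_M v$ iff $p_M(u,v)<\infty$. $\mathfrak R(M)=\sup\{p_M(u,v):u\sim_M v\}$ and $\mathfrak O(M)$ is the number of orbits of $\sim_M$ on $\mathcal H(M)$. $\mathfrak c$ is the cardinality of the continuum. *)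

theory Defs
  imports "HOL-Analysis.Analysis" "HOL-Library.Extended_Nat"
begin

class cstar_algebra = real_normed_algebra_1 + banach +
  fixes scaleC :: "complex \<Rightarrow> 'a \<Rightarrow> 'a"
    and adj :: "'a \<Rightarrow> 'a"
  assumes scaleC_add_right: "scaleC c (x + y) = scaleC c x + scaleC c y"
    and scaleC_add_left: "scaleC (c + d) x = scaleC c x + scaleC d x"
    and scaleC_scaleC: "scaleC c (scaleC d x) = scaleC (c * d) x"
    and scaleC_one: "scaleC 1 x = x"
    and scaleR_scaleC: "scaleR r x = scaleC (complex_of_real r) x"
    and norm_scaleC: "norm (scaleC c x) = cmod c * norm x"
    and mult_scaleC_left: "scaleC c x * y = scaleC c (x * y)"
    and mult_scaleC_right: "x * scaleC c y = scaleC c (x * y)"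
    and adj_adj: "adj (adj x) = x"
    and adj_add: "adj (x + y) = adj x + adj y"
    and adj_scaleC: "adj (scaleC c x) = scaleC (cnj c) (adj x)"
    and adj_mult: "adj (x * y) = adj y * adj x"
    and cstar_identity: "norm (adj x * x) = (norm x)\<^sup>2"

definition norm2 :: "('a::cstar_algebra \<Rightarrow> complex) \<Rightarrow> 'a \<Rightarrow> real" where
  "norm2 \<tau> x = sqrt (Re (\<tau> (adj x * x)))"

definition faithful_tracial_state :: "('a::cstar_algebra \<Rightarrow> complex) \<Rightarrow> bool" where
  "faithful_tracial_state \<tau> \<longleftrightarrow>
     (\<forall>x y. \<tau> (x + y) = \<tau> x + \<tau> y) \<and>
     (\<forall>c x. \<tau> (scaleC c x) = c * \<tau> x) \<and>
     (\<forall>x. Im (\<tau> (adj x * x)) = 0 \<and> Re (\<tau> (adj x * x)) \<ge> 0) \<and>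
     (\<forall>x. \<tau> (adj x * x) = 0 \<longrightarrow> x = 0) \<and>
     \<tau> 1 = 1 \<and>
     (\<forall>x y. \<tau> (x * y) = \<tau> (y * x))"

definition tracial_vna :: "('a::cstar_algebra \<Rightarrow> complex) \<Rightarrow> bool" where
  "tracial_vna \<tau> \<longleftrightarrow> faithful_tracial_state \<tau> \<and>
     (\<forall>f :: nat \<Rightarrow> 'a. (\<forall>n. norm (f n) \<le> 1) \<and>
        (\<forall>e>0. \<exists>N. \<forall>m\<ge>N. \<forall>n\<ge>N. norm2 \<tau> (f m - f n) < e) \<longrightarrow>
        (\<exists>x. norm x \<le> 1 \<and> (\<lambda>n. norm2 \<tau> (f n - x)) \<longlonglongrightarrow> 0))"

definition is_projection :: "'a::cstar_algebra \<Rightarrow> bool" where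
  "is_projection p \<longleftrightarrow> adj p = p \<and> p * p = p"

definition diffuse :: "'a::cstar_algebra itself \<Rightarrow> bool" where
  "diffuse _ \<longleftrightarrow> \<not> (\<exists>p::'a. is_projection p \<and> p \<noteq> 0 \<and>
       (\<forall>q. is_projection q \<and> p * q = q \<longrightarrow> q = 0 \<or> q = p))"

text \<open>Separable: separable in the 2-norm (equivalently, separable predual).\<close>
definition separable2 :: "('a::cstar_algebra \<Rightarrow> complex) \<Rightarrow> bool" where
  "separable2 \<tau> \<longleftrightarrow> (\<exists>D :: 'a set. countable D \<and>
       (\<forall>x. \<forall>e>0. \<exists>d\<in>D. norm2 \<tau> (x - d) < e))"

definition unitary :: "'a::cstar_algebra \<Rightarrow> bool" where
  "unitary u \<longleftrightarrow> adj u * u = 1 \<and> u * adj u = 1"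

definition haar :: "('a::cstar_algebra \<Rightarrow> complex) \<Rightarrow> 'a set" where
  "haar \<tau> = {u. unitary u \<and> (\<forall>n::nat. n \<ge> 1 \<longrightarrow> \<tau> (u ^ n) = 0)}"

definition free_ultrafilter :: "nat filter \<Rightarrow> bool" where
  "free_ultrafilter U \<longleftrightarrow> U \<noteq> bot \<and>
     (\<forall>P. eventually P U \<or> eventually (\<lambda>n. \<not> P n) U) \<and>
     (\<forall>k. \<not> eventually (\<lambda>n. n = k) U)"

text \<open>Elements of the tracial ultrapower M^U are classes of norm-bounded sequences
  modulo the ideal of sequences with lim_U of the 2-norm equal to 0; the trace is
  tau_U(x) = lim_U tau(x_n). We work with representatives: all predicates below are
  invariant under the equivalence, and M sits in M^U via constant sequences.\<close>

definition ell_inf :: "(nat \<Rightarrow> 'a::cstar_algebra) set" where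
  "ell_inf = {x. \<exists>B. \<forall>n. norm (x n) \<le> B}"

definition ultra_haar :: "nat filter \<Rightarrow> ('a::cstar_algebra \<Rightarrow> complex) \<Rightarrow> (nat \<Rightarrow> 'a) \<Rightarrow> bool" where
  "ultra_haar U \<tau> x \<longleftrightarrow> x \<in> ell_inf \<and>
     ((\<lambda>n. norm2 \<tau> (adj (x n) * x n - 1)) \<longlongrightarrow> 0) U \<and>
     ((\<lambda>n. norm2 \<tau> (x n * adj (x n) - 1)) \<longlongrightarrow> 0) U \<and>
     (\<forall>k::nat. k \<ge> 1 \<longrightarrow> ((\<lambda>n. \<tau> (x n ^ k)) \<longlongrightarrow> 0) U)"

definition ultra_commute :: "nat filter \<Rightarrow> ('a::cstar_algebra \<Rightarrow> complex) \<Rightarrow> (nat \<Rightarrow> 'a) \<Rightarrow> (nat \<Rightarrow> 'a) \<Rightarrow> bool" where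
  "ultra_commute U \<tau> x y \<longleftrightarrow> ((\<lambda>n. norm2 \<tau> (x n * y n - y n * x n)) \<longlongrightarrow> 0) U"

definition comm_path :: "nat filter \<Rightarrow> ('a::cstar_algebra \<Rightarrow> complex) \<Rightarrow> 'a \<Rightarrow> 'a \<Rightarrow> nat \<Rightarrow> bool" where
  "comm_path U \<tau> u v k \<longleftrightarrow> (\<exists>w :: nat \<Rightarrow> nat \<Rightarrow> 'a.
      w 0 = (\<lambda>n. u) \<and> w k = (\<lambda>n. v) \<and>
      (\<forall>i. 0 < i \<and> i < k \<longrightarrow> ultra_haar U \<tau> (w i)) \<and>
      (\<forall>i<k. ultra_commute U \<tau> (w i) (w (Suc i))))"

definition pdist :: "nat filter \<Rightarrow> ('a::cstar_algebra \<Rightarrow> complex) \<Rightarrow> 'a \<Rightarrow> 'a \<Rightarrow> enat" where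
  "pdist U \<tau> u v =
     (if u = v then 0
      else if (\<exists>k\<ge>1. comm_path U \<tau> u v k)
           then enat (LEAST k. k \<ge> 1 \<and> comm_path U \<tau> u v k)
           else \<infinity>)"

definition haar_equiv :: "nat filter \<Rightarrow> ('a::cstar_algebra \<Rightarrow> complex) \<Rightarrow> ('a \<times> 'a) set" where
  "haar_equiv U \<tau> = {(u, v). u \<in> haar \<tau> \<and> v \<in> haar \<tau> \<and> pdist U \<tau> u v < \<infinity>}"

definition frakR :: "nat filter \<Rightarrow> ('a::cstar_algebra \<Rightarrow> complex) \<Rightarrow> enat" where
  "frakR U \<tau> = Sup {pdist U \<tau> u v | u v. (u, v) \<in> haar_equiv U \<tau>}"

text \<open>The set of orbits of the relation on H(M); O(M) is its cardinality.\<close>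
definition orbits :: "nat filter \<Rightarrow> ('a::cstar_algebra \<Rightarrow> complex) \<Rightarrow> 'a set set" where
  "orbits U \<tau> = haar \<tau> // haar_equiv U \<tau>"

end

theory Submission
  imports Defs
begin

text \<open>
  The relation "joined by a commutation path of length \<open>k\<close> with representatives bounded by \<open>B\<close>" is
  closed in the 2-norm. Let \<open>Y\<close> be the 2-norm closure of the Haar unitaries built from dyadic trees
  of projections; every Haar unitary commutes with one of these. Either none of the countably many
  closed relations contains a product of two balls of \<open>Y\<close>, and a Cantor scheme yields continuum many
  inequivalent Haar unitaries, or all elements of \<open>Y\<close> near some tree-built \<open>u\<close> are joined to \<open>u\<close> by
  paths of bounded length. In the second case this extends to all conjugates \<open>g u g\<^sup>*\<close>, because every
  unitary is a product of boundedly many unitaries close to \<open>1\<close>. Moreover two finite families of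
  orthogonal projections can always be made to commute by conjugating one of them, so some conjugate
  of \<open>u\<close> and an arbitrary tree-built Haar unitary can be perturbed to commute. Hence all Haar
  unitaries are joined by paths of bounded length.
\<close>

section \<open>C*-algebra preliminaries\<close>

text \<open>On distinct Haar unitaries the orbit relation is the union of the closed relations
  \<open>approx_path k B\<close> with \<open>k \<ge> 1\<close>, so the alternative is one of Baire
  type. It works in a complete metric space without separability: the second case always gives at
  least continuum many orbits, and separability serves only to bound the number of elements of the
  algebra from above. Completeness is the reason for taking the closure of the tree-built unitaries,
  density of the latter the reason why a ball can be recentred at a tree-built \<open>u\<close>.
  Being tree-built matters because level \<open>l\<close> of the tree determines the unitary up to a
  multiple of 1/2^l in the 2-norm; closeness thereby becomes a statement on finitely many orthogonal
  projections. The tools from spectral theory are reduced to square roots of positive elements and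
  kernel projections of self-adjoint ones. Together these give signs, which stand in for the Borel
  functional calculus, for polar decomposition and for comparison of projections.\<close>

definition commutes :: "'a::times \<Rightarrow> 'a \<Rightarrow> bool" where
  "commutes x y \<longleftrightarrow> x * y = y * x"

lemma commutes_sym: "commutes x y \<Longrightarrow> commutes y x"
  by (simp add: commutes_def)

lemma commutes_refl [simp]: "commutes x x"
  by (simp add: commutes_def)

lemma commutes_add: "commutes x y \<Longrightarrow> commutes x z \<Longrightarrow> commutes x (y + z)"
  for x :: "'a::ring_1"
  by (simp add: commutes_def algebra_simps)

lemma commutes_diff: "commutes x y \<Longrightarrow> commutes x z \<Longrightarrow> commutes x (y - z)"
  for x :: "'a::ring_1"
  by (simp add: commutes_def algebra_simps)

lemma commutes_minus: "commutes x y \<Longrightarrow> commutes x (- y)"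
  for x :: "'a::ring_1"
  by (simp add: commutes_def)

lemma commutes_mult: "commutes x y \<Longrightarrow> commutes x z \<Longrightarrow> commutes x (y * z)"
  for x :: "'a::ring_1"
  unfolding commutes_def by (metis mult.assoc)

lemma commutes_one [simp]: "commutes x 1" "commutes 1 x"
  for x :: "'a::ring_1"
  by (simp_all add: commutes_def)

lemma commutes_zero [simp]: "commutes x 0" "commutes 0 x"
  for x :: "'a::ring_1"
  by (simp_all add: commutes_def)

lemma commutes_power: "commutes x y \<Longrightarrow> commutes x (y ^ n)"
  for x :: "'a::ring_1"
  by (induction n) (auto intro: commutes_mult)

lemma commutes_sum: "(\<And>i. i \<in> I \<Longrightarrow> commutes x (f i)) \<Longrightarrow> commutes x (sum f I)"
  for x :: "'a::ring_1"
  by (induction I rule: infinite_finite_induct) (auto intro: commutes_add)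

lemma commutes_lim:
  fixes x :: "'a::real_normed_algebra_1"
  assumes "\<And>n. commutes x (f n)" "f \<longlonglongrightarrow> y"
  shows "commutes x y"
proof -
  have "(\<lambda>n. x * f n) \<longlonglongrightarrow> x * y" "(\<lambda>n. f n * x) \<longlonglongrightarrow> y * x"
    by (intro tendsto_intros assms)+
  moreover have "(\<lambda>n. x * f n) = (\<lambda>n. f n * x)"
    using assms(1) by (simp add: commutes_def)
  ultimately show ?thesis
    using LIMSEQ_unique unfolding commutes_def by auto
qed

lemmas commutes_intros = commutes_add commutes_diff commutes_minus commutes_mult
  commutes_one commutes_zero commutes_power commutes_refl

lemma scaleC_zero_right [simp]: "scaleC c (0::'a::cstar_algebra) = 0"
  using scaleC_add_right[of c 0 0] by simp

lemma scaleC_zero_left [simp]: "scaleC 0 (x::'a::cstar_algebra) = 0"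
  using scaleC_add_left[of 0 0 x] by simp

lemma scaleC_minus_right [simp]: "scaleC c (- x::'a::cstar_algebra) = - scaleC c x"
  using scaleC_add_right[of c x "-x"] by (simp add: eq_neg_iff_add_eq_0 add.commute)

lemma scaleC_minus_left [simp]: "scaleC (- c) (x::'a::cstar_algebra) = - scaleC c x"
  using scaleC_add_left[of c "-c" x] by (simp add: eq_neg_iff_add_eq_0 add.commute)

lemma scaleC_diff_right: "scaleC c (x - y::'a::cstar_algebra) = scaleC c x - scaleC c y"
  using scaleC_add_right[of c x "-y"] by simp

lemma scaleC_diff_left: "scaleC (c - d) (x::'a::cstar_algebra) = scaleC c x - scaleC d x"
  using scaleC_add_left[of c "-d" x] by simp

lemma commutes_scaleC: "commutes x y \<Longrightarrow> commutes x (scaleC c y)"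
  for x :: "'a::cstar_algebra"
  by (simp add: commutes_def mult_scaleC_left mult_scaleC_right)

lemma commutes_scaleR: "commutes x y \<Longrightarrow> commutes x (scaleR c y)"
  for x :: "'a::cstar_algebra"
  by (simp add: commutes_def)

lemma adj_zero [simp]: "adj (0::'a::cstar_algebra) = 0"
  using adj_add[of 0 0] by simp

lemma adj_minus [simp]: "adj (- x::'a::cstar_algebra) = - adj x"
  using adj_add[of x "-x"] by (simp add: eq_neg_iff_add_eq_0 add.commute)

lemma adj_diff: "adj (x - y::'a::cstar_algebra) = adj x - adj y"
  using adj_add[of x "-y"] by simp

lemma adj_one [simp]: "adj (1::'a::cstar_algebra) = 1"
  by (metis adj_adj adj_mult mult.right_neutral mult_1)

lemma adj_scaleR [simp]: "adj (scaleR r x::'a::cstar_algebra) = scaleR r (adj x)"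
  by (simp add: scaleR_scaleC adj_scaleC)

lemma adj_power: "adj (x ^ n::'a::cstar_algebra) = adj x ^ n"
  by (induction n) (auto simp: adj_mult power_commutes)

lemma adj_sum: "adj (sum f I) = (\<Sum>i\<in>I. adj (f i :: 'a::cstar_algebra))"
  by (induction I rule: infinite_finite_induct) (auto simp: adj_add)

declare adj_adj [simp]

lemma norm_adj [simp]: "norm (adj x::'a::cstar_algebra) = norm x"
proof -
  have le: "norm y \<le> norm (adj y)" for y :: 'a
  proof (cases "norm y = 0")
    case False
    have "norm y * norm y \<le> norm (adj y) * norm y"
      using norm_mult_ineq[of "adj y" y] cstar_identity[of y] by (simp add: power2_eq_square)
    then show ?thesis using False by simp
  qed simp
  show ?thesis using le[of x] le[of "adj x"] by simp
qed

lemma tendsto_adj: "f \<longlonglongrightarrow> x \<Longrightarrow> (\<lambda>n. adj (f n::'a::cstar_algebra)) \<longlonglongrightarrow> adj x"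
  unfolding tendsto_iff dist_norm by (simp flip: adj_diff)

lemma adj_lim:
  assumes "\<And>n. adj (f n::'a::cstar_algebra) = f n" "f \<longlonglongrightarrow> x"
  shows "adj x = x"
  using tendsto_adj[OF assms(2)] assms LIMSEQ_unique by auto

lemma norm_self_adjoint_square: "adj a = a \<Longrightarrow> norm (a * a::'a::cstar_algebra) = (norm a)\<^sup>2"
  using cstar_identity[of a] by simp

lemma commutes_adj: "commutes x y \<Longrightarrow> commutes (adj x) (adj (y::'a::cstar_algebra))"
  by (metis commutes_def adj_mult)

text \<open>The square root \<open>c = 1 - y\<close> is found by iterating \<open>y = (z + y\<^sup>2) / 2\<close>, which the
  same scalar iteration with \<open>z = 1\<close> majorizes.\<close>

lemma sqrt_one_minus:
  fixes z :: "'a::cstar_algebra"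
  assumes z: "adj z = z" "norm z \<le> 1"
  obtains c where "adj c = c" "c * c = 1 - z" "norm (1 - c) \<le> norm z"
    "\<And>x. commutes x z \<Longrightarrow> commutes x c"
proof -
  define y where "y = rec_nat (0::'a) (\<lambda>_ v. scaleR (1/2) (z + v * v))"
  define s where "s = rec_nat (0::real) (\<lambda>_ v. (1 + v * v) / 2)"
  have y0: "y 0 = 0" and yS: "y (Suc n) = scaleR (1/2) (z + y n * y n)" for n
    by (simp_all add: y_def)
  have s0: "s 0 = 0" and sS: "s (Suc n) = (1 + s n * s n) / 2" for n
    by (simp_all add: s_def)
  have s1: "0 \<le> s n \<and> s n \<le> 1" for n
  proof (induction n)
    case (Suc n)
    then have "s n * s n \<le> 1" by (simp add: mult_le_one)
    then show ?case by (simp add: sS)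
  qed (simp add: s0)
  have "s n \<le> s (Suc n)" for n
  proof -
    have "0 \<le> (1 - s n) * (1 - s n)" by simp
    then show ?thesis by (simp add: sS algebra_simps)
  qed
  then have "incseq s" by (rule incseq_SucI)
  then have "convergent s"
    using incseq_convergent[of s 1] s1 unfolding convergent_def by metis
  have ny: "norm (y n) \<le> s n \<and> norm (y n) \<le> norm z" for n
  proof (induction n)
    case (Suc n)
    have a: "norm (y n * y n) \<le> norm (y n) * norm (y n)" by (rule norm_mult_ineq)
    have b: "norm (y n) * norm (y n) \<le> s n * s n" using Suc s1[of n] by (intro mult_mono) auto
    have "norm (y n) \<le> 1" using Suc z by linarith
    then have "norm (y n) * norm (y n) \<le> norm z * 1" using Suc by (intro mult_mono) auto
    moreover have "norm (z + y n * y n) \<le> norm z + norm (y n * y n)" by (rule norm_triangle_ineq)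
    ultimately show ?case using a b z unfolding yS sS by simp
  qed (simp add: y0 s0)
  \<comment> \<open>For \<open>norm z = 1\<close> the iteration is no strict contraction.
    Summability of the increments comes instead from those of \<open>s\<close>, which telescope
    because \<open>s\<close> is increasing and bounded.\<close>
  have dy: "norm (y (Suc n) - y n) \<le> s (Suc n) - s n" for n
  proof (induction n)
    case 0
    then show ?case using z by (simp add: y0 yS s0 sS)
  next
    case (Suc n)
    let ?d = "y (Suc n) - y n"
    have "y (Suc (Suc n)) - y (Suc n) = scaleR (1/2) (y (Suc n) * y (Suc n) - y n * y n)"
      unfolding yS[of "Suc n"] yS[of n] by (simp add: algebra_simps)
    also have "y (Suc n) * y (Suc n) - y n * y n = ?d * y (Suc n) + y n * ?d"
      by (simp add: algebra_simps)
    finally have "norm (y (Suc (Suc n)) - y (Suc n)) \<le> (norm (?d * y (Suc n)) + norm (y n * ?d)) / 2"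
      using norm_triangle_ineq[of "?d * y (Suc n)" "y n * ?d"] by simp
    also have "\<dots> \<le> (norm ?d * norm (y (Suc n)) + norm (y n) * norm ?d) / 2"
      by (intro divide_right_mono add_mono norm_mult_ineq) auto
    also have "\<dots> \<le> ((s (Suc n) - s n) * s (Suc n) + s n * (s (Suc n) - s n)) / 2"
      using Suc ny s1 \<open>incseq s\<close>[THEN incseq_SucD]
      by (intro divide_right_mono add_mono mult_mono) auto
    also have "\<dots> = s (Suc (Suc n)) - s (Suc n)"
      by (simp add: sS[of "Suc n"] sS[of n] field_simps)
    finally show ?case .
  qed
  have "summable (\<lambda>n. s (Suc n) - s n)"
    using \<open>convergent s\<close> telescope_summable by (auto simp: convergent_def)
  then have "summable (\<lambda>n. y (Suc n) - y n)"
    by (rule summable_comparison_test') (rule dy)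
  then have "convergent y"
    by (simp add: summable_iff_convergent sum_lessThan_telescope y0)
  then obtain l where l: "y \<longlonglongrightarrow> l" by (auto simp: convergent_def)
  have "(\<lambda>n. y (Suc n)) \<longlonglongrightarrow> scaleR (1/2) (z + l * l)"
    unfolding yS by (intro tendsto_intros l)
  then have eq: "l = scaleR (1/2) (z + l * l)"
    by (rule LIMSEQ_unique[OF LIMSEQ_Suc[OF l]])
  have "adj (y n) = y n" for n
    by (induction n) (simp_all add: y0 yS adj_add adj_mult z)
  then have al: "adj l = l" by (rule adj_lim[OF _ l])
  have nl: "norm l \<le> norm z"
    using tendsto_norm[OF l] ny by (intro LIMSEQ_le_const2) auto
  have cl: "commutes x l" if "commutes x z" for x
  proof -
    have "commutes x (y n)" for n
      by (induction n) (auto simp: y0 yS intro!: commutes_intros commutes_scaleR that)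
    then show ?thesis by (rule commutes_lim[OF _ l])
  qed
  have "scaleR 2 l = z + l * l" by (subst eq) simp
  then have "(1 - l) * (1 - l) = 1 - z"
    by (simp add: algebra_simps scaleR_2)
  then show ?thesis
    using al nl cl by (intro that[of "1 - l"]) (auto simp: adj_diff intro!: commutes_intros)
qed

lemma norm_unitary:
  assumes "unitary (u::'a::cstar_algebra)"
  shows "norm u = 1"
proof -
  have "(norm u)\<^sup>2 = 1" using assms cstar_identity[of u] by (simp add: unitary_def)
  then show ?thesis by (simp add: power2_eq_1_iff) (use norm_ge_zero[of u] in linarith)
qed

text \<open>If \<open>c\<close> is a square root of \<open>1 - d * d\<close> commuting with
  \<open>d\<close>, then d + i c is unitary and \<open>c\<close> is its imaginary part, hence a
  contraction. This replaces an argument with the spectrum of \<open>d * d\<close>.\<close>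

lemma norm_one_minus_square:
  fixes d :: "'a::cstar_algebra"
  assumes d: "adj d = d" "norm d \<le> 1"
  shows "norm (1 - d * d) \<le> 1"
proof -
  have "norm (d * d) \<le> 1"
    using d norm_self_adjoint_square[of d] by (simp add: power_le_one)
  then obtain c where c: "adj c = c" "c * c = 1 - d * d" and cc: "\<And>x. commutes x (d * d) \<Longrightarrow> commutes x c"
    using sqrt_one_minus[of "d * d"] d by (metis adj_mult)
  have dc: "d * c = c * d"
    using cc[of d] by (simp add: commutes_def mult.assoc)
  define u where "u = d + scaleC \<i> c"
  have au: "adj u = d - scaleC \<i> c"
    by (simp add: u_def adj_add adj_scaleC d c)
  have "adj u * u = 1" "u * adj u = 1"
    unfolding au by (simp_all add: u_def algebra_simps mult_scaleC_left mult_scaleC_right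
        scaleC_scaleC scaleC_diff_right scaleC_add_right dc c(2) scaleC_one)
  then have nu: "norm u = 1" by (intro norm_unitary) (simp add: unitary_def)
  have "scaleC \<i> c + scaleC \<i> c = u - adj u"
    unfolding au by (simp add: u_def)
  then have "scaleR 2 (scaleC \<i> c) = u - adj u" by (simp add: scaleR_2)
  then have "2 * norm c = norm (u - adj u)"
    by (metis norm_scaleR norm_scaleC abs_numeral norm_ii mult_1)
  also have "\<dots> \<le> 2" using norm_triangle_ineq4[of u "adj u"] nu by simp
  finally have "norm c \<le> 1" by simp
  then have "norm (c * c) \<le> 1"
    using norm_self_adjoint_square[OF c(1)] by (simp add: power_le_one)
  then show ?thesis using c by simp
qed

lemma norm_minus_square:
  fixes d :: "'a::cstar_algebra"
  assumes d: "adj d = d" "norm (d * d) \<le> t"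
  shows "norm (scaleR t 1 - d * d) \<le> t"
proof (cases "t = 0")
  case False
  then have t: "t > 0" using d(2) norm_ge_zero order_trans by (metis less_eq_real_def)
  define e where "e = scaleR (1 / sqrt t) d"
  have ee: "e * e = scaleR (1 / t) (d * d)" using t by (simp add: e_def)
  have "(norm d)\<^sup>2 \<le> t" using d norm_self_adjoint_square by metis
  then have "norm d \<le> sqrt t" by (simp add: real_le_rsqrt)
  then have "norm e \<le> 1" using t by (simp add: e_def)
  then have "norm (1 - e * e) \<le> 1"
    using norm_one_minus_square[of e] d by (simp add: e_def)
  moreover have "scaleR t 1 - d * d = scaleR t (1 - e * e)"
    unfolding ee using t by (simp add: scaleR_diff_right)
  ultimately show ?thesis using t by simp
qed (use d in simp)

text \<open>\<open>d * d\<close> is the absolute value of \<open>a\<close>.\<close>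

lemma abs_square_root:
  fixes a :: "'a::cstar_algebra"
  assumes a: "adj a = a"
  obtains d where "adj d = d" "(d * d) * (d * d) = a * a" "\<And>x. commutes x (a * a) \<Longrightarrow> commutes x d"
proof -
  define r where "r = norm a + 1"
  have r: "r > 0" unfolding r_def by (smt (verit) norm_ge_zero)
  define e where "e = scaleR (1 / r) a"
  have ae: "adj e = e" by (simp add: e_def a)
  have ne: "norm e \<le> 1" using r by (simp add: e_def r_def)
  have "adj (1 - e * e) = 1 - e * e" by (simp add: adj_diff adj_mult ae)
  then obtain c where c: "adj c = c" "c * c = e * e" "norm (1 - c) \<le> norm (1 - e * e)"
     "\<And>x. commutes x (1 - e * e) \<Longrightarrow> commutes x c"
    using sqrt_one_minus[OF _ norm_one_minus_square[OF ae ne]]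
    by (metis (no_types, lifting) add_diff_cancel_left' diff_add_cancel)
  \<comment> \<open>This bound permits a second root \<open>f * f = c\<close>. Exhibiting the
    absolute value as the square of a self-adjoint element is how positivity is expressed
    throughout.\<close>
  have "norm (1 - c) \<le> 1" using c(3) norm_one_minus_square[OF ae ne] by simp
  moreover have "adj (1 - c) = 1 - c" by (simp add: adj_diff c)
  ultimately obtain f where f: "adj f = f" "f * f = 1 - (1 - c)"
     "\<And>x. commutes x (1 - c) \<Longrightarrow> commutes x f"
    using sqrt_one_minus[of "1 - c"] by metis
  define d where "d = scaleR (sqrt r) f"
  have dd: "d * d = scaleR r c" using r f by (simp add: d_def)
  show thesis
  proof
    show "adj d = d" by (simp add: d_def f)
    have "(d * d) * (d * d) = scaleR (r * r) (e * e)"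
      unfolding dd using c(2) by simp
    also have "\<dots> = a * a" using r by (simp add: e_def)
    finally show "(d * d) * (d * d) = a * a" .
    show "commutes x d" if "commutes x (a * a)" for x
    proof -
      have "e * e = scaleR (1 / r * (1 / r)) (a * a)" by (simp add: e_def)
      then have "commutes x (e * e)" by (simp add: commutes_scaleR that del: mult_scaleR_left)
      then show ?thesis
        unfolding d_def by (intro commutes_scaleR f c commutes_diff commutes_one)
    qed
  qed
qed

section \<open>The 2-norm, kernel projections and signs\<close>

locale tracial =
  fixes \<tau> :: "'a::cstar_algebra \<Rightarrow> complex"
  assumes tracial_vna: "tracial_vna \<tau>"
begin

abbreviation n2 :: "'a \<Rightarrow> real" where "n2 \<equiv> norm2 \<tau>"

lemma state: "faithful_tracial_state \<tau>"
  using tracial_vna by (simp add: tracial_vna_def)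

lemma tau_add: "\<tau> (x + y) = \<tau> x + \<tau> y"
  and tau_scaleC: "\<tau> (scaleC c x) = c * \<tau> x"
  and Im_tau_square: "Im (\<tau> (adj x * x)) = 0"
  and Re_tau_square: "0 \<le> Re (\<tau> (adj x * x))"
  and tau_faithful: "\<tau> (adj x * x) = 0 \<Longrightarrow> x = 0"
  and tau_one: "\<tau> 1 = 1"
  and tau_commute: "\<tau> (x * y) = \<tau> (y * x)"
  using state unfolding faithful_tracial_state_def by blast+

lemma tau_zero [simp]: "\<tau> 0 = 0"
  using tau_add[of 0 0] by simp

lemma tau_minus: "\<tau> (- x) = - \<tau> x"
  using tau_add[of x "-x"] by (simp add: eq_neg_iff_add_eq_0 add.commute)

lemma tau_diff: "\<tau> (x - y) = \<tau> x - \<tau> y"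
  using tau_add[of x "-y"] by (simp add: tau_minus)

lemma tau_scaleR: "\<tau> (scaleR r x) = complex_of_real r * \<tau> x"
  by (simp add: scaleR_scaleC tau_scaleC)

lemma tau_sum: "\<tau> (sum f I) = (\<Sum>i\<in>I. \<tau> (f i))"
  by (induction I rule: infinite_finite_induct) (auto simp: tau_add)

text \<open>Only squares are known to have real trace. Those of 1 + x and 1 + i x yield the
  imaginary and the real part of the identity.\<close>

lemma tau_adj: "\<tau> (adj x) = cnj (\<tau> x)"
proof -
  have 1: "\<tau> (adj (1 + x) * (1 + x)) = 1 + \<tau> x + \<tau> (adj x) + \<tau> (adj x * x)"
    by (simp add: adj_add algebra_simps tau_add tau_one)
  have 2: "\<tau> (adj (1 + scaleC \<i> x) * (1 + scaleC \<i> x)) = 1 + \<i> * \<tau> x - \<i> * \<tau> (adj x) + \<tau> (adj x * x)"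
    by (simp add: adj_add algebra_simps tau_add tau_one adj_scaleC mult_scaleC_left mult_scaleC_right
        scaleC_scaleC scaleC_one tau_scaleC tau_minus tau_diff scaleC_diff_right scaleC_add_right)
  show ?thesis
    using Im_tau_square[of "1 + x"] Im_tau_square[of "1 + scaleC \<i> x"] Im_tau_square[of x]
    unfolding 1 2 by (simp add: complex_eq_iff)
qed

lemma n2_square: "(n2 x)\<^sup>2 = Re (\<tau> (adj x * x))"
  by (simp add: norm2_def Re_tau_square)

lemma tau_square: "\<tau> (adj x * x) = complex_of_real ((n2 x)\<^sup>2)"
  by (simp add: n2_square complex_eq_iff Im_tau_square)

lemma n2_nonneg [simp]: "0 \<le> n2 x"
  by (simp add: norm2_def Re_tau_square)

lemma n2_eq_0_iff [simp]: "n2 x = 0 \<longleftrightarrow> x = 0"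
  using tau_square[of x] tau_faithful[of x] by (auto simp: norm2_def)

lemma n2_zero [simp]: "n2 0 = 0"
  by (simp only: n2_eq_0_iff)

lemma n2_adj [simp]: "n2 (adj x) = n2 x"
  unfolding norm2_def using tau_commute[of x "adj x"] by simp

lemma n2_scaleC: "n2 (scaleC c x) = cmod c * n2 x"
proof -
  have "adj (scaleC c x) * scaleC c x = scaleC (c * cnj c) (adj x * x)"
    by (simp add: adj_scaleC mult_scaleC_left mult_scaleC_right scaleC_scaleC mult.commute)
  then have "\<tau> (adj (scaleC c x) * scaleC c x) = complex_of_real ((cmod c)\<^sup>2 * (n2 x)\<^sup>2)"
    unfolding complex_norm_square tau_square[symmetric] by (simp add: tau_scaleC tau_square complex_norm_square del: of_real_power)
  then show ?thesis
    by (simp add: norm2_def[of _ "scaleC c x"] real_sqrt_mult)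
qed

lemma n2_scaleR: "n2 (scaleR r x) = \<bar>r\<bar> * n2 x"
  by (simp add: scaleR_scaleC n2_scaleC)

lemma n2_minus [simp]: "n2 (- x) = n2 x"
  by (simp add: norm2_def)

lemma n2_minus_commute: "n2 (x - y) = n2 (y - x)"
  using n2_minus[of "x - y"] by simp

text \<open>Cauchy-Schwarz. With the weights in \<open>z\<close> the square expands to 2
  \<open>n2 x * n2 y\<close> times the defect of the inequality.\<close>

lemma Re_tau_le: "Re (\<tau> (adj y * x)) \<le> n2 y * n2 x"
proof (cases "x = 0 \<or> y = 0")
  case False
  then have p: "n2 x > 0" "n2 y > 0" using n2_nonneg by (simp_all add: less_le)
  define z where "z = scaleR (n2 y) x - scaleR (n2 x) y"
  have "\<tau> (adj x * y) = cnj (\<tau> (adj y * x))"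
    by (simp flip: tau_adj add: adj_mult)
  then have "Re (\<tau> (adj z * z)) = 2 * (n2 x)\<^sup>2 * (n2 y)\<^sup>2 - 2 * n2 x * n2 y * Re (\<tau> (adj y * x))"
    by (simp add: z_def adj_diff algebra_simps tau_diff tau_add tau_scaleR tau_square power2_eq_square)
  then have "0 \<le> 2 * (n2 x * n2 y) * (n2 x * n2 y - Re (\<tau> (adj y * x)))"
    using Re_tau_square[of z] by (simp add: algebra_simps power2_eq_square)
  moreover have "0 < 2 * (n2 x * n2 y)" using p by simp
  ultimately have "0 \<le> n2 x * n2 y - Re (\<tau> (adj y * x))"
    by (metis linorder_not_le mult_pos_neg)
  then show ?thesis by (simp add: mult.commute)
qed auto

lemma n2_triangle: "n2 (x + y) \<le> n2 x + n2 y"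
proof -
  have "\<tau> (adj x * y) = cnj (\<tau> (adj y * x))"
    by (simp flip: tau_adj add: adj_mult)
  then have "(n2 (x + y))\<^sup>2 = (n2 x)\<^sup>2 + 2 * Re (\<tau> (adj y * x)) + (n2 y)\<^sup>2"
    by (simp add: n2_square adj_add algebra_simps tau_add)
  also have "\<dots> \<le> (n2 x + n2 y)\<^sup>2"
    using Re_tau_le[of y x] by (simp add: power2_eq_square algebra_simps)
  finally show ?thesis by (rule power2_le_imp_le) simp
qed

lemma n2_triangle_diff: "n2 (x - z) \<le> n2 (x - y) + n2 (y - z)"
  using n2_triangle[of "x - y" "y - z"] by simp

lemma n2_triangle_minus: "n2 (x - y) \<le> n2 x + n2 y"
  using n2_triangle[of x "- y"] by simp

lemma norm_tau_le: "cmod (\<tau> x) \<le> n2 x"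
proof (cases "\<tau> x = 0")
  case False
  define c where "c = cnj (\<tau> x) / cmod (\<tau> x)"
  have "cmod c = 1" using False by (simp add: c_def norm_divide)
  have "c * \<tau> x = complex_of_real (cmod (\<tau> x))"
    using False by (simp add: c_def complex_norm_square[symmetric] power2_eq_square field_simps flip: of_real_mult)
  then have "cmod (\<tau> x) = Re (\<tau> (adj 1 * scaleC c x))"
    by (simp add: tau_scaleC)
  also have "\<dots> \<le> n2 1 * n2 (scaleC c x)" by (rule Re_tau_le)
  also have "\<dots> = n2 x" using \<open>cmod c = 1\<close> by (simp add: n2_scaleC norm2_def[of _ 1] tau_one)
  finally show ?thesis .
qed simp

text \<open>For \<open>b\<close> of norm 1 the defect \<open>1 - adj b * b\<close> is the square of
  a self-adjoint \<open>c\<close>, so the squared 2-norms of \<open>x\<close> and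
  \<open>b * x\<close> differ by that of \<open>c * x\<close>.\<close>

lemma n2_mult_left: "n2 (a * x) \<le> norm a * n2 x"
proof (cases "a = 0")
  case False
  define b where "b = scaleR (1 / norm a) a"
  have b: "norm b = 1" "a = scaleR (norm a) b" using False by (simp_all add: b_def)
  have "norm (adj b * b) \<le> 1" using b by (simp add: cstar_identity)
  moreover have "adj (adj b * b) = adj b * b" by (simp add: adj_mult)
  ultimately obtain c where c: "adj c = c" "c * c = 1 - adj b * b"
    using sqrt_one_minus by metis
  have "adj x * x - adj (b * x) * (b * x) = adj x * (1 - adj b * b) * x"
    by (simp add: adj_mult algebra_simps)
  also have "\<dots> = adj (c * x) * (c * x)" by (simp add: adj_mult c flip: c(2)) (simp add: mult.assoc)
  finally have "\<tau> (adj x * x) - \<tau> (adj (b * x) * (b * x)) = \<tau> (adj (c * x) * (c * x))"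
    by (metis tau_diff)
  then have "(n2 x)\<^sup>2 - (n2 (b * x))\<^sup>2 = (n2 (c * x))\<^sup>2"
    unfolding n2_square by (metis minus_complex.simps(1))
  then have "(n2 (b * x))\<^sup>2 \<le> (n2 x)\<^sup>2"
    by (smt (verit) zero_le_power2)
  then have "n2 (b * x) \<le> n2 x" by (rule power2_le_imp_le) simp
  then have "norm a * n2 (b * x) \<le> norm a * n2 x" by (intro mult_left_mono) auto
  moreover have "n2 (a * x) = norm a * n2 (b * x)"
    by (subst b(2)) (simp add: n2_scaleR)
  ultimately show ?thesis by simp
qed simp

lemma n2_mult_right: "n2 (x * a) \<le> n2 x * norm a"
  using n2_mult_left[of "adj a" "adj x"] by (simp add: mult.commute flip: adj_mult)

lemma n2_one [simp]: "n2 1 = 1"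
  by (simp add: norm2_def tau_one)

lemma n2_le_norm: "n2 x \<le> norm x"
  using n2_mult_left[of x 1] by simp

section \<open>Convergence in the 2-norm\<close>

definition conv2 :: "(nat \<Rightarrow> 'a) \<Rightarrow> 'a \<Rightarrow> bool" where
  "conv2 f x \<longleftrightarrow> (\<lambda>n. n2 (f n - x)) \<longlonglongrightarrow> 0"

lemma conv2_null:
  assumes "g \<longlonglongrightarrow> c" "c = 0" "\<And>n. n2 (f n - x) \<le> g n"
  shows "conv2 f x"
  unfolding conv2_def
proof (rule Lim_null_comparison)
  show "\<forall>\<^sub>F n in sequentially. norm (n2 (f n - x)) \<le> g n" using assms(3) by simp
  show "g \<longlonglongrightarrow> 0" using assms by simp
qed

lemma conv2_le:
  assumes "conv2 f x" "\<And>n. n2 (g n - y) \<le> C * n2 (f n - x)"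
  shows "conv2 g y"
proof -
  have "(\<lambda>n. C * n2 (f n - x)) \<longlonglongrightarrow> C * 0"
    using assms(1) unfolding conv2_def by (intro tendsto_intros)
  then show ?thesis by (rule conv2_null) (simp_all add: assms(2))
qed

lemma conv2_const [simp]: "conv2 (\<lambda>_. x) x"
  by (simp add: conv2_def)

lemma conv2_unique:
  assumes "conv2 f x" "conv2 f y"
  shows "x = y"
proof -
  have "(\<lambda>n. n2 (f n - x) + n2 (f n - y)) \<longlonglongrightarrow> 0 + 0"
    using assms unfolding conv2_def by (intro tendsto_intros)
  moreover have "n2 (x - y) \<le> n2 (f n - x) + n2 (f n - y)" for n
    using n2_triangle_diff[of x y "f n"] by (simp add: n2_minus_commute)
  ultimately have "n2 (x - y) \<le> 0"
    by (intro LIMSEQ_le_const[of _ _ "n2 (x - y)"]) auto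
  then have "n2 (x - y) = 0" using n2_nonneg[of "x - y"] by linarith
  then show ?thesis by simp
qed

text \<open>In \<open>f n * (g n - y) + (f n - x) * y\<close> the left factors need a common
  operator-norm bound, while on the right only the fixed limit \<open>y\<close> occurs.\<close>

lemma conv2_mult:
  assumes "conv2 f x" "conv2 g y" "\<And>n. norm (f n) \<le> C"
  shows "conv2 (\<lambda>n. f n * g n) (x * y)"
proof -
  have "(\<lambda>n. C * n2 (g n - y) + n2 (f n - x) * norm y) \<longlonglongrightarrow> C * 0 + 0 * norm y"
    using assms unfolding conv2_def by (intro tendsto_intros)
  moreover have "n2 (f n * g n - x * y) \<le> C * n2 (g n - y) + n2 (f n - x) * norm y" for n
  proof -
    have "f n * g n - x * y = f n * (g n - y) + (f n - x) * y" by (simp add: algebra_simps)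
    then have "n2 (f n * g n - x * y) \<le> n2 (f n * (g n - y)) + n2 ((f n - x) * y)"
      using n2_triangle by simp
    also have "\<dots> \<le> norm (f n) * n2 (g n - y) + n2 (f n - x) * norm y"
      by (intro add_mono n2_mult_left n2_mult_right)
    also have "\<dots> \<le> C * n2 (g n - y) + n2 (f n - x) * norm y"
      using assms(3)[of n] by (intro add_mono mult_right_mono) auto
    finally show ?thesis .
  qed
  ultimately show ?thesis by (intro conv2_null[of _ _ "\<lambda>n. f n * g n"]) auto
qed

lemma conv2_mult_left: "conv2 f x \<Longrightarrow> conv2 (\<lambda>n. a * f n) (a * x)"
  by (rule conv2_mult[OF conv2_const]) auto

lemma conv2_mult_right: "conv2 f x \<Longrightarrow> conv2 (\<lambda>n. f n * a) (x * a)"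
  by (erule conv2_le[where C="norm a"])
     (metis left_diff_distrib mult.commute n2_mult_right)

lemma conv2_adj: "conv2 f x \<Longrightarrow> conv2 (\<lambda>n. adj (f n)) (adj x)"
  by (simp add: conv2_def flip: adj_diff)

lemma conv2_power:
  assumes "conv2 f x" "\<And>n. norm (f n) \<le> 1"
  shows "conv2 (\<lambda>n. f n ^ k) (x ^ k)"
proof (induction k)
  case (Suc k)
  then show ?case unfolding power_Suc by (intro conv2_mult[OF assms(1)]) (auto intro: assms)
qed simp

lemma conv2_tau:
  assumes "conv2 f x"
  shows "(\<lambda>n. \<tau> (f n)) \<longlonglongrightarrow> \<tau> x"
proof -
  have "cmod (\<tau> (f n) - \<tau> x) \<le> n2 (f n - x)" for n
    by (simp flip: tau_diff add: norm_tau_le)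
  then have "(\<lambda>n. \<tau> (f n) - \<tau> x) \<longlonglongrightarrow> 0"
    by (intro Lim_null_comparison[OF _ assms[unfolded conv2_def]]) simp
  then show ?thesis by (simp add: LIM_zero_iff)
qed

lemma conv2_commutes:
  assumes "conv2 f x" "\<And>n. commutes a (f n)"
  shows "commutes a x"
proof -
  have "(\<lambda>n. a * f n) = (\<lambda>n. f n * a)" using assms(2) by (simp add: commutes_def)
  then show ?thesis
    using conv2_unique conv2_mult_left[OF assms(1), of a] conv2_mult_right[OF assms(1), of a]
    unfolding commutes_def by metis
qed

lemma conv2_adj_self: "conv2 f x \<Longrightarrow> (\<And>n. adj (f n) = f n) \<Longrightarrow> adj x = x"
  using conv2_adj[of f x] conv2_unique by auto

lemma conv2_complete:
  assumes "\<And>n. norm (f n) \<le> 1" "\<And>e. e > 0 \<Longrightarrow> \<exists>N. \<forall>m\<ge>N. \<forall>n\<ge>N. n2 (f m - f n) < e"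
  obtains x where "norm x \<le> 1" "conv2 f x"
  using tracial_vna assms unfolding tracial_vna_def conv2_def by blast

text \<open>The kernel projection of \<open>a\<close> is the limit of the powers of \<open>1 - a\<^sup>2\<close>, for \<open>a\<close>
  scaled to a contraction; their traces decrease, which makes them Cauchy in the 2-norm.\<close>

lemma kernel_projection:
  fixes a :: 'a
  assumes a: "adj a = a"
  obtains k where "is_projection k" "k * a = 0" "a * k = 0" "\<And>x. a * x = 0 \<Longrightarrow> k * x = x"
    "\<And>x. commutes x a \<Longrightarrow> commutes x k"
proof -
  define r where "r = norm a + 1"
  have r: "r > 0" unfolding r_def by (smt (verit) norm_ge_zero)
  define d where "d = scaleR (1 / r) a"
  have ad: "adj d = d" by (simp add: d_def a)
  have nd: "norm d \<le> 1" using r by (simp add: d_def r_def)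
  define x where "x = 1 - d * d"
  have nx: "norm x \<le> 1" using norm_one_minus_square[OF ad nd] by (simp add: x_def)
  have ax: "adj x = x" by (simp add: x_def adj_diff adj_mult ad)
  have "norm (d * d) \<le> 1"
    using ad nd norm_self_adjoint_square[of d] by (simp add: power_le_one)
  then obtain c where c: "adj c = c" "c * c = x" and cc: "\<And>x. commutes x (d * d) \<Longrightarrow> commutes x c"
    using sqrt_one_minus[of "d * d"] ad unfolding x_def by (metis adj_mult)
  have dc: "commutes d c" by (intro cc commutes_intros)
  have nxn: "norm (x ^ n) \<le> 1" for n
    using norm_power_ineq[of x n] nx by (meson norm_ge_zero order_trans power_le_one)
  define t where "t n = Re (\<tau> (x ^ n))" for n
  have xn: "x ^ n = adj (c ^ n) * c ^ n" for n
    by (metis adj_power c mult.commute power2_eq_square power_mult)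
  have "decseq t"
  proof (rule decseq_SucI)
    fix n
    have "x ^ n - x ^ Suc n = x ^ n * (d * d)"
      unfolding power_Suc2 by (simp add: x_def algebra_simps)
    also have "\<dots> = adj (d * c ^ n) * (d * c ^ n)"
    proof -
      have "commutes d (c ^ n)" by (intro commutes_power dc)
      then show ?thesis unfolding xn adj_mult ad adj_power c commutes_def
        by (metis mult.assoc)
    qed
    finally have "0 \<le> Re (\<tau> (x ^ n - x ^ Suc n))" using Re_tau_square by simp
    then show "t (Suc n) \<le> t n" by (simp add: t_def tau_diff)
  qed
  moreover have "0 \<le> t n" for n unfolding t_def xn by (rule Re_tau_square)
  ultimately obtain L where L: "t \<longlonglongrightarrow> L"
    using decseq_convergent[of t 0] by metis
  \<comment> \<open>Since \<open>x\<close> is self-adjoint, products of its powers are powers again,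
    and distances are combinations of values of the convergent sequence \<open>t\<close>. The
    coefficients cancel at the limit and have absolute sum 4, whence the tolerance
    \<open>e\<^sup>2 / 8\<close> below.\<close>
  have n2x: "(n2 (x ^ m - x ^ n))\<^sup>2 = t (m + m) + t (n + n) - 2 * t (m + n)" for m n
    by (simp add: n2_square adj_diff adj_power ax algebra_simps tau_diff tau_add t_def flip: power_add)
  obtain k where k: "norm k \<le> 1" "conv2 (\<lambda>n. x ^ n) k"
  proof (rule conv2_complete[of "\<lambda>n. x ^ n"])
    fix e :: real assume e: "e > 0"
    then have "e\<^sup>2 / 8 > 0" by simp
    then obtain N where N: "\<And>n. n \<ge> N \<Longrightarrow> \<bar>t n - L\<bar> < e\<^sup>2 / 8"
      using LIMSEQ_D[OF L] by (metis real_norm_def)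
    have "n2 (x ^ m - x ^ n) < e" if mn: "m \<ge> N" "n \<ge> N" for m n
    proof (rule power2_less_imp_less)
      have "\<bar>t (m + m) - L\<bar> < e\<^sup>2 / 8" "\<bar>t (n + n) - L\<bar> < e\<^sup>2 / 8" "\<bar>t (m + n) - L\<bar> < e\<^sup>2 / 8"
        using mn by (intro N; simp)+
      then show "(n2 (x ^ m - x ^ n))\<^sup>2 < e\<^sup>2" unfolding n2x by linarith
    qed (use e in simp)
    then show "\<exists>N. \<forall>m\<ge>N. \<forall>n\<ge>N. n2 (x ^ m - x ^ n) < e" by blast
  qed (use nxn in auto)
  have kx: "k * x = k"
  proof (rule conv2_unique)
    show "conv2 (\<lambda>n. x ^ n * x) (k * x)" by (rule conv2_mult_right[OF k(2)])
    have "(\<lambda>n. n2 (x ^ Suc n - k)) \<longlonglongrightarrow> 0"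
      using k(2) LIMSEQ_Suc unfolding conv2_def by fastforce
    then show "conv2 (\<lambda>n. x ^ n * x) k" unfolding conv2_def power_Suc2 .
  qed
  have kk: "k * k = k"
  proof (rule conv2_unique)
    show "conv2 (\<lambda>n. x ^ n * k) (k * k)" by (rule conv2_mult_right[OF k(2)])
    have "commutes x (x ^ n)" for n by (intro commutes_power commutes_refl)
    then have "commutes k x" by (intro commutes_sym[OF conv2_commutes[OF k(2)]])
    then have "x ^ n * k = k" for n
      by (induction n) (use kx in \<open>auto simp: commutes_def mult.assoc\<close>)
    then show "conv2 (\<lambda>n. x ^ n * k) k" by simp
  qed
  have ak: "adj k = k" by (rule conv2_adj_self[OF k(2)]) (simp add: adj_power ax)
  have comm: "commutes y k" if "commutes y a" for y
  proof (rule conv2_commutes[OF k(2)])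
    show "commutes y (x ^ n)" for n
      unfolding x_def d_def by (intro commutes_intros commutes_scaleR that)
  qed
  have "commutes k d"
    unfolding d_def by (rule commutes_scaleR[OF commutes_sym[OF comm[OF commutes_refl]]])
  then have "(k * d) * adj (k * d) = k * (d * d)"
    by (metis ad ak adj_mult commutes_def kk mult.assoc)
  also have "\<dots> = 0" using kx by (simp add: x_def algebra_simps)
  finally have "norm (adj (k * d)) ^ 2 = 0"
    using cstar_identity[of "adj (k * d)"] by simp
  then have "k * d = 0" by simp
  then have ka: "k * a = 0" using r by (simp add: d_def)
  show thesis
  proof
    show "is_projection k" by (simp add: is_projection_def ak kk)
    show "k * a = 0" by (fact ka)
    show "a * k = 0" using ka comm[of a] by (simp add: commutes_def)
    show "commutes y k" if "commutes y a" for y by (fact comm[OF that])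
    show "k * y = y" if "a * y = 0" for y
    proof (rule conv2_unique)
      show "conv2 (\<lambda>n. x ^ n * y) (k * y)" by (rule conv2_mult_right[OF k(2)])
      have "d * y = 0" using that by (simp add: d_def)
      then have "x * y = y" by (simp add: x_def left_diff_distrib mult.assoc)
      then have "x ^ n * y = y" for n by (induction n) (auto simp: mult.assoc)
      then show "conv2 (\<lambda>n. x ^ n * y) y" by simp
    qed
  qed
qed

text \<open>The sign of \<open>a\<close>: \<open>f\<close> is the kernel projection of the negative part of \<open>a\<close>, and
  \<open>d * d\<close> is the absolute value of \<open>a\<close>.\<close>

lemma sign_projection:
  fixes a :: 'a
  assumes a: "adj a = a"
  obtains f d where "is_projection f" "adj d = d" "(2 * f - 1) * a = d * d"
    "\<And>x. commutes x a \<Longrightarrow> commutes x f" "\<And>x. commutes x (a * a) \<Longrightarrow> commutes x d"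
    "\<And>x. a * x = 0 \<Longrightarrow> f * x = x"
proof -
  obtain d where d: "adj d = d" "(d * d) * (d * d) = a * a" "\<And>x. commutes x (a * a) \<Longrightarrow> commutes x d"
    using abs_square_root[OF a] by blast
  define b where "b = d * d"
  have bb: "b * b = a * a" using d by (simp add: b_def)
  have ba: "b * a = a * b"
    using d(3)[of a] unfolding b_def by (metis commutes_def commutes_mult commutes_refl)
  have ab: "adj b = b" by (simp add: b_def adj_mult d)
  have abb: "adj (b - a) = b - a" by (simp add: adj_diff a ab)
  have pm: "(b - a) * (b + a) = 0" by (simp add: algebra_simps bb ba)
  obtain f where f: "is_projection f" "f * (b - a) = 0" "\<And>x. (b - a) * x = 0 \<Longrightarrow> f * x = x"
    "\<And>x. commutes x (b - a) \<Longrightarrow> commutes x f"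
    using kernel_projection[OF abb] by metis
  \<comment> \<open>\<open>f\<close> fixes \<open>b + a\<close> and kills \<open>b - a\<close>; the
    difference of the two relations computes \<open>2 * (f * a)\<close>.\<close>
  have "f * (b + a) = b + a" using f(3) pm by simp
  with f(2) have "2 * (f * a) = b + a"
    by (simp add: algebra_simps) (metis add.assoc mult_2)
  then have sa: "(2 * f - 1) * a = b" by (simp add: algebra_simps)
  show thesis
  proof
    show "is_projection f" "adj d = d" by fact+
    show "(2 * f - 1) * a = d * d" using sa b_def by simp
    show "commutes x d" if "commutes x (a * a)" for x by (rule d(3)[OF that])
    show "commutes x f" if "commutes x a" for x
      unfolding b_def by (intro f(4)) (auto simp: b_def intro!: commutes_diff commutes_mult d(3) that)
    show "f * x = x" if "a * x = 0" for x
    proof (rule f(3))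
      have "b * (b * x) = 0" using bb that by (metis mult.assoc mult_zero_right)
      then have "adj (b * x) * (b * x) = 0" by (simp add: adj_mult ab mult.assoc)
      then have "b * x = 0" using cstar_identity[of "b * x"] by simp
      then show "(b - a) * x = 0" by (simp add: left_diff_distrib that)
    qed
  qed
qed

end

section \<open>Commuting projections and factorization of unitaries\<close>

lemma commutes_left: "commutes x y \<Longrightarrow> x * (y * z) = y * (x * z)"
  for x :: "'a::ring_1"
  unfolding commutes_def by (metis mult.assoc)

lemma adj_two [simp]: "adj 2 = (2::'a::cstar_algebra)"
  by (metis adj_add adj_one one_add_one)

lemma unitary_one [simp]: "unitary (1::'a::cstar_algebra)"
  by (simp add: unitary_def)

lemma unitary_mult: "unitary x \<Longrightarrow> unitary y \<Longrightarrow> unitary (x * y :: 'a::cstar_algebra)"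
  unfolding unitary_def adj_mult by (metis mult.assoc mult_1)

lemma unitary_adj: "unitary x \<Longrightarrow> unitary (adj x :: 'a::cstar_algebra)"
  by (simp add: unitary_def)

lemma unitary_cancel:
  assumes "unitary (g::'a::cstar_algebra)"
  shows "g * adj g = 1" "adj g * g = 1" "g * (adj g * x) = x" "adj g * (g * x) = x"
  using assms unfolding unitary_def by (metis mult.assoc mult_1)+

lemma norm_is_projection:
  assumes "is_projection (p::'a::cstar_algebra)"
  shows "norm p \<le> 1"
proof -
  have "norm p = norm p * norm p"
    using assms cstar_identity[of p] by (simp add: is_projection_def power2_eq_square)
  then show ?thesis by (metis mult_cancel_right1 order_refl norm_zero norm_eq_zero zero_le_one)
qed

lemma is_projection_compl: "is_projection p \<Longrightarrow> is_projection (1 - p :: 'a::cstar_algebra)"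
  by (simp add: is_projection_def adj_diff algebra_simps)

lemma is_projection_one [simp]: "is_projection (1 :: 'a::cstar_algebra)"
  by (simp add: is_projection_def)

lemma is_projection_zero [simp]: "is_projection (0 :: 'a::cstar_algebra)"
  by (simp add: is_projection_def)

lemma is_projection_mult:
  assumes "is_projection p" "is_projection q" "commutes p (q :: 'a::cstar_algebra)"
  shows "is_projection (p * q)"
  using assms unfolding is_projection_def commutes_def adj_mult by (metis mult.assoc)

lemma is_projection_add:
  assumes "is_projection p" "is_projection q" "p * q = (0 :: 'a::cstar_algebra)"
  shows "is_projection (p + q)"
proof -
  have "q * p = 0" using assms by (metis adj_mult adj_zero is_projection_def)
  then show ?thesis using assms by (simp add: is_projection_def adj_add algebra_simps)
qed

lemma is_projection_diff:
  assumes "is_projection p" "is_projection q" "p * q = (q :: 'a::cstar_algebra)"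
  shows "is_projection (p - q)"
proof -
  have "q * p = q" using assms by (metis adj_mult is_projection_def)
  then show ?thesis using assms by (simp add: is_projection_def adj_diff algebra_simps)
qed

lemma is_projection_sum:
  assumes "finite I" "\<And>i. i \<in> I \<Longrightarrow> is_projection (p i :: 'a::cstar_algebra)"
    "\<And>i j. i \<in> I \<Longrightarrow> j \<in> I \<Longrightarrow> i \<noteq> j \<Longrightarrow> p i * p j = 0"
  shows "is_projection (sum p I)"
  using assms
proof (induction I rule: finite_induct)
  case (insert i I)
  have "p i * sum p I = 0"
    unfolding sum_distrib_left by (rule sum.neutral) (use insert in auto)
  then show ?case using insert by (auto intro!: is_projection_add)
qed simp

lemma is_projection_conj:
  "unitary g \<Longrightarrow> is_projection p \<Longrightarrow> is_projection (g * p * adj g :: 'a::cstar_algebra)"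
  unfolding is_projection_def adj_mult by (simp add: mult.assoc unitary_cancel) (metis mult.assoc)

text \<open>Taking for \<open>s\<close> the sign of \<open>p + q - 1\<close> works without any comparison of \<open>p\<close> and \<open>q\<close>:
  \<open>s\<close> carries \<open>p\<close> to \<open>q\<close> off the kernel \<open>k\<close> of \<open>p + q - 1\<close>, and \<open>p * k = (1 - q) * k\<close>.\<close>

lemma (in tracial) two_projections:
  fixes p q :: 'a
  assumes p: "is_projection p" and q: "is_projection q"
  obtains s where "unitary s" "commutes q (s * p * adj s)"
    "\<And>x. commutes x p \<Longrightarrow> commutes x q \<Longrightarrow> commutes x s"
proof -
  define a where "a = p + q - 1"
  have pq: "adj p = p" "p * p = p" "adj q = q" "q * q = q"
    using p q by (simp_all add: is_projection_def)
  have pp: "p * (p * x) = p * x" "q * (q * x) = q * x" for x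
    by (simp_all add: pq flip: mult.assoc)
  have aa: "adj a = a" by (simp add: a_def adj_add adj_diff pq)
  obtain f d where fd: "is_projection f" "adj d = d" "(2 * f - 1) * a = d * d"
    "\<And>x. commutes x a \<Longrightarrow> commutes x f" "\<And>x. commutes x (a * a) \<Longrightarrow> commutes x d"
    "\<And>x. a * x = 0 \<Longrightarrow> f * x = x"
    using sign_projection[OF aa] by metis
  have ff: "f * f = f" "adj f = f" using fd(1) by (simp_all add: is_projection_def)
  define s where "s = 2 * f - 1"
  have as: "adj s = s"
    unfolding s_def mult_2 by (simp add: adj_diff adj_add ff)
  have ss: "s * s = 1" unfolding s_def mult_2 by (simp add: algebra_simps ff)
  define b where "b = d * d"
  have sa: "s * a = b" by (simp add: s_def b_def fd)
  have sc: "commutes x s" if "commutes x a" for x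
    unfolding s_def mult_2 by (intro commutes_intros fd that)
  have sb: "s * b = a" unfolding sa[symmetric] by (simp add: ss flip: mult.assoc)
  have as': "a * s = b" using sc[of a] sa by (simp add: commutes_def)
  have bs: "b * s = a" unfolding as'[symmetric] by (simp add: ss mult.assoc)
  have "commutes p (a * a)" "commutes q (a * a)"
    by (simp_all add: commutes_def a_def algebra_simps pq pp)
  then have cb: "commutes p b" "commutes q b"
    unfolding b_def by (auto intro!: commutes_mult fd)
  have ap: "a * p = q * a" by (simp add: a_def algebra_simps pq)
  \<comment> \<open>As \<open>b\<close> is the absolute value of \<open>a\<close>, this places the
    difference of \<open>s * p * s\<close> and \<open>q\<close> under the kernel projection of
    \<open>b\<close>.\<close>
  have "b * (s * p * s - q) = 0"
  proof -
    have "b * (s * p * s) = a * p * s" by (simp add: bs flip: mult.assoc)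
    also have "\<dots> = q * b" by (simp add: ap as' mult.assoc)
    finally show ?thesis using cb by (simp add: right_diff_distrib commutes_def)
  qed
  moreover have "adj b = b" by (simp add: b_def adj_mult fd)
  then obtain k where k: "is_projection k" "b * k = 0" "\<And>x. b * x = 0 \<Longrightarrow> k * x = x"
    "\<And>x. commutes x b \<Longrightarrow> commutes x k"
    using kernel_projection by metis
  ultimately have kd: "k * (s * p * s - q) = s * p * s - q" by blast
  have ks: "commutes s k" by (intro k) (simp add: commutes_def sb bs)
  have kpq: "commutes p k" "commutes q k" using k(4) cb by auto
  \<comment> \<open>Under \<open>k\<close> the sign \<open>s\<close> acts as the identity and
    \<open>p + q\<close> as 1, so there \<open>s * p * s\<close> is \<open>p\<close>, that is
    \<open>1 - q\<close>. Together with \<open>q\<close> off \<open>k\<close> this gives q + k - 2 k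
    q, which commutes with \<open>q\<close>.\<close>
  have ak: "a * k = 0" using k(2) by (simp add: mult.assoc flip: sb)
  then have "f * k = k" by (rule fd)
  then have sk: "s * k = k" "k * s = k" unfolding mult_2 s_def
    using ks unfolding s_def commutes_def mult_2 by (simp_all add: algebra_simps)
  have "k * (s * p * s) = k * p"
  proof -
    have "k * (s * p * s) = k * p * s" by (simp add: sk flip: mult.assoc)
    also have "\<dots> = p * (k * s)" using kpq by (simp add: commutes_def flip: mult.assoc)
    finally show ?thesis using kpq by (simp add: sk commutes_def)
  qed
  moreover have "k * p = k - k * q"
    using ak kpq by (simp add: a_def commutes_def algebra_simps)
  ultimately have "s * p * s = q + (k - k * q - k * q)"
    using kd unfolding right_diff_distrib by (metis add.commute diff_add_cancel)
  then have "commutes q (s * p * adj s)"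
    unfolding as using kpq by (auto intro!: commutes_intros)
  moreover have "unitary s" by (simp add: unitary_def as ss)
  moreover have "commutes x s" if "commutes x p" "commutes x q" for x
    by (rule sc) (auto simp: a_def intro!: commutes_intros that)
  ultimately show thesis using that by blast
qed

text \<open>Induction on \<open>m\<close>: once the conjugate of \<open>p\<close> commutes with the
  earlier \<open>q i\<close>, only its part off their sum \<open>Q\<close> is rotated against
  \<open>q m\<close>. The rotation commutes with the earlier \<open>q i\<close>, as these are
  orthogonal both to that part and to \<open>q m\<close>, so nothing gained is lost. The last
  conclusion, saying that \<open>g\<close> commutes with whatever commutes with the data, protects
  earlier stages in \<open>partition_conj_commutes\<close>.\<close>

lemma (in tracial) projection_conj_commutes:
  fixes p :: 'a and m :: nat
  assumes p: "is_projection p" and q: "\<And>i. i < m \<Longrightarrow> is_projection (q i)"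
    and orth: "\<And>i j. i < m \<Longrightarrow> j < m \<Longrightarrow> i \<noteq> j \<Longrightarrow> q i * q j = 0"
  shows "\<exists>g. unitary g \<and> (\<forall>i<m. commutes (q i) (g * p * adj g)) \<and>
    (\<forall>x. commutes x p \<longrightarrow> (\<forall>i<m. commutes x (q i)) \<longrightarrow> commutes x g)"
  using q orth
proof (induction m)
  case 0
  then show ?case by (intro exI[of _ 1]) auto
next
  case (Suc m)
  then obtain g where g: "unitary g" "\<And>i. i < m \<Longrightarrow> commutes (q i) (g * p * adj g)"
    "\<And>x. commutes x p \<Longrightarrow> (\<forall>i<m. commutes x (q i)) \<Longrightarrow> commutes x g"
    by (metis less_SucI)
  define p' where "p' = g * p * adj g"
  have pp: "is_projection p'" unfolding p'_def by (rule is_projection_conj[OF g(1) p])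
  define Q where "Q = sum q {..<m}"
  have Q: "is_projection Q" unfolding Q_def by (rule is_projection_sum) (use Suc.prems in auto)
  have Qq: "Q * q m = 0"
    unfolding Q_def sum_distrib_right by (rule sum.neutral) (use Suc.prems in auto)
  have qQ: "q m * Q = 0"
    unfolding Q_def sum_distrib_left by (rule sum.neutral) (use Suc.prems in auto)
  have Qp: "commutes p' Q"
    unfolding Q_def by (rule commutes_sum) (use g(2) in \<open>auto simp: p'_def intro: commutes_sym\<close>)
  have "is_projection (p' * (1 - Q))"
    by (intro is_projection_mult pp is_projection_compl Q commutes_intros Qp)
  then obtain s where s: "unitary s" "commutes (q m) (s * (p' * (1 - Q)) * adj s)"
    "\<And>x. commutes x (p' * (1 - Q)) \<Longrightarrow> commutes x (q m) \<Longrightarrow> commutes x s"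
    using two_projections[OF _ Suc.prems(1)[of m]] by blast
  have qiQ: "q i * Q = q i" "Q * q i = q i" if "i < m" for i
  proof -
    have "(\<Sum>j<m. q i * q j) = (\<Sum>j<m. if j = i then q i else 0)"
      using Suc.prems(2)[of i] Suc.prems(1)[of i] that by (intro sum.cong) (auto simp: is_projection_def)
    then show "q i * Q = q i" using that by (simp add: Q_def sum_distrib_left)
    have "(\<Sum>j<m. q j * q i) = (\<Sum>j<m. if j = i then q i else 0)"
      using Suc.prems(2)[of _ i] Suc.prems(1)[of i] that by (intro sum.cong) (auto simp: is_projection_def)
    then show "Q * q i = q i" using that by (simp add: Q_def sum_distrib_right)
  qed
  have qs: "commutes (q i) s" if "i < m" for i
  proof (rule s(3))
    have "q i * (p' * (1 - Q)) = p' * (q i * (1 - Q))"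
      using g(2)[OF that] by (intro commutes_left) (simp add: p'_def)
    moreover have "(p' * (1 - Q)) * q i = 0" "q i * (1 - Q) = 0"
      using qiQ[OF that] by (simp_all add: algebra_simps mult.assoc)
    ultimately show "commutes (q i) (p' * (1 - Q))" by (simp add: commutes_def)
    show "commutes (q i) (q m)" using Suc.prems(2)[of i m] Suc.prems(2)[of m i] that
      by (simp add: commutes_def)
  qed
  have Qs: "commutes s Q" unfolding Q_def by (rule commutes_sum) (use qs in \<open>auto intro: commutes_sym\<close>)
  have Qs': "commutes (adj s) Q"
    using commutes_adj[OF Qs] Q by (simp add: is_projection_def)
  have "commutes (q i) (s * g * p * adj (s * g))" if "i < Suc m" for i
  proof (cases "i < m")
    case True
    have "commutes (q i) (adj s)"
      using commutes_adj[OF qs[OF True]] Suc.prems(1)[of i] True by (simp add: is_projection_def)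
    then have "commutes (q i) (s * p' * adj s)"
      using g(2)[OF True] by (intro commutes_mult qs[OF True]) (auto simp: p'_def)
    then show ?thesis by (simp add: p'_def adj_mult mult.assoc)
  next
    case False
    then have i: "i = m" using that by simp
    \<comment> \<open>The remaining part of \<open>p'\<close>, under \<open>Q\<close>, stays under
      \<open>Q\<close> after conjugation by \<open>s\<close> and is therefore orthogonal to
      \<open>q m\<close>.\<close>
    have "commutes (q m) (s * (p' * Q) * adj s)"
    proof -
      have 1: "s * (p' * Q) * adj s = Q * (s * p' * adj s)"
        using Qp Qs by (metis commutes_def mult.assoc)
      have 2: "s * (p' * Q) * adj s = (s * p' * adj s) * Q"
        using Qs' by (metis commutes_def mult.assoc)
      have "q m * (s * (p' * Q) * adj s) = 0" unfolding 1 by (simp add: qQ flip: mult.assoc)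
      moreover have "(s * (p' * Q) * adj s) * q m = 0" unfolding 2 by (simp add: Qq mult.assoc)
      ultimately show ?thesis by (simp add: commutes_def)
    qed
    from commutes_add[OF s(2) this] show ?thesis
      unfolding i by (simp add: p'_def adj_mult algebra_simps)
  qed
  moreover have "commutes x (s * g)" if x: "commutes x p" "\<forall>i<Suc m. commutes x (q i)" for x
  proof -
    have xg: "commutes x g" using g(3) x by simp
    \<comment> \<open>The hypotheses on \<open>x\<close> pass to \<open>adj x\<close> because the
      projections are self-adjoint; this yields that \<open>x\<close> commutes with
      \<open>adj g\<close> as well.\<close>
    have "commutes (adj x) g"
    proof (rule g(3))
      show "commutes (adj x) p" using commutes_adj[OF x(1)] p by (simp add: is_projection_def)
      show "\<forall>i<m. commutes (adj x) (q i)"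
        using x(2) Suc.prems(1) commutes_adj by (metis is_projection_def less_SucI)
    qed
    then have "commutes x (adj g)" using commutes_adj[of "adj x" g] by simp
    then have "commutes x p'" unfolding p'_def by (intro commutes_mult xg x)
    moreover have "commutes x Q" unfolding Q_def by (rule commutes_sum) (use x in auto)
    ultimately have "commutes x s" using x by (intro s(3)) (auto intro!: commutes_intros)
    then show ?thesis by (rule commutes_mult[OF _ xg])
  qed
  ultimately show ?case using unitary_mult[OF s(1) g(1)] by blast
qed

text \<open>Induction on \<open>n\<close>: with \<open>P\<close> the sum of the conjugates already
  treated, the next one is rotated against the cut-down projections \<open>q i * (1 - P)\<close>.
  The treated conjugates commute with all data of this rotation, hence with the rotation itself, and
  are left in place.\<close>

lemma (in tracial) partition_conj_commutes:
  fixes p q :: "nat \<Rightarrow> 'a"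
  assumes "\<And>j. j < n \<Longrightarrow> is_projection (p j)" "\<And>i j. i < n \<Longrightarrow> j < n \<Longrightarrow> i \<noteq> j \<Longrightarrow> p i * p j = 0"
    and q: "\<And>i. i < m \<Longrightarrow> is_projection (q i)" "\<And>i j. i < m \<Longrightarrow> j < m \<Longrightarrow> i \<noteq> j \<Longrightarrow> q i * q j = 0"
  shows "\<exists>g. unitary g \<and> (\<forall>j<n. \<forall>i<m. commutes (q i) (g * p j * adj g))"
  using assms(1,2)
proof (induction n)
  case 0
  then show ?case by (intro exI[of _ 1]) auto
next
  case (Suc n)
  then obtain g where g: "unitary g" and gc: "\<And>i j. j < n \<Longrightarrow> i < m \<Longrightarrow> commutes (q i) (g * p j * adj g)"
    by (metis less_SucI)
  define r where "r j = g * p j * adj g" for j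
  have r: "is_projection (r j)" if "j < Suc n" for j
    unfolding r_def by (rule is_projection_conj[OF g Suc.prems(1)[OF that]])
  have rr: "r i * r j = 0" if "i < Suc n" "j < Suc n" "i \<noteq> j" for i j
  proof -
    have "r i * r j = g * (p i * p j) * adj g"
      by (simp add: r_def mult.assoc unitary_cancel[OF g])
    then show ?thesis using Suc.prems(2) that by simp
  qed
  define P where "P = sum r {..<n}"
  have P: "is_projection P" unfolding P_def by (rule is_projection_sum) (use r rr in auto)
  have rP: "r n * P = 0"
    unfolding P_def sum_distrib_left by (rule sum.neutral) (use rr in auto)
  have Pr: "P * r n = 0"
    unfolding P_def sum_distrib_right by (rule sum.neutral) (use rr in auto)
  have qP: "commutes (q i) P" if "i < m" for i
    unfolding P_def by (rule commutes_sum) (use gc that in \<open>auto simp: r_def\<close>)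
  have q': "is_projection (q i * (1 - P))" if "i < m" for i
    by (intro is_projection_mult q is_projection_compl P commutes_intros qP that)
  have qq': "q i * (1 - P) * (q j * (1 - P)) = 0" if "i < m" "j < m" "i \<noteq> j" for i j
  proof -
    have "commutes (q j) (1 - P)" by (intro commutes_intros qP that)
    then have "(1 - P) * (q j * (1 - P)) = q j * ((1 - P) * (1 - P))"
      by (rule commutes_left[OF commutes_sym])
    then have "q i * (1 - P) * (q j * (1 - P)) = q i * q j * ((1 - P) * (1 - P))"
      by (simp only: mult.assoc)
    then show ?thesis using q(2) that by simp
  qed
  obtain h where h: "unitary h" "\<And>i. i < m \<Longrightarrow> commutes (q i * (1 - P)) (h * r n * adj h)"
    "\<And>x. commutes x (r n) \<Longrightarrow> (\<forall>i<m. commutes x (q i * (1 - P))) \<Longrightarrow> commutes x h"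
    using projection_conj_commutes[of "r n" m "\<lambda>i. q i * (1 - P)"] r q' qq' by blast
  have rjh: "commutes (r j) h" if "j < n" for j
  proof (rule h(3))
    show "commutes (r j) (r n)" using rr[of j n] rr[of n j] that by (simp add: commutes_def)
    have "commutes (r j) P" unfolding P_def
    proof (rule commutes_sum)
      show "commutes (r j) (r i)" if "i \<in> {..<n}" for i
        using rr[of i j] rr[of j i] that \<open>j < n\<close> by (cases "i = j") (auto simp: commutes_def)
    qed
    then show "\<forall>i<m. commutes (r j) (q i * (1 - P))"
      using commutes_sym[OF gc[OF that]] by (auto simp flip: r_def intro!: commutes_mult commutes_diff)
  qed
  have Ph: "commutes P h" by (rule commutes_sym, unfold P_def, rule commutes_sum) (auto intro: commutes_sym rjh)
  have "h * P * adj h = P" using Ph h(1) unfolding commutes_def by (metis mult.assoc mult.right_neutral unitary_def)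
  have adjP: "adj P = P" using P by (simp add: is_projection_def)
  have Ph': "commutes P (adj h)" using commutes_adj[OF Ph] by (simp add: adjP)
  have "commutes (q i) (h * g * p j * adj (h * g))" if "j < Suc n" "i < m" for i j
  proof (cases "j < n")
    case True
    have "h * r j * adj h = r j" using rjh[OF True] h(1) unfolding commutes_def
      by (metis mult.assoc mult.right_neutral unitary_def)
    then show ?thesis using gc[OF True that(2)] by (simp add: r_def adj_mult mult.assoc)
  next
    case False
    then have j: "j = n" using that by simp
    define R where "R = h * r n * adj h"
    have "P * R = h * (P * r n) * adj h" "R * P = h * (r n * P) * adj h"
      unfolding R_def using commutes_left[OF Ph] Ph' by (simp_all add: mult.assoc commutes_def)
    then have "P * R = 0" "R * P = 0" using Pr rP by simp_all
    \<comment> \<open>Because \<open>R\<close> lies under \<open>1 - P\<close>, commuting with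
      \<open>q i * (1 - P)\<close> amounts to commuting with \<open>q i\<close>.\<close>
    then have "(1 - P) * R = R" "R * (1 - P) = R" by (simp_all add: algebra_simps)
    moreover have "q i * (1 - P) = (1 - P) * q i"
      using qP[OF that(2)] by (simp add: commutes_def algebra_simps)
    ultimately have "q i * R = R * q i"
      using h(2)[OF that(2)] unfolding commutes_def R_def[symmetric] by (metis mult.assoc)
    then show ?thesis unfolding j by (simp add: R_def r_def commutes_def adj_mult mult.assoc)
  qed
  then show ?case using unitary_mult[OF h(1) g] by blast
qed

section \<open>Roots of unitaries and factorization\<close>

lemma one_minus_inverse:
  fixes y :: "'a::cstar_algebra"
  assumes y: "adj y = y" "norm y < 1"
  obtains w where "adj w = w" "w * (1 - y) = 1" "(1 - y) * w = 1" "\<And>x. commutes x y \<Longrightarrow> commutes x w"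
proof -
  define v where "v n = (\<Sum>k<n. y ^ k)" for n
  have "summable (\<lambda>k. y ^ k)"
  proof (rule summable_comparison_test')
    show "summable (\<lambda>k. norm y ^ k)" using y by (simp add: summable_geometric)
  qed (rule norm_power_ineq)
  then have "convergent v" by (simp add: summable_iff_convergent v_def[abs_def])
  then obtain w where w: "v \<longlonglongrightarrow> w" by (auto simp: convergent_def)
  have "(\<lambda>n. y ^ n) \<longlonglongrightarrow> 0"
    using \<open>summable (\<lambda>k. y ^ k)\<close> by (rule summable_LIMSEQ_zero)
  then have lim: "(\<lambda>n. 1 - y ^ n) \<longlonglongrightarrow> 1 - 0" by (rule tendsto_diff[OF tendsto_const])
  have "v n * (1 - y) = 1 - y ^ n" for n
  proof (induction n)
    case (Suc n)
    have "v (Suc n) * (1 - y) = v n * (1 - y) + (y ^ n - y ^ n * y)"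
      by (simp add: v_def algebra_simps)
    then show ?case using Suc by (simp add: power_commutes)
  qed (simp add: v_def)
  moreover have "(\<lambda>n. v n * (1 - y)) \<longlonglongrightarrow> w * (1 - y)" by (intro tendsto_intros w)
  ultimately have 1: "w * (1 - y) = 1" using LIMSEQ_unique[OF _ lim] by simp
  have comm: "commutes x w" if "commutes x y" for x
    by (rule commutes_lim[OF _ w]) (auto simp: v_def intro!: commutes_sum commutes_power that)
  have "adj w = w"
    by (rule adj_lim[OF _ w]) (simp add: v_def adj_sum adj_power y)
  moreover have "(1 - y) * w = 1"
    using 1 comm[of "y"] by (simp add: commutes_def algebra_simps)
  ultimately show thesis using 1 comm that by blast
qed

text \<open>For a scalar h = exp(i t) the elements \<open>z\<close>, \<open>c\<close>,
  \<open>g\<close> are sin(t/2)^2, cos(t/2) and exp(i t/2), the last written as (1 + h) / (2 c). The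
  hypothesis gives \<open>norm z \<le> 1/2\<close>, so \<open>c\<close> is invertible with inverse
  \<open>w\<close>. The distance estimate comes from |g - 1|^2 = 2 (1 - c).\<close>

lemma unitary_sqrt:
  fixes h :: "'a::cstar_algebra"
  assumes h: "unitary h" "(norm (h - 1))\<^sup>2 \<le> 2"
  obtains g where "unitary g" "g * g = h" "(norm (g - 1))\<^sup>2 \<le> (norm (h - 1))\<^sup>2 / 2"
proof -
  note uc = unitary_cancel[OF h(1)]
  define z where "z = scaleR (1/4) (2 - h - adj h)"
  have az: "adj z = z"
    by (simp add: z_def adj_diff adj_add algebra_simps)
  have "adj (h - 1) * (h - 1) = 2 - h - adj h"
    unfolding one_add_one[symmetric] by (simp add: adj_diff algebra_simps uc)
  then have nz: "norm z = (norm (h - 1))\<^sup>2 / 4"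
    using cstar_identity[of "h - 1"] by (simp add: z_def)
  then have "norm z \<le> 1" using h(2) by linarith
  then obtain c where c: "adj c = c" "c * c = 1 - z" "norm (1 - c) \<le> norm z"
    "\<And>x. commutes x z \<Longrightarrow> commutes x c"
    using sqrt_one_minus[OF az] by metis
  have "adj (1 - c) = 1 - c" by (simp add: adj_diff c)
  moreover have "norm (1 - c) < 1" using c(3) nz h(2) by linarith
  ultimately obtain w where w: "adj w = w" "w * c = 1" "c * w = 1"
    "\<And>x. commutes x (1 - c) \<Longrightarrow> commutes x w"
    using one_minus_inverse[of "1 - c"] by auto
  have hz: "commutes h z" "commutes (adj h) z"
    unfolding z_def
    by (auto intro!: commutes_scaleR simp: commutes_def algebra_simps uc mult_2 mult_2_right)
  have hw: "commutes h w" "commutes (adj h) w"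
    by (intro w commutes_intros c hz)+
  have cw: "commutes c w" by (simp add: commutes_def w)
  define g where "g = scaleR (1/2) ((1 + h) * w)"
  have ag: "adj g = scaleR (1/2) (w * (1 + adj h))"
    by (simp add: g_def adj_mult adj_add w)
  have ag': "adj g = scaleR (1/2) ((1 + adj h) * w)"
    unfolding ag using hw by (simp add: algebra_simps commutes_def)
  have hc: "(1 + adj h) * (1 + h) = scaleR 4 (c * c)" "(1 + h) * (1 + adj h) = scaleR 4 (c * c)"
    unfolding c(2) z_def one_add_one[symmetric] by (simp_all add: algebra_simps uc) 
     (simp_all add: scaleR_conv_of_real)
  have wcc: "w * (c * c) * w = 1" by (metis mult.assoc mult.right_neutral w(2,3))
  have "adj g * g = scaleR (1/4) (w * ((1 + adj h) * (1 + h)) * w)"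
    unfolding ag by (simp add: g_def mult.assoc)
  then have 1: "adj g * g = 1" unfolding hc by (simp add: wcc)
  have wg: "commutes w (1 + h)" "commutes w (1 + adj h)"
    by (auto intro!: commutes_intros commutes_sym[OF hw(1)] commutes_sym[OF hw(2)])
  have "g * adj g = scaleR (1/4) ((1 + h) * (w * ((1 + adj h) * w)))"
    unfolding ag' by (simp add: g_def mult.assoc)
  also have "\<dots> = scaleR (1/4) (w * ((1 + h) * (1 + adj h)) * w)"
    using wg by (metis commutes_left mult.assoc commutes_def)
  finally have 2: "g * adj g = 1" unfolding hc by (simp add: wcc)
  have "g * g = scaleR (1/4) (((1 + h) * (1 + h)) * (w * w))"
    by (simp add: g_def mult.assoc commutes_left[OF wg(1)])
  also have "(1 + h) * (1 + h) = h * ((1 + adj h) * (1 + h))"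
    by (simp add: algebra_simps uc)
  also have "scaleR (1/4) (h * ((1 + adj h) * (1 + h)) * (w * w)) = h"
    unfolding hc by (simp add: mult.assoc) (metis mult.assoc mult.right_neutral w(3))
  finally have gg: "g * g = h" .
  have "g + adj g = scaleR (1/2) ((2 + h + adj h) * w)"
    unfolding ag' unfolding g_def scaleR_add_right[symmetric] distrib_right[symmetric]
    by (rule arg_cong[where f="\<lambda>x. scaleR (1/2) (x * w)"]) simp
  also have "2 + h + adj h = scaleR 4 (c * c)"
    unfolding hc(1)[symmetric] one_add_one[symmetric] by (simp add: algebra_simps uc)
  finally have "g + adj g = scaleR 2 c" by (simp add: mult.assoc w)
  then have "adj (g - 1) * (g - 1) = scaleR 2 (1 - c)"
    by (simp add: adj_diff algebra_simps 1 scaleR_2)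
  then have "(norm (g - 1))\<^sup>2 = 2 * norm (1 - c)"
    using cstar_identity[of "g - 1"] by simp
  also have "\<dots> \<le> (norm (h - 1))\<^sup>2 / 2" using c(3) nz by simp
  finally show thesis using that[of g] gg 1 2 by (simp add: unitary_def)
qed

text \<open>Each square root halves the bound on the squared distance to 1 and so stays within reach
  of \<open>unitary_sqrt\<close>. The resulting bound does not depend on \<open>h\<close>, which
  later makes the number of factors uniform.\<close>

lemma unitary_root:
  fixes h :: "'a::cstar_algebra"
  assumes h: "unitary h" "(norm (h - 1))\<^sup>2 \<le> 2"
  shows "\<exists>g. unitary g \<and> g ^ (2 ^ l) = h \<and> (norm (g - 1))\<^sup>2 \<le> 2 / 2 ^ l"
proof (induction l)
  case 0
  then show ?case using h by (intro exI[of _ h]) auto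
next
  case (Suc l)
  then obtain g where g: "unitary g" "g ^ (2 ^ l) = h" "(norm (g - 1))\<^sup>2 \<le> 2 / 2 ^ l" by blast
  have "2 / 2 ^ l \<le> (2::real)" by (simp add: field_simps)
  then have "(norm (g - 1))\<^sup>2 \<le> 2" using g(3) by linarith
  then obtain k where k: "unitary k" "k * k = g" "(norm (k - 1))\<^sup>2 \<le> (norm (g - 1))\<^sup>2 / 2"
    using unitary_sqrt[OF g(1)] by metis
  have "k ^ (2 ^ Suc l) = h"
    using g(2) k(2) by (metis power_Suc power_mult power2_eq_square)
  moreover have "(norm (k - 1))\<^sup>2 \<le> 2 / 2 ^ Suc l" using k(3) g(3) by simp
  ultimately show ?case using k(1) by blast
qed

text \<open>\<open>f\<close> is the spectral projection of \<open>g\<close> for the right half of the circle; \<open>a * c * c * b\<close>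
  turns the other half by \<open>c * c = 2 * f - 1\<close> and treats both halves separately.\<close>

lemma (in tracial) unitary_factorization:
  fixes g :: 'a
  assumes g: "unitary g"
  obtains a b c where "unitary a" "unitary b" "unitary c" "g = a * (c * c) * b"
    "(norm (a - 1))\<^sup>2 \<le> 2" "(norm (b - 1))\<^sup>2 \<le> 2" "(norm (c - 1))\<^sup>2 \<le> 2"
proof -
  note uc = unitary_cancel[OF g]
  have "adj (g + adj g) = g + adj g" by (simp add: adj_add add.commute)
  then obtain f d where fd: "is_projection f" "adj d = d" "(2 * f - 1) * (g + adj g) = d * d"
    "\<And>x. commutes x (g + adj g) \<Longrightarrow> commutes x f"
    using sign_projection by metis
  have ff: "f * f = f" "adj f = f" using fd(1) by (simp_all add: is_projection_def)
  have ffl: "f * (f * x) = f * x" for x by (simp add: ff flip: mult.assoc)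
  have gf: "commutes g f" "commutes (adj g) f"
    by (intro fd; auto simp: commutes_def algebra_simps uc)+
  have gf': "g * f = f * g" "adj g * f = f * adj g" using gf by (simp_all add: commutes_def)
  have gfl: "g * (f * x) = f * (g * x)" "adj g * (f * x) = f * (adj g * x)" for x
    using gf by (auto intro: commutes_left)
  note simps = algebra_simps adj_add adj_diff adj_mult ff ffl gf' gfl uc
  have nf: "norm f \<le> 1" "norm (1 - f) \<le> 1"
    by (intro norm_is_projection is_projection_compl fd)+
  have "unitary (2 * f - 1)"
    unfolding unitary_def mult_2 by (simp add: simps)
  then have "norm (d * d) \<le> 1 * norm (g + adj g)"
    unfolding fd(3)[symmetric] using norm_mult_ineq by (metis norm_unitary)
  also have "\<dots> \<le> 2" using norm_triangle_ineq[of g "adj g"] norm_unitary[OF g] by simp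
  finally have "norm (scaleR 2 1 - d * d) \<le> 2" by (rule norm_minus_square[OF fd(2)])
  then have nd: "norm (2 - d * d) \<le> 2" by (simp add: scaleR_2)
  \<comment> \<open>On \<open>f\<close> the element \<open>g + adj g\<close> is
    \<open>d * d\<close>, off \<open>f\<close> it is \<open>- (d * d)\<close>. Hence the squares of
    both \<open>a - 1\<close> and \<open>b - 1\<close> become cut-downs of
    \<open>2 - d * d\<close>.\<close>
  have fa: "f * g + f * adj g = f * (d * d)" "g + adj g - f * g - f * adj g = - (d * d) + f * (d * d)"
    unfolding fd(3)[symmetric] mult_2 by (simp_all add: simps)
  define a where "a = g * f + (1 - f)"
  define b where "b = f - g * (1 - f)"
  \<comment> \<open>If \<open>f\<close> is not 1, the symmetry \<open>2 * f - 1\<close> has distance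
    2 from 1, too far for \<open>unitary_root\<close>; its square root \<open>c\<close> is within
    sqrt 2.\<close>
  define c where "c = f + scaleC \<i> (1 - f)"
  have ua: "unitary a" "unitary b" by (simp_all add: unitary_def a_def b_def simps)
  have ac: "adj c = f - scaleC \<i> (1 - f)"
    by (simp add: c_def adj_add adj_scaleC adj_diff ff)
  have cc: "c * c = 2 * f - 1" and uc': "unitary c"
    unfolding unitary_def ac mult_2 c_def
    by (simp_all add: simps mult_scaleC_left mult_scaleC_right scaleC_scaleC scaleC_add_right
        scaleC_diff_right scaleC_one adj_scaleC)
  have "g = a * (c * c) * b"
    unfolding cc mult_2 by (simp add: a_def b_def simps mult_2_right)
  moreover have "(norm (a - 1))\<^sup>2 \<le> 2"
  proof -
    have "adj (a - 1) * (a - 1) = f * (2 - d * d)"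
      unfolding right_diff_distrib fa(1)[symmetric] one_add_one[symmetric] by (simp add: a_def simps mult_2_right)
    then have "(norm (a - 1))\<^sup>2 = norm (f * (2 - d * d))" by (simp flip: cstar_identity)
    also have "\<dots> \<le> norm f * norm (2 - d * d)" by (rule norm_mult_ineq)
    also have "\<dots> \<le> 1 * 2" by (intro mult_mono nf nd) auto
    finally show ?thesis by simp
  qed
  moreover have "(norm (b - 1))\<^sup>2 \<le> 2"
  proof -
    have "(1 - f) * (2 - d * d) = 2 * (1 - f) + (- (d * d) + f * (d * d))"
      by (simp add: algebra_simps mult_2 mult_2_right)
    also have "\<dots> = adj (b - 1) * (b - 1)"
      unfolding fa(2)[symmetric] mult_2 by (simp add: b_def simps)
    finally have "(norm (b - 1))\<^sup>2 = norm ((1 - f) * (2 - d * d))" by (simp flip: cstar_identity)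
    also have "\<dots> \<le> norm (1 - f) * norm (2 - d * d)" by (rule norm_mult_ineq)
    also have "\<dots> \<le> 1 * 2" by (intro mult_mono nf nd) auto
    finally show ?thesis by simp
  qed
  moreover have "(norm (c - 1))\<^sup>2 \<le> 2"
  proof -
    have "c - 1 = scaleC (\<i> - 1) (1 - f)"
      by (simp add: c_def scaleC_diff_left scaleC_one)
    then have "norm (c - 1) = cmod (\<i> - 1) * norm (1 - f)" by (simp add: norm_scaleC)
    also have "\<dots> \<le> sqrt 2 * 1"
      by (intro mult_mono nf) (auto simp: cmod_def)
    finally have "(norm (c - 1))\<^sup>2 \<le> (sqrt 2)\<^sup>2" by (intro power_mono) auto
    then show ?thesis by simp
  qed
  ultimately show thesis using that ua uc' by blast
qed

section \<open>Atomless algebras of projections\<close>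

text \<open>The second clause (closure under the bicommutant) yields all algebraic and limit closure
  properties of \<open>B\<close> at once.\<close>

definition atomless_algebra :: "'a::cstar_algebra set \<Rightarrow> bool" where
  "atomless_algebra B \<longleftrightarrow>
    (\<forall>p\<in>B. is_projection p \<and> (\<forall>q\<in>B. commutes p q)) \<and>
    (\<forall>p. is_projection p \<longrightarrow> (\<forall>x. (\<forall>b\<in>B. commutes x b) \<longrightarrow> commutes x p) \<longrightarrow> p \<in> B) \<and>
    (\<forall>r\<in>B. r \<noteq> 0 \<longrightarrow> (\<exists>q\<in>B. r * q = q \<and> q \<noteq> 0 \<and> q \<noteq> r))"

lemma atomless_algebraD:
  assumes B: "atomless_algebra B"
  shows "p \<in> B \<Longrightarrow> is_projection p"
    and "p \<in> B \<Longrightarrow> q \<in> B \<Longrightarrow> commutes p q"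
    and "r \<in> B \<Longrightarrow> r \<noteq> 0 \<Longrightarrow> \<exists>q\<in>B. r * q = q \<and> q \<noteq> 0 \<and> q \<noteq> r"
proof -
  have c1: "\<forall>p\<in>B. is_projection p \<and> (\<forall>q\<in>B. commutes p q)"
    using B unfolding atomless_algebra_def by (elim conjE)
  have c3: "\<forall>r\<in>B. r \<noteq> 0 \<longrightarrow> (\<exists>q\<in>B. r * q = q \<and> q \<noteq> 0 \<and> q \<noteq> r)"
    using B unfolding atomless_algebra_def by (elim conjE)
  show "p \<in> B \<Longrightarrow> is_projection p" "p \<in> B \<Longrightarrow> q \<in> B \<Longrightarrow> commutes p q" using c1 by simp_all
  show "r \<in> B \<Longrightarrow> r \<noteq> 0 \<Longrightarrow> \<exists>q\<in>B. r * q = q \<and> q \<noteq> 0 \<and> q \<noteq> r" using c3 by simp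
qed

lemma atomless_algebra_closed:
  assumes B: "atomless_algebra B" and p: "is_projection p"
    "\<And>x. (\<And>b. b \<in> B \<Longrightarrow> commutes x b) \<Longrightarrow> commutes x p"
  shows "p \<in> B"
proof -
  have "\<forall>x. (\<forall>b\<in>B. commutes x b) \<longrightarrow> commutes x p" using p(2) by simp
  then show ?thesis using B p(1) unfolding atomless_algebra_def by simp
qed

text \<open>\<open>C\<close> is empty when atoms are excluded by diffuseness, and \<open>{w}\<close>
  when the whole family has to commute with a Haar unitary \<open>w\<close>.\<close>

definition maximal_commuting :: "'a::cstar_algebra set \<Rightarrow> 'a set \<Rightarrow> bool" where
  "maximal_commuting C B \<longleftrightarrow>
    (\<forall>p\<in>B. is_projection p \<and> (\<forall>q\<in>B. commutes p q) \<and> (\<forall>c\<in>C. commutes c p)) \<and>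
    (\<forall>p. is_projection p \<longrightarrow> (\<forall>c\<in>C. commutes c p) \<longrightarrow> (\<forall>q\<in>B. commutes q p) \<longrightarrow> p \<in> B)"

lemma maximal_commutingD:
  assumes B: "maximal_commuting C B"
  shows "p \<in> B \<Longrightarrow> is_projection p"
    and "p \<in> B \<Longrightarrow> q \<in> B \<Longrightarrow> commutes p q"
    and "p \<in> B \<Longrightarrow> c \<in> C \<Longrightarrow> commutes c p"
    and "is_projection p \<Longrightarrow> (\<And>c. c \<in> C \<Longrightarrow> commutes c p) \<Longrightarrow> (\<And>q. q \<in> B \<Longrightarrow> commutes q p) \<Longrightarrow> p \<in> B"
proof -
  have c1: "\<forall>p\<in>B. is_projection p \<and> (\<forall>q\<in>B. commutes p q) \<and> (\<forall>c\<in>C. commutes c p)"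
    using B unfolding maximal_commuting_def by (elim conjE)
  have c2: "\<forall>p. is_projection p \<longrightarrow> (\<forall>c\<in>C. commutes c p) \<longrightarrow> (\<forall>q\<in>B. commutes q p) \<longrightarrow> p \<in> B"
    using B unfolding maximal_commuting_def by (elim conjE)
  show "p \<in> B \<Longrightarrow> is_projection p" "p \<in> B \<Longrightarrow> q \<in> B \<Longrightarrow> commutes p q"
    "p \<in> B \<Longrightarrow> c \<in> C \<Longrightarrow> commutes c p" using c1 by simp_all
  show "is_projection p \<Longrightarrow> (\<And>c. c \<in> C \<Longrightarrow> commutes c p) \<Longrightarrow> (\<And>q. q \<in> B \<Longrightarrow> commutes q p) \<Longrightarrow> p \<in> B"
    using c2 by simp
qed

lemma atomless_algebra_add:
  assumes B: "atomless_algebra B" and "p \<in> B" "q \<in> B" "p * q = 0"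
  shows "p + q \<in> B"
proof (rule atomless_algebra_closed[OF B])
  show "is_projection (p + q)"
    using assms atomless_algebraD(1)[OF B] by (simp add: is_projection_add)
qed (use assms in \<open>auto intro!: commutes_add\<close>)

lemma atomless_algebra_diff:
  assumes B: "atomless_algebra B" and "p \<in> B" "q \<in> B" "p * q = q"
  shows "p - q \<in> B"
proof (rule atomless_algebra_closed[OF B])
  show "is_projection (p - q)"
    using assms atomless_algebraD(1)[OF B] by (simp add: is_projection_diff)
qed (use assms in \<open>auto intro!: commutes_diff\<close>)

lemma maximal_commuting_exists:
  fixes S C :: "'a::cstar_algebra set"
  assumes S: "\<And>p. p \<in> S \<Longrightarrow> is_projection p" "\<And>p q. p \<in> S \<Longrightarrow> q \<in> S \<Longrightarrow> commutes p q"
    "\<And>p c. p \<in> S \<Longrightarrow> c \<in> C \<Longrightarrow> commutes c p"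
  shows "\<exists>B. S \<subseteq> B \<and> maximal_commuting C B"
proof -
  define F where "F = {B. S \<subseteq> B \<and> (\<forall>p\<in>B. is_projection p \<and> (\<forall>q\<in>B. commutes p q) \<and> (\<forall>c\<in>C. commutes c p))}"
  have "\<exists>M\<in>F. \<forall>X\<in>F. M \<subseteq> X \<longrightarrow> X = M"
  proof (rule subset_Zorn_nonempty)
    have "S \<in> F" using S by (auto simp: F_def)
    then show "F \<noteq> {}" by blast
    fix \<C> assume c: "\<C> \<noteq> {}" "subset.chain F \<C>"
    then have sub: "\<C> \<subseteq> F" and tot: "\<And>X Y. X \<in> \<C> \<Longrightarrow> Y \<in> \<C> \<Longrightarrow> X \<subseteq> Y \<or> Y \<subseteq> X"
      by (auto simp: subset_chain_def)
    have "S \<subseteq> \<Union>\<C>" using c(1) sub by (auto simp: F_def)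
    moreover have "commutes p q" if pq: "p \<in> \<Union>\<C>" "q \<in> \<Union>\<C>" for p q
    proof -
      obtain X Y where XY: "X \<in> \<C>" "Y \<in> \<C>" "p \<in> X" "q \<in> Y" using pq by blast
      then obtain Z where "Z \<in> \<C>" "p \<in> Z" "q \<in> Z" using tot[OF XY(1,2)] by blast
      then show ?thesis using sub by (auto simp: F_def)
    qed
    ultimately show "\<Union>\<C> \<in> F" using sub by (auto simp: F_def)
  qed
  then obtain B where B: "B \<in> F" "\<And>X. X \<in> F \<Longrightarrow> B \<subseteq> X \<Longrightarrow> X = B" by blast
  have "p \<in> B" if p: "is_projection p" "\<forall>c\<in>C. commutes c p" "\<forall>q\<in>B. commutes q p" for p
  proof -
    have "insert p B \<in> F"
      using B(1) p by (auto simp: F_def intro: commutes_sym)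
    then show "p \<in> B" using B(2)[of "insert p B"] by blast
  qed
  moreover have "\<forall>p\<in>B. is_projection p \<and> (\<forall>q\<in>B. commutes p q) \<and> (\<forall>c\<in>C. commutes c p)"
    using B(1) unfolding F_def mem_Collect_eq by (rule conjunct2)
  ultimately have "maximal_commuting C B"
    unfolding maximal_commuting_def by (intro conjI allI impI)
  then show ?thesis using B(1) by (auto simp: F_def)
qed

lemma maximal_commuting_mult:
  assumes B: "maximal_commuting C B" and pq: "p \<in> B" "q \<in> B"
  shows "p * q \<in> B"
proof (rule maximal_commutingD(4)[OF B])
  show "is_projection (p * q)"
    using maximal_commutingD(1,2)[OF B] pq by (simp add: is_projection_mult)
qed (use maximal_commutingD(2,3)[OF B] pq in \<open>auto intro!: commutes_mult\<close>)

text \<open>Bicommutant closure follows from maximality: the members of \<open>C\<close> and of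
  \<open>B\<close> all commute with \<open>B\<close>, so a projection in the bicommutant of
  \<open>B\<close> commutes with them.\<close>

lemma atomless_algebraI:
  assumes B: "maximal_commuting C B"
    and "\<And>r. r \<in> B \<Longrightarrow> r \<noteq> 0 \<Longrightarrow> \<exists>q\<in>B. r * q = q \<and> q \<noteq> 0 \<and> q \<noteq> r"
  shows "atomless_algebra B"
proof -
  have "p \<in> B" if p: "is_projection p" "\<forall>x. (\<forall>b\<in>B. commutes x b) \<longrightarrow> commutes x p" for p
    using p maximal_commutingD(2,3)[OF B] by (intro maximal_commutingD(4)[OF B]) auto
  then show ?thesis
    using assms(2) maximal_commutingD(1,2)[OF B] by (simp add: atomless_algebra_def)
qed

text \<open>If \<open>r\<close> were minimal in a maximal \<open>B\<close>, every \<open>b\<close>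
  in \<open>B\<close> would cut \<open>r\<close> down to 0 or \<open>r\<close>, hence commute with
  any subprojection of \<open>r\<close>. A proper one, which diffuseness provides, would then belong
  to \<open>B\<close> by maximality.\<close>

lemma atomless_algebra_of_diffuse:
  fixes S :: "'a::cstar_algebra set"
  assumes diffuse: "diffuse TYPE('a)"
    and S: "\<And>p. p \<in> S \<Longrightarrow> is_projection p" "\<And>p q. p \<in> S \<Longrightarrow> q \<in> S \<Longrightarrow> commutes p q"
  shows "\<exists>B. S \<subseteq> B \<and> atomless_algebra B"
proof -
  obtain B where SB: "S \<subseteq> B" and max: "maximal_commuting {} B"
    using maximal_commuting_exists[of S "{}"] S by auto
  note B = maximal_commutingD[OF max]
  have "\<exists>q\<in>B. r * q = q \<and> q \<noteq> 0 \<and> q \<noteq> r" if r: "r \<in> B" "r \<noteq> 0" for r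
  proof (rule ccontr)
    assume atom: "\<not> ?thesis"
    have rp: "adj r = r" "r * r = r" using B(1)[OF r(1)] by (auto simp: is_projection_def)
    obtain q where q: "is_projection q" "r * q = q" "q \<noteq> 0" "q \<noteq> r"
      using diffuse r B(1)[OF r(1)] unfolding diffuse_def by blast
    have qr: "q * r = q" using q rp by (metis adj_mult is_projection_def)
    have "q \<in> B"
    proof (rule B(4)[OF q(1)])
      fix b assume b: "b \<in> B"
      have "r * (r * b) = r * b" by (simp add: rp flip: mult.assoc)
      then have "r * b = 0 \<or> r * b = r" using atom maximal_commuting_mult[OF max r(1) b] by blast
      moreover have "b * q = r * b * q" "q * b = q * (r * b)"
        using q(2) qr B(2)[OF r(1) b] by (metis commutes_def mult.assoc)+
      ultimately show "commutes b q" by (auto simp: commutes_def q(2) qr)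
    qed simp
    then show False using atom q by blast
  qed
  then have "atomless_algebra B" by (rule atomless_algebraI[OF max])
  then show ?thesis using SB by blast
qed

section \<open>Haar unitaries have no atoms; halving of projections\<close>

context tracial
begin

lemma tau_projection:
  assumes "is_projection p"
  shows "\<tau> p = complex_of_real ((n2 p)\<^sup>2)"
  using assms tau_square[of p] by (simp add: is_projection_def)

lemma haarD:
  assumes "w \<in> haar \<tau>"
  shows "unitary w" "n \<ge> 1 \<Longrightarrow> \<tau> (w ^ n) = 0" "norm w = 1"
  using assms norm_unitary by (auto simp: haar_def)

lemma n2_unitary_left: "unitary u \<Longrightarrow> n2 (u * x) = n2 x"
  unfolding norm2_def by (simp add: adj_mult mult.assoc unitary_cancel)

lemma n2_unitary_right: "unitary u \<Longrightarrow> n2 (x * u) = n2 x"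
  using n2_unitary_left[OF unitary_adj, of u "adj x"] by (simp flip: adj_mult)

lemma n2_sum_powers:
  assumes w: "w \<in> haar \<tau>"
  shows "(n2 (\<Sum>n<N. w ^ n))\<^sup>2 = real N"
proof (induction N)
  case (Suc N)
  define S where "S = (\<Sum>n<N. w ^ n)"
  have "(\<Sum>n<Suc N. w ^ n) = 1 + w * S"
    by (simp add: S_def sum.lessThan_Suc_shift sum_distrib_left del: sum.lessThan_Suc)
  moreover have "\<tau> (w * S) = 0"
    using haarD(2)[OF w] by (simp add: S_def sum_distrib_left tau_sum flip: power_Suc)
  moreover have "\<tau> (adj S * S) = complex_of_real (real N)"
    using Suc by (simp add: tau_square S_def)
  ultimately have "Re (\<tau> (adj (\<Sum>n<Suc N. w ^ n) * (\<Sum>n<Suc N. w ^ n))) = real (Suc N)"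
    by (simp add: adj_add algebra_simps tau_add tau_one tau_adj adj_mult unitary_cancel[OF haarD(1)[OF w]]
      flip: adj_mult)
       (simp add: adj_mult mult.assoc unitary_cancel[OF haarD(1)[OF w]])
  then show ?case by (simp only: n2_square)
qed simp

lemma haar_scaleC:
  assumes w: "w \<in> haar \<tau>" and c: "cmod c = 1"
  shows "scaleC c w \<in> haar \<tau>"
proof -
  have cc: "c * cnj c = 1" using c by (metis complex_norm_square of_real_1 power_one)
  have "unitary (scaleC c w)"
    using haarD(1)[OF w] cc
    by (simp add: unitary_def adj_scaleC mult_scaleC_left mult_scaleC_right scaleC_scaleC scaleC_one mult.commute)
  moreover have "scaleC c w ^ n = scaleC (c ^ n) (w ^ n)" for n
    by (induction n) (auto simp: mult_scaleC_left mult_scaleC_right scaleC_scaleC scaleC_one mult.commute)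
  ultimately show ?thesis using haarD(2)[OF w] by (simp add: haar_def tau_scaleC)
qed

text \<open>The powers of a Haar unitary are orthonormal, so Bessel's inequality applies.\<close>

lemma haar_no_eigenprojection:
  assumes w: "w \<in> haar \<tau>" and r: "is_projection r" and e: "r * w = scaleC c r"
  shows "r = 0"
proof (rule ccontr)
  assume "r \<noteq> 0"
  have rp: "adj r = r" "r * r = r" using r by (auto simp: is_projection_def)
  have "(r * w) * adj (r * w) = r"
    using haarD(1)[OF w] by (simp add: adj_mult rp mult.assoc unitary_cancel)
  then have "scaleC (c * cnj c) r = r"
    unfolding e by (simp add: adj_scaleC mult_scaleC_left mult_scaleC_right scaleC_scaleC rp mult.commute)
  then have "norm r = cmod (c * cnj c) * norm r" by (metis norm_scaleC)
  then have "(cmod c)\<^sup>2 = 1" using \<open>r \<noteq> 0\<close> by (simp add: norm_mult power2_eq_square)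
  then have c: "cmod c = 1" by (simp add: power2_eq_1_iff) (use norm_ge_zero[of c] in linarith)
  define v where "v = scaleC (cnj c) w"
  have v: "v \<in> haar \<tau>" unfolding v_def using haar_scaleC[OF w] c by simp
  have "c * cnj c = 1" using c by (metis complex_norm_square of_real_1 power_one)
  then have rv: "r * v = r" by (simp add: v_def mult_scaleC_right e scaleC_scaleC scaleC_one mult.commute)
  have rvn: "r * v ^ n = r" for n
    by (induction n) (simp_all add: rv flip: mult.assoc)
  have "real N * n2 r \<le> sqrt (real N)" for N
  proof -
    have "r * (\<Sum>n<N. v ^ n) = scaleR (real N) r"
      by (simp add: sum_distrib_left rvn sum_constant_scaleR del: sum_constant)
    then have "real N * n2 r = n2 (r * (\<Sum>n<N. v ^ n))" by (simp add: n2_scaleR)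
    also have "\<dots> \<le> norm r * n2 (\<Sum>n<N. v ^ n)" by (rule n2_mult_left)
    also have "\<dots> \<le> 1 * n2 (\<Sum>n<N. v ^ n)" by (intro mult_right_mono norm_is_projection r) auto
    also have "\<dots> = sqrt (real N)" by (simp flip: n2_sum_powers[OF v])
    finally show ?thesis .
  qed
  moreover obtain N where N: "real N > (1 / n2 r)\<^sup>2" using reals_Archimedean2 by blast
  ultimately have "real N * n2 r \<le> sqrt (real N)" by blast
  have p: "n2 r > 0" using \<open>r \<noteq> 0\<close> n2_nonneg[of r] n2_eq_0_iff[of r] by linarith
  have "sqrt (real N) > 1 / n2 r" using N by (simp add: real_less_rsqrt)
  then have "1 < sqrt (real N) * n2 r" using p by (simp add: field_simps)
  moreover have "sqrt (real N) > 0"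
    using \<open>sqrt (real N) > 1 / n2 r\<close> p by (meson divide_pos_pos less_trans zero_less_one)
  ultimately have "sqrt (real N) < sqrt (real N) * (sqrt (real N) * n2 r)" by simp
  also have "\<dots> = real N * n2 r" by simp
  finally show False using \<open>real N * n2 r \<le> sqrt (real N)\<close> by simp
qed

text \<open>If \<open>r\<close> were an atom of a maximal algebra, then \<open>r\<close> would be comparable with the sign of
  \<open>a - t\<close>, where \<open>t\<close> is the mean of \<open>a\<close> over \<open>r\<close>; this forces \<open>r * a = t * r\<close>.\<close>

lemma atom_scalar:
  fixes r a :: 'a
  assumes r: "is_projection r" "r \<noteq> 0" and a: "adj a = a" "commutes r a"
    and atom: "\<And>f. is_projection f \<Longrightarrow> (\<And>x. commutes x a \<Longrightarrow> commutes x f) \<Longrightarrow> r * f = 0 \<or> r * f = r"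
  shows "\<exists>t. r * a = scaleC t r"
proof -
  have rp: "adj r = r" "r * r = r" using r by (auto simp: is_projection_def)
  have "\<tau> (r * a) = cnj (\<tau> (r * a))"
    using a by (metis adj_mult commutes_def rp(1) tau_adj)
  then have im: "Im (\<tau> (r * a)) = 0" by (simp add: complex_eq_iff)
  define t where "t = Re (\<tau> (r * a)) / (n2 r)\<^sup>2"
  have "n2 r > 0" using r(2) n2_nonneg[of r] n2_eq_0_iff[of r] by linarith
  then have tr: "\<tau> (r * (a - scaleR t 1)) = 0"
    using im by (simp add: right_diff_distrib tau_diff tau_scaleR tau_projection[OF r(1)] t_def complex_eq_iff)
  define b where "b = a - scaleR t 1"
  have "adj b = b" by (simp add: b_def adj_diff a)
  then obtain f d where fd: "is_projection f" "adj d = d" "(2 * f - 1) * b = d * d"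
    "\<And>x. commutes x b \<Longrightarrow> commutes x f" "\<And>x. commutes x (b * b) \<Longrightarrow> commutes x d"
    using sign_projection by metis
  have cb: "commutes x b" if "commutes x a" for x
    unfolding b_def by (intro commutes_diff commutes_scaleR commutes_one that)
  have "r * f = 0 \<or> r * f = r"
    by (rule atom[OF fd(1)]) (intro fd(4) cb)
  then have "r * (2 * f - 1) = - r \<or> r * (2 * f - 1) = r"
    unfolding mult_2 by (auto simp: algebra_simps)
  then have "r * (d * d) = - (r * b) \<or> r * (d * d) = r * b"
    unfolding fd(3)[symmetric] mult.assoc[symmetric] by auto
  then have rb: "\<tau> (r * (d * d)) = 0" "r * (d * d) = 0 \<Longrightarrow> r * b = 0"
    using tr by (auto simp: b_def[symmetric] tau_minus)
  have "commutes r d" using cb a(2) by (intro fd(5) commutes_mult)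
  \<comment> \<open>By the choice of \<open>t\<close> the trace of \<open>r * (d * d)\<close>
    vanishes; rewriting it as the trace of a square lets faithfulness apply.\<close>
  then have "adj (d * r) * (d * r) = r * (d * d)"
    by (simp add: adj_mult rp fd(2)) (metis commutes_def mult.assoc rp(2))
  then have "d * r = 0" using rb(1) tau_faithful by metis
  then have "r * (d * d) = 0" using \<open>commutes r d\<close> by (metis commutes_def mult.assoc mult_zero_left)
  then have "r * b = 0" by (rule rb(2))
  then have "r * a = scaleR t r" by (simp add: b_def right_diff_distrib)
  then show ?thesis by (auto simp: scaleR_scaleC)
qed

text \<open>On an atom \<open>r\<close> of a maximal family commuting with \<open>w\<close>,
  \<open>atom_scalar\<close> makes the real and imaginary parts of \<open>w\<close> scalar. Then
  \<open>w\<close> is scalar on \<open>r\<close>, which \<open>haar_no_eigenprojection\<close>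
  excludes.\<close>

lemma atomless_algebra_of_haar:
  assumes w: "w \<in> haar \<tau>"
  shows "\<exists>B. atomless_algebra B \<and> 1 \<in> B \<and> (\<forall>b\<in>B. commutes w b)"
proof -
  obtain B where B1: "1 \<in> B" and max: "maximal_commuting {w} B"
    using maximal_commuting_exists[of "{1}" "{w}"] by auto
  note B = maximal_commutingD[OF max]
  have wB: "commutes w p" if "p \<in> B" for p using B(3)[OF that] by simp
  have waB: "commutes (adj w) p" if "p \<in> B" for p
    using commutes_adj[OF wB[OF that]] B(1)[OF that] by (simp add: is_projection_def)
  note uc = unitary_cancel[OF haarD(1)[OF w]]
  have "\<exists>q\<in>B. r * q = q \<and> q \<noteq> 0 \<and> q \<noteq> r" if r: "r \<in> B" "r \<noteq> 0" for r
  proof (rule ccontr)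
    assume atom: "\<not> ?thesis"
    have rp: "is_projection r" "r * r = r" using B(1)[OF r(1)] by (auto simp: is_projection_def)
    have ex: "\<exists>t. r * a = scaleC t r" if a: "adj a = a" "commutes w a" "\<And>b. b \<in> B \<Longrightarrow> commutes b a" for a
    proof (rule atom_scalar[OF rp(1) r(2) a(1) a(3)[OF r(1)]])
      fix f assume f: "is_projection f" "\<And>x. commutes x a \<Longrightarrow> commutes x f"
      have "f \<in> B" using a f by (intro B(4)) auto
      moreover have "r * (r * f) = r * f" by (simp add: rp flip: mult.assoc)
      ultimately show "r * f = 0 \<or> r * f = r" using atom maximal_commuting_mult[OF max r(1)] by blast
    qed
    have "\<exists>t. r * (w + adj w) = scaleC t r"
      using waB wB by (intro ex) (auto simp: adj_add add.commute commutes_def algebra_simps uc)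
    moreover have "\<exists>t. r * scaleC \<i> (w - adj w) = scaleC t r"
      using waB wB by (intro ex commutes_scaleC)
        (auto simp: adj_diff adj_scaleC scaleC_diff_right commutes_def algebra_simps uc)
    ultimately obtain s t where st: "r * (w + adj w) = scaleC s r" "r * scaleC \<i> (w - adj w) = scaleC t r"
      by blast
    have "scaleR 2 (r * w) = r * (w + adj w) - scaleC \<i> (r * scaleC \<i> (w - adj w))"
      by (simp add: mult_scaleC_right scaleC_scaleC scaleC_one algebra_simps scaleR_2)
    also have "\<dots> = scaleC (s - \<i> * t) r" unfolding st by (simp add: scaleC_scaleC scaleC_diff_left)
    finally have "scaleR (1/2) (scaleR 2 (r * w)) = scaleR (1/2) (scaleC (s - \<i> * t) r)" by simp
    then have "r * w = scaleC (complex_of_real (1/2) * (s - \<i> * t)) r"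
      by (simp only: scaleR_scaleR) (simp add: scaleR_scaleC scaleC_scaleC scaleC_one)
    then show False using haar_no_eigenprojection[OF w rp(1)] r(2) by blast
  qed
  then have "atomless_algebra B" by (rule atomless_algebraI[OF max])
  then show ?thesis using B1 wB by blast
qed

lemma conv2_shift: "conv2 f x \<Longrightarrow> conv2 (\<lambda>n. f (n + k)) x"
  unfolding conv2_def by (rule LIMSEQ_ignore_initial_segment)

lemma n2_projection_diff:
  assumes "is_projection p" "is_projection q" "p * q = q"
  shows "(n2 (p - q))\<^sup>2 = (n2 p)\<^sup>2 - (n2 q)\<^sup>2"
proof -
  have "complex_of_real ((n2 (p - q))\<^sup>2) = complex_of_real ((n2 p)\<^sup>2 - (n2 q)\<^sup>2)"
    using tau_projection[OF is_projection_diff[OF assms]] tau_projection assms(1,2)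
    by (simp add: tau_diff)
  then show ?thesis by (simp only: of_real_eq_iff)
qed

lemma n2_projection_add:
  assumes "is_projection p" "is_projection q" "p * q = 0"
  shows "(n2 (p + q))\<^sup>2 = (n2 p)\<^sup>2 + (n2 q)\<^sup>2"
proof -
  have "complex_of_real ((n2 (p + q))\<^sup>2) = complex_of_real ((n2 p)\<^sup>2 + (n2 q)\<^sup>2)"
    using tau_projection[OF is_projection_add[OF assms]] tau_projection assms(1,2)
    by (simp add: tau_add)
  then show ?thesis by (simp only: of_real_eq_iff)
qed

text \<open>Of a proper nonzero subprojection and its complement, one has at most half the trace;
  iterate.\<close>

lemma atomless_small:
  assumes B: "atomless_algebra B" and r: "r \<in> B" "r \<noteq> 0" and e: "e > 0"
  shows "\<exists>s\<in>B. r * s = s \<and> s \<noteq> 0 \<and> (n2 s)\<^sup>2 < e"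
proof -
  note Bp = atomless_algebraD(1,2)[OF B] atomless_algebra_closed[OF B] atomless_algebraD(3)[OF B]
  have "\<exists>s\<in>B. r * s = s \<and> s \<noteq> 0 \<and> (n2 s)\<^sup>2 \<le> (n2 r)\<^sup>2 / 2 ^ n" for n
  proof (induction n)
    case 0
    then show ?case using r Bp(1)[OF r(1)] by (intro bexI[of _ r]) (auto simp: is_projection_def)
  next
    case (Suc n)
    then obtain s where s: "s \<in> B" "r * s = s" "s \<noteq> 0" "(n2 s)\<^sup>2 \<le> (n2 r)\<^sup>2 / 2 ^ n" by blast
    obtain q where q: "q \<in> B" "s * q = q" "q \<noteq> 0" "q \<noteq> s" using Bp(4)[OF s(1,3)] by blast
    have "(n2 (s - q))\<^sup>2 = (n2 s)\<^sup>2 - (n2 q)\<^sup>2" by (intro n2_projection_diff Bp(1) s q)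
    then consider "(n2 q)\<^sup>2 \<le> (n2 s)\<^sup>2 / 2" | "(n2 (s - q))\<^sup>2 \<le> (n2 s)\<^sup>2 / 2" by linarith
    then show ?case
    proof cases
      case 1
      then have "(n2 q)\<^sup>2 \<le> (n2 r)\<^sup>2 / 2 ^ Suc n" using s(4) by simp
      moreover have "r * q = q" using s(2) q(2) by (metis mult.assoc)
      ultimately show ?thesis using q by blast
    next
      case 2
      then have "(n2 (s - q))\<^sup>2 \<le> (n2 r)\<^sup>2 / 2 ^ Suc n" using s(4) by simp
      moreover have "r * (s - q) = s - q" using s(2) q(2) by (metis mult.assoc right_diff_distrib)
      moreover have "s - q \<in> B" by (rule atomless_algebra_diff[OF B s(1) q(1,2)])
      ultimately show ?thesis using q(4) by (intro bexI[of _ "s - q"]) auto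
    qed
  qed note ex = this
  have "(\<lambda>n. (n2 r)\<^sup>2 / 2 ^ n) \<longlonglongrightarrow> 0" by (rule LIMSEQ_divide_realpow_zero) simp
  then obtain n where "(n2 r)\<^sup>2 / 2 ^ n < e"
    using LIMSEQ_D[OF _ e] by (metis diff_zero abs_ge_self order_refl order_le_less_trans real_norm_def)
  then show ?thesis using ex[of n] by (meson order_le_less_trans)
qed

text \<open>Greedy exhaustion: below half of \<open>r\<close>, keep adding an admissible piece of at least half
  the maximal possible size.\<close>

lemma atomless_halving:
  assumes B: "atomless_algebra B" and r: "r \<in> B"
  shows "\<exists>s\<in>B. r * s = s \<and> \<tau> s = \<tau> r / 2"
proof -
  note Bp = atomless_algebraD(1,2)[OF B] atomless_algebra_closed[OF B]
  have pp: "p * p = p" "adj p = p" if "p \<in> B" for p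
    using Bp(1)[OF that] by (auto simp: is_projection_def)
  define t where "t p = (n2 p)\<^sup>2" for p
  have t0: "t p \<ge> 0" for p by (simp add: t_def)
  have zB: "0 \<in> B" by (rule atomless_algebra_closed[OF B]) auto
  define D where "D s = {d \<in> B. r * d = d \<and> s * d = 0 \<and> t s + t d \<le> t r / 2}" for s
  define P where "P s \<longleftrightarrow> s \<in> B \<and> r * s = s \<and> t s \<le> t r / 2" for s
  \<comment> \<open>The factor 2 says that the piece added to \<open>s\<close> has at least half the
    trace of every admissible piece; the supremum itself need not be attained.\<close>
  define Q where "Q s s' \<longleftrightarrow> s' * s = s \<and> (\<forall>d\<in>D s. t d \<le> 2 * (t s' - t s))" for s s'
  have "\<exists>s'. P s' \<and> Q s s'" if s: "P s" for s
  proof -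
    have "\<exists>d\<in>D s. \<forall>d'\<in>D s. t d' \<le> 2 * t d"
    proof (cases "\<forall>d\<in>D s. t d = 0")
      case True
      have "0 \<in> D s" using s zB by (simp add: D_def P_def t_def)
      then show ?thesis using True by (intro bexI[of _ 0]) auto
    next
      case False
      define m where "m = Sup (t ` D s)"
      have "bdd_above (t ` D s)"
        using t0[of s] by (intro bdd_aboveI[of _ "t r / 2"]) (auto simp: D_def)
      then have le: "t d \<le> m" if "d \<in> D s" for d unfolding m_def by (rule cSUP_upper[OF that])
      obtain d0 where "d0 \<in> D s" "t d0 \<noteq> 0" using False by blast
      then have "m > 0" using le[of d0] t0[of d0] by linarith
      then have "m / 2 < Sup (t ` D s)" unfolding m_def by simp
      then obtain d where "d \<in> D s" "m / 2 < t d"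
        using less_cSup_iff[of "t ` D s" "m / 2"] \<open>d0 \<in> D s\<close> \<open>bdd_above (t ` D s)\<close> by blast
      then show ?thesis using le by (intro bexI[of _ d]) (auto intro: order_trans[OF le])
    qed
    then obtain d where d: "d \<in> D s" "\<And>d'. d' \<in> D s \<Longrightarrow> t d' \<le> 2 * t d" by blast
    have dB: "d \<in> B" "r * d = d" "s * d = 0" "t s + t d \<le> t r / 2" using d(1) by (auto simp: D_def)
    have sB: "s \<in> B" "r * s = s" using s by (auto simp: P_def)
    have "d * s = 0" using Bp(2)[OF dB(1) sB(1)] dB(3) by (simp add: commutes_def)
    have tsd: "t (s + d) = t s + t d" unfolding t_def by (intro n2_projection_add Bp(1) sB dB)
    have "s + d \<in> B" by (rule atomless_algebra_add[OF B sB(1) dB(1,3)])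
    moreover have "r * (s + d) = s + d" by (simp add: distrib_left sB dB)
    ultimately have "P (s + d)" using tsd dB(4) by (simp add: P_def)
    moreover have "Q s (s + d)"
      using d(2) by (simp add: Q_def tsd distrib_right pp[OF sB(1)] \<open>d * s = 0\<close>)
    ultimately show ?thesis by blast
  qed
  moreover have "P 0" using zB t0[of r] by (simp add: P_def t_def)
  ultimately obtain S where S: "\<And>n. P (S n)" "\<And>n. Q (S n) (S (Suc n))"
    using dependent_nat_choice[of "\<lambda>_. P" "\<lambda>_. Q"] by blast
  have SB: "S n \<in> B" "r * S n = S n" "t (S n) \<le> t r / 2" for n using S(1)[of n] by (auto simp: P_def)
  have mono: "S (n + k) * S n = S n" for n k
  proof (induction k)
    case (Suc k)
    have "S (Suc (n + k)) * S (n + k) = S (n + k)" using S(2)[of "n + k"] by (simp add: Q_def)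
    then show ?case using Suc by (metis add_Suc_right mult.assoc)
  qed (simp add: pp SB)
  have dist: "(n2 (S (n + k) - S n))\<^sup>2 = t (S (n + k)) - t (S n)" for n k
    unfolding t_def by (intro n2_projection_diff Bp(1) SB mono)
  have "t (S n) \<le> t (S (Suc n))" for n
    using dist[of n 1] zero_le_power2[of "n2 (S (n + 1) - S n)"] by (simp del: zero_le_power2)
  then have "incseq (\<lambda>n. t (S n))" by (rule incseq_SucI)
  then obtain L where L: "(\<lambda>n. t (S n)) \<longlonglongrightarrow> L" "\<And>n. t (S n) \<le> L"
    using incseq_convergent[of "\<lambda>n. t (S n)" "t r / 2"] SB(3) by metis
  obtain s where s: "conv2 S s"
  proof (rule conv2_complete[of S])
    show "norm (S n) \<le> 1" for n by (intro norm_is_projection Bp(1) SB)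
    fix e :: real assume e: "e > 0"
    then obtain N where N: "\<And>n. n \<ge> N \<Longrightarrow> \<bar>t (S n) - L\<bar> < e\<^sup>2"
      using LIMSEQ_D[OF L(1), of "e\<^sup>2"] by auto
    have *: "n2 (S m - S n) < e" if mn: "N \<le> n" "n \<le> m" for m n
    proof (rule power2_less_imp_less)
      obtain k where k: "m = n + k" using le_Suc_ex[OF mn(2)] by metis
      show "(n2 (S m - S n))\<^sup>2 < e\<^sup>2"
        unfolding k dist using N[OF mn(1)] L(2)[of "n + k"] by linarith
    qed (use e in simp)
    have "n2 (S m - S n) < e" if "m \<ge> N" "n \<ge> N" for m n
      using *[of n m] *[of m n] that n2_minus_commute[of "S m"] by (cases "n \<le> m") auto
    then show "\<exists>N. \<forall>m\<ge>N. \<forall>n\<ge>N. n2 (S m - S n) < e" by blast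
  qed
  have sS: "s * S n = S n" for n
  proof (rule conv2_unique)
    show "conv2 (\<lambda>k. S (k + n) * S n) (s * S n)" by (intro conv2_mult_right conv2_shift s)
    have "S (k + n) * S n = S n" for k using mono[of n k] by (simp add: add.commute)
    then show "conv2 (\<lambda>k. S (k + n) * S n) (S n)" by simp
  qed
  have ss: "s * s = s"
    by (rule conv2_unique[OF conv2_mult_left[OF s]]) (simp add: sS s)
  have as: "adj s = s" by (rule conv2_adj_self[OF s]) (simp add: pp SB)
  have sp: "is_projection s" by (simp add: is_projection_def as ss)
  have sB: "s \<in> B"
  proof (rule atomless_algebra_closed[OF B sp])
    fix x assume "\<And>b. b \<in> B \<Longrightarrow> commutes x b"
    then show "commutes x s" by (intro conv2_commutes[OF s]) (simp add: SB)
  qed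
  have rs: "r * s = s"
    by (rule conv2_unique[OF conv2_mult_left[OF s]]) (simp add: SB s)
  have tS: "(n2 (s - S n))\<^sup>2 = t s - t (S n)" for n
    unfolding t_def by (intro n2_projection_diff sp Bp(1) SB sS)
  have Ss: "t (S n) \<le> t s" for n using tS[of n] by (metis diff_ge_0_iff_ge zero_le_power2)
  have "(\<lambda>n. (n2 (s - S n))\<^sup>2) \<longlonglongrightarrow> 0\<^sup>2"
    using s unfolding conv2_def n2_minus_commute[of _ s] by (rule tendsto_power)
  then have "(\<lambda>n. t s - (t s - t (S n))) \<longlonglongrightarrow> t s - 0" unfolding tS by (intro tendsto_intros) simp
  then have tlim: "(\<lambda>n. t (S n)) \<longlonglongrightarrow> t s" by simp
  then have "t s \<le> t r / 2" using SB(3) by (intro LIMSEQ_le_const2) auto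
  \<comment> \<open>Otherwise a small nonzero \<open>d\<close> under \<open>r - s\<close> would be
    admissible at every stage, so each increment would be at least half of \<open>t d\<close>,
    whereas the increments tend to 0.\<close>
  moreover have "\<not> t s < t r / 2"
  proof
    assume lt: "t s < t r / 2"
    have trs: "t (r - s) = t r - t s"
      unfolding t_def by (intro n2_projection_diff Bp(1) r sB rs)
    have "r - s \<noteq> 0"
    proof
      assume "r - s = 0"
      then have "t s = t r" by (simp add: t_def)
      then show False using lt t0[of r] by linarith
    qed
    moreover have rsB: "r - s \<in> B" by (rule atomless_algebra_diff[OF B r sB rs])
    ultimately obtain d where d: "d \<in> B" "(r - s) * d = d" "d \<noteq> 0" "t d < t r / 2 - t s"
      using atomless_small[OF B, of "r - s" "t r / 2 - t s"] lt unfolding t_def by auto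
    have "s * r = s" using rs Bp(2)[OF sB r] by (simp add: commutes_def)
    have sd: "s * d = 0"
      by (subst d(2)[symmetric]) (simp add: ss \<open>s * r = s\<close> right_diff_distrib flip: mult.assoc)
    have rd: "r * d = d"
      by (subst (1 2) d(2)[symmetric]) (simp add: rs pp[OF r] right_diff_distrib flip: mult.assoc)
    have "d \<in> D (S n)" for n
    proof -
      have "S n * s = S n" using sS[of n] Bp(2)[OF sB SB(1)[of n]] by (simp add: commutes_def)
      then have "S n * d = 0" using sd by (metis mult.assoc mult_zero_right)
      then show ?thesis using d rd Ss[of n] by (simp add: D_def)
    qed
    then have "t d \<le> 2 * (t (S (Suc n)) - t (S n))" for n using S(2)[of n] by (auto simp: Q_def)
    moreover have "(\<lambda>n. 2 * (t (S (Suc n)) - t (S n))) \<longlonglongrightarrow> 2 * (t s - t s)"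
      by (intro tendsto_intros tlim LIMSEQ_Suc[OF tlim])
    ultimately have "t d \<le> 2 * (t s - t s)" by (intro LIMSEQ_le_const) auto
    then have "t d = 0" using t0[of d] by simp
    then show False using d(3) by (simp add: t_def)
  qed
  ultimately have "t s = t r / 2" by linarith
  then have "complex_of_real (t s) = complex_of_real (t r) / 2" by (simp only: of_real_divide of_real_numeral)
  then have "\<tau> s = \<tau> r / 2"
    unfolding tau_projection[OF sp] tau_projection[OF Bp(1)[OF r]] t_def[symmetric] .
  then show ?thesis using sB rs by blast
qed

end

section \<open>Haar unitaries from dyadic trees\<close>

lemma cmod_cis_diff_le: "cmod (cis a - cis b) \<le> \<bar>a - b\<bar>"
proof -
  have "cis a - cis b = cis b * (exp (\<i> * of_real (a - b)) - 1)"
    by (simp add: cis_conv_exp algebra_simps flip: exp_add)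
  then have "cmod (cis a - cis b) = 2 * \<bar>sin ((a - b) / 2)\<bar>"
    by (simp add: norm_mult dist_exp_i_1 del: of_real_diff)
  also have "\<dots> \<le> 2 * \<bar>(a - b) / 2\<bar>" by (intro mult_left_mono abs_sin_x_le_abs_x) auto
  finally show ?thesis by simp
qed

lemma dyadic_small:
  fixes C :: real
  assumes "r > 0"
  shows "\<exists>N. \<forall>l\<ge>N. C / 2 ^ l < r"
proof -
  have "(\<lambda>l. C / 2 ^ l) \<longlonglongrightarrow> 0" by (rule LIMSEQ_divide_realpow_zero) simp
  from order_tendstoD(2)[OF this assms] show ?thesis by (simp add: eventually_sequentially)
qed

lemma sum_pairs:
  fixes f :: "nat \<Rightarrow> 'b::comm_monoid_add"
  shows "(\<Sum>j<2 * n. f j) = (\<Sum>j<n. f (2 * j) + f (2 * j + 1))"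
  by (induction n) (auto simp: add.assoc)

lemma sum_roots_of_unity:
  assumes "1 \<le> n" "n < N"
  shows "(\<Sum>j<N. cis (2 * pi * real j / real N) ^ n) = 0"
proof -
  define w where "w = cis (2 * pi * real n / real N)"
  have "w \<noteq> 1"
  proof
    assume "w = 1"
    then have "cos (2 * pi * real n / real N) = 1" by (simp add: w_def complex_eq_iff)
    then obtain k :: int where "2 * pi * real n / real N = real_of_int k * 2 * pi"
      using cos_one_2pi_int by blast
    then have "real n = real_of_int k * real N"
      using assms by (simp add: field_simps)
    then have eq: "int n = k * int N" by (metis of_int_eq_iff of_int_mult of_int_of_nat_eq)
    have "0 < k * int N" using eq assms by linarith
    then have "k \<ge> 1" using zero_less_mult_pos2[of k "int N"] assms by simp
    then have "int N \<le> k * int N" by (simp add: mult_le_cancel_right1)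
    then show False using eq assms(2) by linarith
  qed
  moreover have "w ^ N = 1"
  proof -
    have "real N * (2 * pi * real n / real N) = 2 * pi * real n" using assms by simp
    then show ?thesis unfolding w_def Complex.DeMoivre by (simp only: cis_multiple_2pi Ints_of_nat)
  qed
  moreover have "cis (2 * pi * real j / real N) ^ n = w ^ j" for j
    by (simp add: w_def Complex.DeMoivre algebra_simps)
  ultimately show ?thesis by (simp add: geometric_sum)
qed

definition (in tracial) dyadic_partition :: "nat \<Rightarrow> (nat \<Rightarrow> 'a) \<Rightarrow> bool" where
  "dyadic_partition l c \<longleftrightarrow>
    (\<forall>j<2^l. is_projection (c j) \<and> \<tau> (c j) = 1 / 2^l) \<and>
    (\<forall>i<2^l. \<forall>j<2^l. i \<noteq> j \<longrightarrow> c i * c j = 0)"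

text \<open>A step function on the circle: \<open>c j\<close> stands for the \<open>j\<close>-th
  dyadic arc of level \<open>l\<close> and carries the value at its initial point.\<close>

definition dyadic_sum :: "nat \<Rightarrow> (nat \<Rightarrow> 'a::cstar_algebra) \<Rightarrow> 'a" where
  "dyadic_sum l c = (\<Sum>j<2^l. scaleC (cis (2 * pi * real j / 2^l)) (c j))"

context tracial
begin

lemma orthogonal_sum_mult:
  fixes c :: "nat \<Rightarrow> 'a"
  assumes c: "\<And>j. j < N \<Longrightarrow> is_projection (c j)" "\<And>i j. i < N \<Longrightarrow> j < N \<Longrightarrow> i \<noteq> j \<Longrightarrow> c i * c j = 0"
  shows "(\<Sum>j<N. scaleC (a j) (c j)) * (\<Sum>j<N. scaleC (b j) (c j)) = (\<Sum>j<N. scaleC (a j * b j) (c j))"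
proof -
  have "(\<Sum>j<N. scaleC (a j) (c j)) * (\<Sum>j<N. scaleC (b j) (c j)) =
    (\<Sum>i<N. \<Sum>j<N. scaleC (a i * b j) (c i * c j))"
    by (simp add: sum_product mult_scaleC_left mult_scaleC_right scaleC_scaleC mult.commute)
  also have "\<dots> = (\<Sum>i<N. \<Sum>j<N. if j = i then scaleC (a i * b i) (c i) else 0)"
    using c by (intro sum.cong refl) (auto simp: is_projection_def)
  also have "\<dots> = (\<Sum>j<N. scaleC (a j * b j) (c j))" by simp
  finally show ?thesis .
qed

lemma orthogonal_sum_adj:
  fixes c :: "nat \<Rightarrow> 'a"
  assumes "\<And>j. j < N \<Longrightarrow> is_projection (c j)"
  shows "adj (\<Sum>j<N. scaleC (a j) (c j)) = (\<Sum>j<N. scaleC (cnj (a j)) (c j))"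
  unfolding adj_sum by (rule sum.cong) (use assms in \<open>auto simp: adj_scaleC is_projection_def\<close>)

lemma orthogonal_sum_n2:
  fixes c :: "nat \<Rightarrow> 'a"
  assumes c: "\<And>j. j < N \<Longrightarrow> is_projection (c j)" "\<And>i j. i < N \<Longrightarrow> j < N \<Longrightarrow> i \<noteq> j \<Longrightarrow> c i * c j = 0"
  shows "(n2 (\<Sum>j<N. scaleC (a j) (c j)))\<^sup>2 = (\<Sum>j<N. (cmod (a j))\<^sup>2 * Re (\<tau> (c j)))"
proof -
  have "\<tau> (adj (\<Sum>j<N. scaleC (a j) (c j)) * (\<Sum>j<N. scaleC (a j) (c j)))
    = (\<Sum>j<N. complex_of_real ((cmod (a j))\<^sup>2) * \<tau> (c j))"
    by (simp add: orthogonal_sum_adj[OF c(1)] orthogonal_sum_mult[OF c] tau_sum tau_scaleC complex_norm_square mult.commute del: of_real_power)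
  then show ?thesis by (simp add: n2_square del: of_real_power)
qed

lemma dyadic_partitionD:
  assumes "dyadic_partition l c"
  shows "j < 2^l \<Longrightarrow> is_projection (c j)" "j < 2^l \<Longrightarrow> \<tau> (c j) = 1 / 2^l"
    "i < 2^l \<Longrightarrow> j < 2^l \<Longrightarrow> i \<noteq> j \<Longrightarrow> c i * c j = 0"
  using assms by (auto simp: dyadic_partition_def)

text \<open>The complement of the sum is a projection of trace 0, so faithfulness kills it.\<close>

lemma dyadic_partition_sum:
  assumes "dyadic_partition l c"
  shows "(\<Sum>j<2^l. c j) = 1"
proof -
  note d = dyadic_partitionD[OF assms]
  have p: "is_projection (\<Sum>j<2^l. c j)" by (rule is_projection_sum) (use d in auto)
  have "\<tau> (1 - (\<Sum>j<2^l. c j)) = 0" by (simp add: tau_diff tau_one tau_sum d)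
  then have "(n2 (1 - (\<Sum>j<2^l. c j)))\<^sup>2 = 0"
    using tau_projection[OF is_projection_compl[OF p]] by simp
  then show ?thesis by simp
qed

lemma dyadic_sum_power:
  assumes "dyadic_partition l c"
  shows "dyadic_sum l c ^ n = (\<Sum>j<2^l. scaleC (cis (2 * pi * real j / 2^l) ^ n) (c j))"
proof (induction n)
  case 0
  then show ?case using dyadic_partition_sum[OF assms] by (simp add: scaleC_one)
next
  case (Suc n)
  then show ?case
    by (simp add: dyadic_sum_def orthogonal_sum_mult[of "2^l" c, OF dyadic_partitionD(1,3)[OF assms]])
qed

lemma dyadic_sum_unitary:
  assumes "dyadic_partition l c"
  shows "unitary (dyadic_sum l c)"
proof -
  note d = dyadic_partitionD(1,3)[OF assms]
  have "cnj (cis t) * cis t = 1" "cis t * cnj (cis t) = 1" for t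
    by (simp_all add: complex_eq_iff flip: power2_eq_square)
  then show ?thesis
    unfolding unitary_def dyadic_sum_def
    by (simp add: orthogonal_sum_adj[OF d(1)] orthogonal_sum_mult[OF d] scaleC_one dyadic_partition_sum[OF assms])
qed

lemma tau_dyadic_sum_power:
  assumes "dyadic_partition l c" "1 \<le> n" "n < 2 ^ l"
  shows "\<tau> (dyadic_sum l c ^ n) = 0"
proof -
  have "\<tau> (dyadic_sum l c ^ n) = (\<Sum>j<2^l. cis (2 * pi * real j / 2^l) ^ n) * (1 / 2 ^ l)"
    unfolding dyadic_sum_power[OF assms(1)]
    by (simp add: tau_sum tau_scaleC dyadic_partitionD(2)[OF assms(1)] sum_divide_distrib)
  also have "(\<Sum>j<2^l. cis (2 * pi * real j / 2^l) ^ n) = 0"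
    using sum_roots_of_unity[OF assms(2,3)] by simp
  finally show ?thesis by simp
qed

text \<open>Refinement leaves the value on left children unchanged and moves the angle on right
  children by pi/2^l.\<close>

lemma dyadic_sum_refine:
  assumes c: "dyadic_partition (Suc l) c" and b: "\<And>j. j < 2^l \<Longrightarrow> b j = c (2 * j) + c (2 * j + 1)"
  shows "n2 (dyadic_sum (Suc l) c - dyadic_sum l b) \<le> pi / 2 ^ l"
proof -
  define \<omega> where "\<omega> t = cis (2 * pi * t)" for t
  define a where "a j = (if even j then 0 else \<omega> (real j / 2^Suc l) - \<omega> (real (j div 2) / 2^l))" for j :: nat
  have "dyadic_sum (Suc l) c - dyadic_sum l b = (\<Sum>j<2 * 2^l. scaleC (a j) (c j))"
    unfolding dyadic_sum_def power_Suc sum_pairs sum_subtractf[symmetric]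
  proof (rule sum.cong[OF refl])
    fix j :: nat assume "j \<in> {..<2^l}"
    then show "scaleC (cis (2 * pi * real (2 * j) / (2 * 2 ^ l))) (c (2 * j)) +
         scaleC (cis (2 * pi * real (2 * j + 1) / (2 * 2 ^ l))) (c (2 * j + 1)) -
         scaleC (cis (2 * pi * real j / 2 ^ l)) (b j) =
         scaleC (a (2 * j)) (c (2 * j)) + scaleC (a (2 * j + 1)) (c (2 * j + 1))"
      using b[of j] by (simp add: a_def \<omega>_def scaleC_add_right scaleC_diff_left mult.assoc)
  qed
  then have eq: "dyadic_sum (Suc l) c - dyadic_sum l b = (\<Sum>j<2^Suc l. scaleC (a j) (c j))" by simp
  have am: "cmod (a j) \<le> pi / 2^l" for j
  proof (cases "even j")
    case False
    then have "real j = 2 * real (j div 2) + 1" by (auto elim!: oddE)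
    then have "2 * pi * (real j / 2^Suc l) - 2 * pi * (real (j div 2) / 2^l) = pi / 2 ^ l"
      by (simp add: field_simps)
    then show ?thesis
      using cmod_cis_diff_le[of "2 * pi * (real j / 2^Suc l)" "2 * pi * (real (j div 2) / 2^l)"] False
      by (simp only: a_def \<omega>_def if_False) simp
  qed (simp add: a_def)
  have "(n2 (dyadic_sum (Suc l) c - dyadic_sum l b))\<^sup>2 = (\<Sum>j<2^Suc l. (cmod (a j))\<^sup>2 * Re (\<tau> (c j)))"
    unfolding eq by (rule orthogonal_sum_n2[of _ c, OF dyadic_partitionD(1,3)[OF c]])
  also have "\<dots> = (\<Sum>j<2^Suc l. (cmod (a j))\<^sup>2 * (1 / 2^Suc l))"
  proof (rule sum.cong[OF refl])
    fix j :: nat assume "j \<in> {..<2^Suc l}"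
    then have "\<tau> (c j) = complex_of_real (1 / 2^Suc l)" using dyadic_partitionD(2)[OF c, of j] by simp
    then show "(cmod (a j))\<^sup>2 * Re (\<tau> (c j)) = (cmod (a j))\<^sup>2 * (1 / 2^Suc l)" by (simp only: Re_complex_of_real)
  qed
  also have "\<dots> \<le> (\<Sum>j<(2::nat)^Suc l. (pi / 2^l)\<^sup>2 * (1 / 2^Suc l))"
    by (intro sum_mono mult_right_mono power_mono am) auto
  also have "\<dots> = (pi / 2^l)\<^sup>2" by simp
  finally show ?thesis by (rule power2_le_imp_le) simp
qed

text \<open>Levels below \<open>L\<close> are unconstrained, so that a tree can be grown from a
  prescribed partition at level \<open>L\<close>.\<close>

definition dyadic_tree :: "nat \<Rightarrow> (nat \<Rightarrow> nat \<Rightarrow> 'a) \<Rightarrow> bool" where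
  "dyadic_tree L e \<longleftrightarrow> (\<forall>l\<ge>L. dyadic_partition l (e l) \<and>
    (\<forall>j<2^l. e l j = e (Suc l) (2 * j) + e (Suc l) (2 * j + 1)))"

lemma dyadic_treeD:
  assumes "dyadic_tree L e" "L \<le> l"
  shows "dyadic_partition l (e l)"
    and "j < 2^l \<Longrightarrow> e l j = e (Suc l) (2 * j) + e (Suc l) (2 * j + 1)"
  using assms unfolding dyadic_tree_def by blast+

text \<open>The rate is the sum of the refinement steps pi/2^k over k \<ge> l.\<close>

definition tree_limit :: "nat \<Rightarrow> (nat \<Rightarrow> nat \<Rightarrow> 'a) \<Rightarrow> 'a \<Rightarrow> bool" where
  "tree_limit L e y \<longleftrightarrow> dyadic_tree L e \<and> y \<in> haar \<tau> \<and> (\<forall>l\<ge>L. n2 (y - dyadic_sum l (e l)) \<le> 2 * pi / 2^l)"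

definition tree_haar :: "'a set" where
  "tree_haar = {y. \<exists>L e. tree_limit L e y}"

lemma conv2_haar:
  assumes lim: "conv2 f y" and u: "\<And>n. unitary (f n)" and t: "\<And>k. k \<ge> 1 \<Longrightarrow> (\<lambda>n. \<tau> (f n ^ k)) \<longlonglongrightarrow> 0"
  shows "y \<in> haar \<tau>"
proof -
  have n: "norm (f n) \<le> 1" for n using norm_unitary[OF u[of n]] by simp
  have "conv2 (\<lambda>n. adj (f n) * f n) (adj y * y)" "conv2 (\<lambda>n. f n * adj (f n)) (y * adj y)"
    by (rule conv2_mult[OF conv2_adj[OF lim] lim, of 1] conv2_mult[OF lim conv2_adj[OF lim], of 1], simp add: n)+
  then have "conv2 (\<lambda>n. 1) (adj y * y)" "conv2 (\<lambda>n. 1) (y * adj y)"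
    using u by (simp_all add: unitary_def)
  then have "unitary y" using conv2_unique[OF conv2_const] unfolding unitary_def by metis
  moreover have "\<tau> (y ^ k) = 0" if "k \<ge> 1" for k
    using LIMSEQ_unique[OF conv2_tau[OF conv2_power[OF lim n]] t[OF that]] .
  ultimately show ?thesis by (simp add: haar_def)
qed

lemma tree_limit_exists:
  assumes e: "dyadic_tree L e"
  shows "\<exists>y. tree_limit L e y \<and> conv2 (\<lambda>l. dyadic_sum (l + L) (e (l + L))) y"
proof -
  define s where "s l = dyadic_sum (l + L) (e (l + L))" for l
  have ep: "dyadic_partition (l + L) (e (l + L))" for l
    using dyadic_treeD(1)[OF e] by simp
  have un: "unitary (s l)" for l unfolding s_def by (rule dyadic_sum_unitary[OF ep])
  have step: "n2 (s (Suc l) - s l) \<le> pi / 2 ^ (l + L)" for l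
    unfolding s_def add_Suc
  proof (rule dyadic_sum_refine)
    show "dyadic_partition (Suc (l + L)) (e (Suc (l + L)))" using ep[of "Suc l"] by simp
    show "e (l + L) j = e (Suc (l + L)) (2 * j) + e (Suc (l + L)) (2 * j + 1)" if "j < 2 ^ (l + L)" for j
      by (rule dyadic_treeD(2)[OF e _ that]) simp
  qed
  \<comment> \<open>The exact partial geometric sum is what makes the induction close;
    \<open>far'\<close> then drops the subtracted term.\<close>
  have far: "n2 (s (l + k) - s l) \<le> 2 * pi / 2 ^ (l + L) - 2 * pi / 2 ^ (l + k + L)" for l k
  proof (induction k)
    case (Suc k)
    have "n2 (s (l + Suc k) - s l) \<le> n2 (s (Suc (l + k)) - s (l + k)) + n2 (s (l + k) - s l)"
      using n2_triangle_diff by simp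
    also have "\<dots> \<le> pi / 2 ^ (l + k + L) + (2 * pi / 2 ^ (l + L) - 2 * pi / 2 ^ (l + k + L))"
      by (intro add_mono step Suc)
    also have "\<dots> = 2 * pi / 2 ^ (l + L) - 2 * pi / 2 ^ (l + Suc k + L)"
      by (simp add: field_simps)
    finally show ?case .
  qed simp
  have far': "n2 (s (l + k) - s l) \<le> 2 * pi / 2 ^ (l + L)" for l k
    using far[of l k] by (smt (verit) divide_nonneg_pos pi_ge_zero zero_less_power)
  obtain y where y: "conv2 s y"
  proof (rule conv2_complete[of s])
    show "norm (s l) \<le> 1" for l using norm_unitary[OF un] by simp
    fix r :: real assume r: "r > 0"
    obtain N where N: "2 * pi / 2 ^ L / 2 ^ N < r / 2"
      using dyadic_small[of "r / 2" "2 * pi / 2 ^ L"] r by auto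
    have near: "n2 (s m - s N) < r / 2" if m: "m \<ge> N" for m
    proof -
      obtain k where "m = N + k" using le_Suc_ex[OF m] by metis
      moreover have "2 * pi / 2 ^ (N + L) = 2 * pi / 2 ^ L / 2 ^ N" by (simp add: power_add)
      ultimately show ?thesis using far'[of N k] N by simp
    qed
    have "n2 (s m - s n) < r" if "m \<ge> N" "n \<ge> N" for m n
      using near[OF that(1)] near[OF that(2)] n2_triangle_diff[of "s m" "s n" "s N"]
        n2_minus_commute[of "s n" "s N"] by linarith
    then show "\<exists>N. \<forall>m\<ge>N. \<forall>n\<ge>N. n2 (s m - s n) < r" by blast
  qed
  have "y \<in> haar \<tau>"
  proof (rule conv2_haar[OF y un])
    fix k :: nat assume k: "k \<ge> 1"
    \<comment> \<open>At a given level only the moments below 2 to the level vanish, but each fixed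
      moment vanishes from some level on.\<close>
    have "\<tau> (s n ^ k) = 0" if "n \<ge> k" for n
      unfolding s_def
    proof (rule tau_dyadic_sum_power[OF ep k])
      have "k < 2 ^ k" by (rule less_exp)
      also have "(2::nat) ^ k \<le> 2 ^ (n + L)" using that by (intro power_increasing) auto
      finally show "k < 2 ^ (n + L)" .
    qed
    then have "\<forall>\<^sub>F n in sequentially. \<tau> (s n ^ k) = 0" by (rule eventually_sequentiallyI)
    then show "(\<lambda>n. \<tau> (s n ^ k)) \<longlonglongrightarrow> 0" by (rule tendsto_eventually)
  qed
  moreover have "n2 (y - dyadic_sum l (e l)) \<le> 2 * pi / 2 ^ l" if l: "l \<ge> L" for l
  proof -
    obtain m where m: "l = m + L" using le_Suc_ex[OF l] by (metis add.commute)
    have "(\<lambda>k. 2 * pi / 2 ^ l + n2 (s (k + m) - y)) \<longlonglongrightarrow> 2 * pi / 2 ^ l + 0"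
      using conv2_shift[OF y] unfolding conv2_def by (intro tendsto_intros)
    moreover have "n2 (y - s m) \<le> 2 * pi / 2 ^ l + n2 (s (k + m) - y)" for k
      using far'[of m k] n2_triangle_diff[of y "s m" "s (k + m)"] n2_minus_commute[of y "s (k + m)"]
      by (simp add: m add.commute)
    ultimately show ?thesis
      unfolding m s_def by (intro LIMSEQ_le_const[of _ "2 * pi / 2 ^ (m + L)"]) auto
  qed
  ultimately show ?thesis using e y unfolding tree_limit_def s_def by blast
qed

lemma haar_conj:
  assumes y: "y \<in> haar \<tau>" and g: "unitary g"
  shows "g * y * adj g \<in> haar \<tau>"
proof -
  have pow: "(g * y * adj g) ^ n = g * y ^ n * adj g" for n
    by (induction n) (simp_all add: unitary_cancel[OF g] mult.assoc)
  have "\<tau> (g * y ^ n * adj g) = \<tau> (y ^ n)" for n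
    using tau_commute[of "g * y ^ n" "adj g"] by (simp add: unitary_cancel[OF g] flip: mult.assoc)
  moreover have "unitary (g * y * adj g)" using y g haarD(1)[OF y] by (simp add: unitary_mult unitary_adj)
  ultimately show ?thesis using haarD(2)[OF y] by (simp add: haar_def pow)
qed

lemma n2_conj: "unitary g \<Longrightarrow> n2 (g * x * adj g) = n2 x"
  by (simp add: n2_unitary_left n2_unitary_right unitary_adj)

lemma dyadic_partition_conj:
  assumes c: "dyadic_partition l c" and g: "unitary g"
  shows "dyadic_partition l (\<lambda>j. g * c j * adj g)"
  unfolding dyadic_partition_def
proof (intro conjI allI impI)
  note d = dyadic_partitionD[OF c]
  fix j :: nat assume j: "j < 2^l"
  show "is_projection (g * c j * adj g)" by (rule is_projection_conj[OF g d(1)[OF j]])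
  have "\<tau> (g * c j * adj g) = \<tau> (adj g * (g * c j))" by (rule tau_commute)
  then show "\<tau> (g * c j * adj g) = 1 / 2^l" by (simp add: unitary_cancel[OF g] d(2)[OF j])
  fix i :: nat assume i: "i < 2^l" "j \<noteq> i"
  have "g * c j * adj g * (g * c i * adj g) = g * (c j * c i) * adj g"
    by (simp add: mult.assoc unitary_cancel[OF g])
  then show "g * c j * adj g * (g * c i * adj g) = 0" using d(3)[OF j i] by simp
qed

lemma dyadic_sum_conj: "dyadic_sum l (\<lambda>j. g * c j * h) = g * dyadic_sum l c * h"
  by (simp add: dyadic_sum_def sum_distrib_left sum_distrib_right mult_scaleC_left mult_scaleC_right)

lemma tree_limit_conj:
  assumes y: "tree_limit L e y" and g: "unitary g"
  shows "tree_limit L (\<lambda>l j. g * e l j * adj g) (g * y * adj g)"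
proof -
  have "n2 (g * y * adj g - dyadic_sum l (\<lambda>j. g * e l j * adj g)) = n2 (y - dyadic_sum l (e l))" for l
  proof -
    have "g * y * adj g - dyadic_sum l (\<lambda>j. g * e l j * adj g) = g * (y - dyadic_sum l (e l)) * adj g"
      unfolding dyadic_sum_conj by (simp add: algebra_simps)
    then show ?thesis by (simp only: n2_conj[OF g])
  qed
  moreover have "dyadic_tree L (\<lambda>l j. g * e l j * adj g)"
    unfolding dyadic_tree_def
  proof (intro allI impI conjI)
    have e: "dyadic_tree L e" using y by (simp add: tree_limit_def)
    fix l assume l: "L \<le> l"
    show "dyadic_partition l (\<lambda>j. g * e l j * adj g)"
      by (rule dyadic_partition_conj[OF dyadic_treeD(1)[OF e l] g])
    show "g * e l j * adj g = g * e (Suc l) (2 * j) * adj g + g * e (Suc l) (2 * j + 1) * adj g" if "j < 2^l" for j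
      by (subst dyadic_treeD(2)[OF e l that]) (simp only: distrib_left distrib_right)
  qed
  ultimately show ?thesis using y haar_conj[of y, OF _ g] by (simp add: tree_limit_def)
qed

lemma tree_haar_conj: "y \<in> tree_haar \<Longrightarrow> unitary g \<Longrightarrow> g * y * adj g \<in> tree_haar"
  unfolding tree_haar_def using tree_limit_conj by blast

lemma tree_haar_subset: "tree_haar \<subseteq> haar \<tau>"
  by (auto simp: tree_haar_def tree_limit_def)

text \<open>Agreement at a single level suffices, so approximating tree-built unitaries is a matter
  of finite partitions.\<close>

lemma tree_limit_near:
  assumes "tree_limit L e y" "tree_limit L' e' y'" "L \<le> l" "L' \<le> l" "\<And>j. j < 2^l \<Longrightarrow> e l j = e' l j"
  shows "n2 (y - y') \<le> 4 * pi / 2^l"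
proof -
  have "dyadic_sum l (e l) = dyadic_sum l (e' l)" using assms(5) by (simp add: dyadic_sum_def)
  moreover have "n2 (y - dyadic_sum l (e l)) \<le> 2 * pi / 2^l" "n2 (y' - dyadic_sum l (e' l)) \<le> 2 * pi / 2^l"
    using assms by (auto simp: tree_limit_def)
  ultimately show ?thesis
    using n2_triangle_diff[of y y' "dyadic_sum l (e l)"] n2_minus_commute[of y' "dyadic_sum l (e l)"] by simp
qed

text \<open>Each projection \<open>r\<close> of the tree splits into \<open>h r\<close> and
  \<open>r - h r\<close>, both in \<open>B\<close>. The last conclusion puts \<open>y\<close> into
  the bicommutant of \<open>B\<close>; thus two unitaries grown in the same \<open>B\<close>
  commute.\<close>

lemma atomless_tree:
  assumes B: "atomless_algebra B" and c: "dyadic_partition L c" "\<And>j. j < 2^L \<Longrightarrow> c j \<in> B"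
  shows "\<exists>e y. tree_limit L e y \<and> (\<forall>j<2^L. e L j = c j) \<and> (\<forall>x. (\<forall>b\<in>B. commutes x b) \<longrightarrow> commutes x y)"
proof -
  obtain h where h: "\<And>r. r \<in> B \<Longrightarrow> h r \<in> B \<and> r * h r = h r \<and> \<tau> (h r) = \<tau> r / 2"
    using atomless_halving[OF B] by metis
  \<comment> \<open>\<open>E k\<close> is level \<open>k + L\<close> of the tree;
    \<open>j div 2\<close> is the parent of node \<open>j\<close>.\<close>
  define E where "E = rec_nat c (\<lambda>_ f j. if even j then h (f (j div 2)) else f (j div 2) - h (f (j div 2)))"
  have E0: "E 0 = c" and ES: "E (Suc k) j = (if even j then h (E k (j div 2)) else E k (j div 2) - h (E k (j div 2)))" for k j
    by (simp_all add: E_def)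
  have E: "dyadic_partition (k + L) (E k) \<and> (\<forall>j<2^(k + L). E k j \<in> B)" for k
  proof (induction k)
    case 0
    then show ?case using c by (simp add: E0)
  next
    case (Suc k)
    note d = dyadic_partitionD[OF conjunct1[OF Suc]]
    have EB: "E (Suc k) j \<in> B" "E k (j div 2) * E (Suc k) j = E (Suc k) j"
      "\<tau> (E (Suc k) j) = 1 / 2 ^ (Suc k + L)" if "j < 2 ^ (Suc k + L)" for j
    proof -
      have j: "j div 2 < 2 ^ (k + L)" using that by auto
      then have r: "E k (j div 2) \<in> B" using Suc by blast
      note hr = h[OF r]
      have rr: "E k (j div 2) * E k (j div 2) = E k (j div 2)" using d(1)[OF j] by (simp add: is_projection_def)
      show "E (Suc k) j \<in> B" using hr r atomless_algebra_diff[OF B r] by (simp add: ES)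
      show "E k (j div 2) * E (Suc k) j = E (Suc k) j" using hr rr by (simp add: ES right_diff_distrib)
      show "\<tau> (E (Suc k) j) = 1 / 2 ^ (Suc k + L)" using hr d(2)[OF j] by (simp add: ES tau_diff)
    qed
    have "E (Suc k) i * E (Suc k) j = 0" if ij: "i < 2 ^ (Suc k + L)" "j < 2 ^ (Suc k + L)" "i \<noteq> j" for i j
    proof (cases "i div 2 = j div 2")
      case False
      have "i div 2 < 2 ^ (k + L)" "j div 2 < 2 ^ (k + L)" using ij by auto
      then have 0: "E k (i div 2) * E k (j div 2) = 0" using d(3) False by blast
      have "E (Suc k) i * E (Suc k) j = (E (Suc k) i * E k (i div 2)) * (E k (j div 2) * E (Suc k) j)"
        using EB(2)[OF ij(1)] EB(2)[OF ij(2)] atomless_algebraD(2)[OF B EB(1)[OF ij(1)], of "E k (i div 2)"]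
          conjunct2[OF Suc] \<open>i div 2 < 2 ^ (k + L)\<close> by (simp add: commutes_def)
      also have "\<dots> = E (Suc k) i * (E k (i div 2) * E k (j div 2)) * E (Suc k) j" by (simp only: mult.assoc)
      finally show ?thesis by (simp add: 0)
    next
      case True
      define r where "r = E k (i div 2)"
      have j: "i div 2 < 2 ^ (k + L)" using ij by auto
      then have r: "r \<in> B" unfolding r_def using Suc by blast
      note hr = h[OF r]
      have hh: "h r * h r = h r" using atomless_algebraD(1)[OF B, of "h r"] hr by (simp add: is_projection_def)
      have "h r * r = h r" using atomless_algebraD(2)[OF B r, of "h r"] hr by (simp add: commutes_def)
      then have 0: "h r * (r - h r) = 0" "(r - h r) * h r = 0" using hh hr by (simp_all add: algebra_simps)
      have "even i \<noteq> even j" using True ij(3) by (metis even_two_times_div_two odd_two_times_div_two_succ)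
      then show ?thesis using 0 by (cases "even i") (simp_all add: ES r_def[symmetric] True[symmetric])
    qed
    then show ?case
      using EB atomless_algebraD(1)[OF B] by (simp add: dyadic_partition_def)
  qed
  define e where "e l = E (l - L)" for l
  have tree: "dyadic_tree L e"
    unfolding dyadic_tree_def
  proof (intro allI impI conjI)
    fix l assume l: "l \<ge> L"
    show "dyadic_partition l (e l)" using E[of "l - L"] l by (simp add: e_def)
    show "e l j = e (Suc l) (2 * j) + e (Suc l) (2 * j + 1)" for j
      using l by (simp add: e_def Suc_diff_le ES)
  qed
  then obtain y where y: "tree_limit L e y" "conv2 (\<lambda>l. dyadic_sum (l + L) (e (l + L))) y"
    using tree_limit_exists by blast
  have "commutes x y" if x: "\<forall>b\<in>B. commutes x b" for x
  proof (rule conv2_commutes[OF y(2)])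
    show "commutes x (dyadic_sum (l + L) (e (l + L)))" for l
      unfolding dyadic_sum_def by (rule commutes_sum, rule commutes_scaleC)
        (use x E[of l] in \<open>simp add: e_def\<close>)
  qed
  then show ?thesis using y(1) by (intro exI[of _ e] exI[of _ y]) (simp add: e_def E0)
qed

lemma tree_limit_mono:
  assumes "tree_limit L e y" "L \<le> L'"
  shows "tree_limit L' e y"
proof -
  have "dyadic_tree L' e" using assms order_trans unfolding tree_limit_def dyadic_tree_def by blast
  then show ?thesis using assms by (simp add: tree_limit_def)
qed

lemma dyadic_partition_trivial: "dyadic_partition 0 (\<lambda>_. 1)"
  by (simp add: dyadic_partition_def tau_one)

lemma haar_commutes_tree_haar:
  assumes w: "w \<in> haar \<tau>"
  shows "\<exists>y\<in>tree_haar. commutes w y"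
proof -
  obtain B where B: "atomless_algebra B" "1 \<in> B" "\<forall>b\<in>B. commutes w b"
    using atomless_algebra_of_haar[OF w] by blast
  obtain e y where "tree_limit 0 e y" "\<forall>x. (\<forall>b\<in>B. commutes x b) \<longrightarrow> commutes x y"
    using atomless_tree[OF B(1) dyadic_partition_trivial] B(2) by blast
  then show ?thesis using B(3) unfolding tree_haar_def by blast
qed

lemma tree_haar_nonempty:
  assumes "diffuse TYPE('a)"
  shows "tree_haar \<noteq> {}"
proof -
  obtain B :: "'a set" where B: "{1} \<subseteq> B" "atomless_algebra B"
    using atomless_algebra_of_diffuse[OF assms, of "{1}"] by auto
  obtain e y where "tree_limit 0 e y"
    using atomless_tree[OF B(2) dyadic_partition_trivial] B(1) by blast
  then show ?thesis unfolding tree_haar_def by blast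
qed

text \<open>After conjugating the level \<open>l\<close> partition of \<open>u\<close> so that it commutes with that of \<open>w\<close>, both
  partitions lie in a common atomless algebra and extend to trees in it.\<close>

lemma tree_haar_common:
  assumes diffuse: "diffuse TYPE('a)" and u: "u \<in> tree_haar" and w: "w \<in> tree_haar" and r: "r > 0"
  shows "\<exists>g y z. unitary g \<and> y \<in> tree_haar \<and> z \<in> tree_haar \<and> commutes y z \<and>
    n2 (g * u * adj g - y) < r \<and> n2 (w - z) < r"
proof -
  obtain L e L' e' where ee: "tree_limit L e u" "tree_limit L' e' w" using u w by (auto simp: tree_haar_def)
  obtain N where N: "\<And>l. l \<ge> N \<Longrightarrow> 4 * pi / 2 ^ l < r"
    using dyadic_small[OF r] by metis
  define l where "l = max N (max L L')"
  have l: "tree_limit l e u" "tree_limit l e' w" "4 * pi / 2 ^ l < r"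
    using tree_limit_mono[OF ee(1)] tree_limit_mono[OF ee(2)] N[of l] by (auto simp: l_def)
  then have dp: "dyadic_partition l (e l)" "dyadic_partition l (e' l)"
    unfolding tree_limit_def by (auto intro: dyadic_treeD(1))
  note d = dyadic_partitionD[OF dp(1)] and d' = dyadic_partitionD[OF dp(2)]
  obtain g where g: "unitary g" "\<forall>j<2^l. \<forall>i<2^l. commutes (e' l i) (g * e l j * adj g)"
    using partition_conj_commutes[of "2^l" "e l" "2^l" "e' l"] d(1,3) d'(1,3) by blast
  define c where "c j = g * e l j * adj g" for j
  have dc: "dyadic_partition l c" unfolding c_def by (rule dyadic_partition_conj[OF dp(1) g(1)])
  define S where "S = c ` {..<2^l} \<union> e' l ` {..<2^l}"
  have part: "commutes (b i) (b j)" if "dyadic_partition l b" "i < 2^l" "j < 2^l" for b i j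
    using dyadic_partitionD(3)[OF that(1), of i j] dyadic_partitionD(3)[OF that(1), of j i] that
    by (cases "i = j") (auto simp: commutes_def)
  have cc: "commutes (e' l i) (c j)" "commutes (c j) (e' l i)" if "i < 2^l" "j < 2^l" for i j
    using g(2) that by (auto simp: c_def intro: commutes_sym)
  obtain B where B: "S \<subseteq> B" "atomless_algebra B"
  proof -
    have "is_projection p" if "p \<in> S" for p
      using that dyadic_partitionD(1)[OF dc] d'(1) by (auto simp: S_def)
    moreover have "commutes p q" if "p \<in> S" "q \<in> S" for p q
      using that part[OF dc] part[OF dp(2)] cc by (auto simp: S_def)
    ultimately have "\<exists>B. S \<subseteq> B \<and> atomless_algebra B" by (rule atomless_algebra_of_diffuse[OF diffuse])
    then show thesis using that by blast
  qed
  obtain f y where y: "tree_limit l f y" "\<forall>j<2^l. f l j = c j" "\<forall>x. (\<forall>b\<in>B. commutes x b) \<longrightarrow> commutes x y"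
    using atomless_tree[OF B(2) dc] B(1) unfolding S_def by blast
  obtain f' z where z: "tree_limit l f' z" "\<forall>j<2^l. f' l j = e' l j" "\<forall>x. (\<forall>b\<in>B. commutes x b) \<longrightarrow> commutes x z"
    using atomless_tree[OF B(2) dp(2)] B(1) unfolding S_def by blast
  \<comment> \<open>The bicommutant property is used twice: for \<open>y\<close> against members of
    \<open>B\<close>, then for \<open>z\<close> against \<open>y\<close>.\<close>
  have "commutes b y" if "b \<in> B" for b using y(3) atomless_algebraD(2)[OF B(2) that] by blast
  then have "commutes y z" using z(3) commutes_sym by blast
  moreover have "n2 (g * u * adj g - y) \<le> 4 * pi / 2^l"
    by (rule tree_limit_near[OF tree_limit_conj[OF l(1) g(1)] y(1)]) (use y(2) in \<open>auto simp: c_def\<close>)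
  moreover have "n2 (w - z) \<le> 4 * pi / 2^l"
    by (rule tree_limit_near[OF l(2) z(1)]) (use z(2) in auto)
  moreover have "y \<in> tree_haar" "z \<in> tree_haar" using y(1) z(1) unfolding tree_haar_def by blast+
  ultimately show ?thesis using g(1) l(3) by (intro exI[of _ g] exI[of _ y] exI[of _ z]) auto
qed

end

section \<open>Approximate commutation paths\<close>

context tracial
begin

text \<open>The parameter \<open>N\<close> is both the precision and the number of moments tested,
  so the limit of elements satisfying this for growing \<open>N\<close> is a Haar unitary of the
  ultrapower.\<close>

definition near_haar :: "real \<Rightarrow> nat \<Rightarrow> 'a \<Rightarrow> bool" where
  "near_haar B N x \<longleftrightarrow> norm x \<le> B \<and>
    n2 (adj x * x - 1) < 1 / real (Suc N) \<and> n2 (x * adj x - 1) < 1 / real (Suc N) \<and>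
    (\<forall>j. 1 \<le> j \<and> j \<le> N \<longrightarrow> cmod (\<tau> (x ^ j)) < 1 / real (Suc N))"

definition near_path :: "nat \<Rightarrow> real \<Rightarrow> nat \<Rightarrow> 'a \<Rightarrow> 'a \<Rightarrow> (nat \<Rightarrow> 'a) \<Rightarrow> bool" where
  "near_path k B N u v x \<longleftrightarrow> x 0 = u \<and> x k = v \<and> (\<forall>i\<le>k. near_haar B N (x i)) \<and>
    (\<forall>i<k. n2 (x i * x (Suc i) - x (Suc i) * x i) < 1 / real (Suc N))"

text \<open>Paths of length \<open>k\<close> in the ultrapower whose vertices have representatives bounded by \<open>B\<close>,
  expressed by finite approximations inside \<open>M\<close>; in particular the ultrafilter is irrelevant.
  Fixing \<open>B\<close> makes the relation closed.\<close>

definition approx_path :: "nat \<Rightarrow> real \<Rightarrow> 'a \<Rightarrow> 'a \<Rightarrow> bool" where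
  "approx_path k B u v \<longleftrightarrow> (\<forall>N. \<exists>x. near_path k B N u v x)"

lemma near_haar_of_haar: "u \<in> haar \<tau> \<Longrightarrow> 1 \<le> B \<Longrightarrow> near_haar B N u"
  using haarD[of u] by (simp add: near_haar_def unitary_def)

lemma near_haar_mono:
  assumes x: "near_haar B N' x" and "N \<le> N'" "B \<le> B'"
  shows "near_haar B' N x"
proof -
  have "1 / real (Suc N') \<le> 1 / real (Suc N)" using assms by (simp add: field_simps)
  then show ?thesis using assms unfolding near_haar_def by (meson order_le_less_trans order_less_le_trans order_trans)
qed

lemma approx_path_mono:
  assumes p: "approx_path k B u v" and "B \<le> B'"
  shows "approx_path k B' u v"
proof -
  have "near_path k B' N u v x" if "near_path k B N u v x" for N x
    using that near_haar_mono[OF _ order_refl \<open>B \<le> B'\<close>] unfolding near_path_def by blast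
  then show ?thesis using p unfolding approx_path_def by blast
qed

text \<open>The constant path has any length \<open>k\<close>; composing with it pads paths to a
  common length.\<close>

lemma approx_path_refl:
  assumes "u \<in> haar \<tau>" "1 \<le> B"
  shows "approx_path k B u u"
  unfolding approx_path_def near_path_def
  using near_haar_of_haar[OF assms] by (intro allI exI[of _ "\<lambda>_. u"]) simp

lemma approx_path_commutes:
  assumes "u \<in> haar \<tau>" "v \<in> haar \<tau>" "commutes u v" "1 \<le> B"
  shows "approx_path 1 B u v"
  unfolding approx_path_def near_path_def
  using near_haar_of_haar assms by (intro allI exI[of _ "\<lambda>i. if i = 0 then u else v"]) (simp add: commutes_def)

lemma approx_path_trans:
  assumes "approx_path k B u v" "approx_path l B v w"
  shows "approx_path (k + l) B u w"
  unfolding approx_path_def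
proof
  fix N
  obtain x y where x: "near_path k B N u v x" and y: "near_path l B N v w y"
    using assms unfolding approx_path_def by blast
  define z where "z i = (if i \<le> k then x i else y (i - k))" for i
  have zk: "z (k + i) = y i" for i using x y by (simp add: z_def near_path_def)
  have "near_haar B N (z i)" if "i \<le> k + l" for i
  proof (cases "i \<le> k")
    case False
    then obtain j where "i = k + j" using le_Suc_ex by (metis nat_le_linear)
    then show ?thesis using y that zk[of j] by (simp add: near_path_def)
  qed (use x in \<open>simp add: z_def near_path_def\<close>)
  moreover have "n2 (z i * z (Suc i) - z (Suc i) * z i) < 1 / real (Suc N)" if "i < k + l" for i
  proof (cases "i < k")
    case True
    then show ?thesis using x by (simp add: z_def near_path_def)
  next
    case False
    then obtain j where j: "i = k + j" using le_Suc_ex by (metis not_less)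
    then show ?thesis using y that zk[of j] zk[of "Suc j"] by (simp add: near_path_def)
  qed
  moreover have "z 0 = u" "z (k + l) = w" using x y zk[of l] by (simp_all add: z_def near_path_def)
  ultimately show "\<exists>z. near_path (k + l) B N u w z" unfolding near_path_def by blast
qed

lemma approx_path_sym:
  assumes "approx_path k B u v"
  shows "approx_path k B v u"
  unfolding approx_path_def
proof
  fix N
  obtain x where x: "near_path k B N u v x" using assms unfolding approx_path_def by blast
  have "n2 (x (k - i) * x (k - Suc i) - x (k - Suc i) * x (k - i)) < 1 / real (Suc N)" if "i < k" for i
  proof -
    have "Suc (k - Suc i) = k - i" using that by simp
    moreover have "k - Suc i < k" using that by simp
    ultimately show ?thesis
      using x n2_minus_commute unfolding near_path_def by metis
  qed
  then show "\<exists>x. near_path k B N v u x"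
    using x by (intro exI[of _ "\<lambda>i. x (k - i)"]) (simp add: near_path_def)
qed

lemma conj_mult: "unitary g \<Longrightarrow> (g * x * adj g) * (g * y * adj g) = g * (x * y) * adj g" for x y :: 'a
  by (simp add: mult.assoc unitary_cancel)

lemma conj_power: "unitary g \<Longrightarrow> (g * x * adj g) ^ n = g * x ^ n * adj g" for x :: 'a
  by (induction n) (simp_all add: mult.assoc unitary_cancel)

lemma tau_conj: "unitary g \<Longrightarrow> \<tau> (g * x * adj g) = \<tau> x"
  using tau_commute[of "g * x" "adj g"] by (simp add: unitary_cancel)

lemma norm_conj_le: "unitary g \<Longrightarrow> norm (g * x * adj g) \<le> norm x" for x :: 'a
  using norm_mult_ineq[of "g * x" "adj g"] norm_mult_ineq[of g x] by (simp add: norm_unitary)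

lemma near_haar_conj:
  assumes x: "near_haar B N x" and g: "unitary g"
  shows "near_haar B N (g * x * adj g)"
proof -
  have "adj (g * x * adj g) = g * adj x * adj g" by (simp add: adj_mult mult.assoc)
  moreover have "g * y * adj g - 1 = g * (y - 1) * adj g" for y
    by (simp add: algebra_simps unitary_cancel[OF g])
  ultimately show ?thesis
    using x norm_conj_le[OF g, of x]
    by (simp add: near_haar_def conj_mult[OF g] conj_power[OF g] tau_conj[OF g] n2_conj[OF g])
qed

lemma approx_path_conj:
  assumes "approx_path k B u v" and g: "unitary g"
  shows "approx_path k B (g * u * adj g) (g * v * adj g)"
  unfolding approx_path_def
proof
  fix N
  obtain x where x: "near_path k B N u v x" using assms(1) unfolding approx_path_def by blast
  have "g * a * adj g * (g * b * adj g) - g * b * adj g * (g * a * adj g) = g * (a * b - b * a) * adj g" for a b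
    unfolding conj_mult[OF g] by (simp add: algebra_simps)
  then have "near_path k B N (g * u * adj g) (g * v * adj g) (\<lambda>i. g * x i * adj g)"
    using x near_haar_conj[OF _ g] by (simp add: near_path_def n2_conj[OF g])
  then show "\<exists>x. near_path k B N (g * u * adj g) (g * v * adj g) x" by blast
qed

text \<open>The expansion is arranged so that only \<open>a\<close> and \<open>b'\<close> multiply
  the differences; one operator-norm bound per pair is therefore enough.\<close>

lemma n2_commutator_le:
  assumes "norm a \<le> B" "norm b' \<le> B"
  shows "n2 (a * b - b * a) \<le> n2 (a' * b' - b' * a') + 2 * B * (n2 (a - a') + n2 (b - b'))"
proof -
  have eq: "a * b - b * a = (a' * b' - b' * a') + ((a * (b - b') + (a - a') * b') - ((b - b') * a + b' * (a - a')))"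
    by (simp add: algebra_simps)
  have "n2 (a * (b - b')) \<le> B * n2 (b - b')"
    using n2_mult_left[of a "b - b'"] assms(1) mult_right_mono[OF assms(1), of "n2 (b - b')"] by simp
  moreover have "n2 ((a - a') * b') \<le> B * n2 (a - a')"
    using n2_mult_right[of "a - a'" b'] mult_left_mono[OF assms(2), of "n2 (a - a')"] by (simp add: mult.commute)
  moreover have "n2 ((b - b') * a) \<le> B * n2 (b - b')"
    using n2_mult_right[of "b - b'" a] mult_left_mono[OF assms(1), of "n2 (b - b')"] by (simp add: mult.commute)
  moreover have "n2 (b' * (a - a')) \<le> B * n2 (a - a')"
    using n2_mult_left[of b' "a - a'"] mult_right_mono[OF assms(2), of "n2 (a - a')"] by simp
  moreover have "n2 (a * b - b * a) \<le> n2 (a' * b' - b' * a') +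
      ((n2 (a * (b - b')) + n2 ((a - a') * b')) + (n2 ((b - b') * a) + n2 (b' * (a - a'))))"
    unfolding eq
    by (intro order_trans[OF n2_triangle] add_left_mono order_trans[OF n2_triangle_minus] add_mono n2_triangle)
  ultimately show ?thesis by (simp add: algebra_simps)
qed

text \<open>Take a path between nearby endpoints, keep its interior vertices and replace the
  endpoints. The commutators change by at most 2 B times the displacements, which is uniform because
  \<open>B\<close> is fixed.\<close>

lemma approx_path_closed:
  assumes u: "u \<in> haar \<tau>" and v: "v \<in> haar \<tau>" and k: "1 \<le> k" and B: "1 \<le> B"
    and near: "\<And>e. e > 0 \<Longrightarrow> \<exists>u' v'. n2 (u - u') < e \<and> n2 (v - v') < e \<and> approx_path k B u' v'"
  shows "approx_path k B u v"
  unfolding approx_path_def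
proof
  fix N
  define \<delta> where "\<delta> = 1 / real (Suc N)"
  \<comment> \<open>Two displacements of at most \<open>e\<close>, multiplied by
    \<open>2 * B\<close>, use up half of the tolerance; the other half is left to the commutators of
    a path at precision \<open>N'\<close>.\<close>
  define e where "e = \<delta> / (8 * B)"
  have pos: "\<delta> > 0" "e > 0" using B by (simp_all add: \<delta>_def e_def)
  obtain u' v' where uv: "n2 (u - u') < e" "n2 (v - v') < e" "approx_path k B u' v'"
    using near[OF pos(2)] by blast
  define N' where "N' = 2 * N + 1"
  have N': "1 / real (Suc N') = \<delta> / 2" "N \<le> N'" by (simp_all add: N'_def \<delta>_def field_simps)
  obtain x where x: "near_path k B N' u' v' x" using uv(3) unfolding approx_path_def by blast
  define y where "y i = (if i = 0 then u else if i = k then v else x i)" for i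
  have xy: "n2 (y i - x i) < e" for i
    using uv x pos by (auto simp: y_def near_path_def)
  have yh: "near_haar B N (y i)" if "i \<le> k" for i
  proof -
    have "near_haar B N (x i)" using x that near_haar_mono[OF _ N'(2) order_refl] by (auto simp: near_path_def)
    then show ?thesis using near_haar_of_haar[OF u B] near_haar_of_haar[OF v B] by (simp add: y_def)
  qed
  moreover have "n2 (y i * y (Suc i) - y (Suc i) * y i) < 1 / real (Suc N)" if i: "i < k" for i
  proof -
    have b: "norm (y i) \<le> B" "norm (x (Suc i)) \<le> B"
      using yh[of i] x i by (auto simp: near_haar_def near_path_def)
    have "n2 (y i - x i) + n2 (y (Suc i) - x (Suc i)) \<le> 2 * e"
      using xy[of i] xy[of "Suc i"] by linarith
    then have "2 * B * (n2 (y i - x i) + n2 (y (Suc i) - x (Suc i))) \<le> 2 * B * (2 * e)"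
      using B by (intro mult_left_mono) auto
    also have "\<dots> = \<delta> / 2" using B by (simp add: e_def)
    finally have "2 * B * (n2 (y i - x i) + n2 (y (Suc i) - x (Suc i))) \<le> \<delta> / 2" .
    moreover have "n2 (x i * x (Suc i) - x (Suc i) * x i) < \<delta> / 2"
      using x i unfolding N'(1)[symmetric] near_path_def by blast
    ultimately show ?thesis
      using n2_commutator_le[OF b, of "y (Suc i)" "x i"] unfolding \<delta>_def[symmetric] by linarith
  qed
  moreover have "y 0 = u" "y k = v" using k by (simp_all add: y_def)
  ultimately show "\<exists>x. near_path k B N u v x" unfolding near_path_def by blast
qed

section \<open>Comparison with paths in the ultrapower\<close>

lemma free_ultrafilter_le_sequentially:
  assumes "free_ultrafilter U"
  shows "U \<le> sequentially"
proof (rule filter_leI)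
  fix P assume "eventually P sequentially"
  then obtain N where N: "\<And>n. n \<ge> N \<Longrightarrow> P n" by (auto simp: eventually_sequentially)
  have "\<forall>k\<in>{..<N}. \<forall>\<^sub>F n in U. n \<noteq> k"
    using assms unfolding free_ultrafilter_def by blast
  then have "\<forall>\<^sub>F n in U. \<forall>k\<in>{..<N}. n \<noteq> k" by (intro eventually_ball_finite) auto
  then show "eventually P U" by (rule eventually_mono) (rule N, rule ccontr, auto)
qed

text \<open>For each \<open>N\<close> only finitely many conditions are involved, each true for
  \<open>U\<close>-almost all indices, so one index satisfies them all. A common \<open>B\<close>
  exists because the path has finitely many vertices.\<close>

lemma comm_path_imp_approx_path:
  assumes U: "U \<noteq> bot" and u: "u \<in> haar \<tau>" and v: "v \<in> haar \<tau>" and p: "comm_path U \<tau> u v k"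
  shows "\<exists>B\<ge>1. approx_path k B u v"
proof -
  obtain w where w: "w 0 = (\<lambda>n. u)" "w k = (\<lambda>n. v)" "\<And>i. 0 < i \<Longrightarrow> i < k \<Longrightarrow> ultra_haar U \<tau> (w i)"
    "\<And>i. i < k \<Longrightarrow> ultra_commute U \<tau> (w i) (w (Suc i))"
    using p unfolding comm_path_def by metis
  have "\<exists>b. \<forall>n. norm (w i n) \<le> b" if "i \<le> k" for i
  proof (cases "0 < i \<and> i < k")
    case True
    then show ?thesis using w(3)[of i] by (auto simp: ultra_haar_def ell_inf_def)
  next
    case False
    then have "i = 0 \<or> i = k" using that by linarith
    then show ?thesis using w(1,2) by auto
  qed
  then obtain b where b: "\<And>i n. i \<le> k \<Longrightarrow> norm (w i n) \<le> b i" by metis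
  define B where "B = 1 + (\<Sum>i\<le>k. \<bar>b i\<bar>)"
  have B1: "1 \<le> B" by (simp add: B_def sum_nonneg)
  have bB: "norm (w i n) \<le> B" if "i \<le> k" for i n
  proof -
    have "\<bar>b i\<bar> \<le> (\<Sum>i\<le>k. \<bar>b i\<bar>)" by (rule member_le_sum) (use that in auto)
    then show ?thesis using b[OF that, of n] by (simp add: B_def)
  qed
  have "approx_path k B u v"
    unfolding approx_path_def
  proof
    fix N
    define \<delta> where "\<delta> = 1 / real (Suc N)"
    have \<delta>: "\<delta> > 0" by (simp add: \<delta>_def)
    have "\<forall>\<^sub>F n in U. near_haar B N (w i n)" if "i \<le> k" for i
    proof (cases "0 < i \<and> i < k")
      case True
      then have h: "ultra_haar U \<tau> (w i)" using w(3) by blast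
      have "\<forall>\<^sub>F n in U. n2 (adj (w i n) * w i n - 1) < \<delta>" "\<forall>\<^sub>F n in U. n2 (w i n * adj (w i n) - 1) < \<delta>"
        by (rule order_tendstoD(2)[OF _ \<delta>]; use h in \<open>simp add: ultra_haar_def\<close>)+
      moreover have "\<forall>\<^sub>F n in U. cmod (\<tau> (w i n ^ j)) < \<delta>" if "j \<in> {1..N}" for j
      proof -
        have "((\<lambda>n. \<tau> (w i n ^ j)) \<longlongrightarrow> 0) U" using h that by (simp add: ultra_haar_def)
        then show ?thesis using tendstoD[OF _ \<delta>] by fastforce
      qed
      then have "\<forall>\<^sub>F n in U. \<forall>j\<in>{1..N}. cmod (\<tau> (w i n ^ j)) < \<delta>"
        by (intro eventually_ball_finite) auto
      ultimately show ?thesis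
        by eventually_elim (use bB[OF that] in \<open>auto simp: near_haar_def \<delta>_def\<close>)
    next
      case False
      then have "i = 0 \<or> i = k" using that by linarith
      then show ?thesis using w(1,2) near_haar_of_haar[OF u B1] near_haar_of_haar[OF v B1] by auto
    qed
    then have 1: "\<forall>\<^sub>F n in U. \<forall>i\<in>{..k}. near_haar B N (w i n)"
      by (intro eventually_ball_finite) auto
    have "\<forall>\<^sub>F n in U. n2 (w i n * w (Suc i) n - w (Suc i) n * w i n) < \<delta>" if "i < k" for i
      using w(4)[OF that] \<delta> unfolding ultra_commute_def by (rule order_tendstoD(2))
    then have 2: "\<forall>\<^sub>F n in U. \<forall>i\<in>{..<k}. n2 (w i n * w (Suc i) n - w (Suc i) n * w i n) < \<delta>"
      by (intro eventually_ball_finite) auto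
    obtain n where "\<forall>i\<in>{..k}. near_haar B N (w i n)"
      "\<forall>i\<in>{..<k}. n2 (w i n * w (Suc i) n - w (Suc i) n * w i n) < \<delta>"
      using eventually_happens'[OF U eventually_conj[OF 1 2]] by blast
    then have "near_path k B N u v (\<lambda>i. w i n)" using w(1,2) by (simp add: near_path_def \<delta>_def)
    then show "\<exists>x. near_path k B N u v x" by blast
  qed
  then show ?thesis using B1 by blast
qed

text \<open>Diagonal choice: the \<open>n\<close>-th coordinate of each vertex is taken from a path
  of precision \<open>n\<close>. The uniform bound \<open>B\<close> makes the vertices bounded
  sequences.\<close>

lemma approx_path_imp_comm_path:
  assumes U: "free_ultrafilter U" and p: "approx_path k B u v"
  shows "comm_path U \<tau> u v k"
proof -
  obtain x where x: "\<And>n. near_path k B n u v (x n)" using p unfolding approx_path_def by metis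
  have lim: "((\<lambda>n. 1 / real (Suc n)) \<longlongrightarrow> 0) U"
    using LIMSEQ_Suc[OF lim_1_over_n] free_ultrafilter_le_sequentially[OF U] by (rule tendsto_mono[rotated]) 
  have le: "(f \<longlongrightarrow> 0) U" if "\<And>n. n \<ge> N \<Longrightarrow> norm (f n) < 1 / real (Suc n)" for f :: "nat \<Rightarrow> 'b::real_normed_vector" and N
  proof (rule Lim_null_comparison[OF _ lim])
    have "\<forall>\<^sub>F n in sequentially. norm (f n) \<le> 1 / real (Suc n)"
      using that by (intro eventually_sequentiallyI[of N]) (simp add: less_imp_le)
    then show "\<forall>\<^sub>F n in U. norm (f n) \<le> 1 / real (Suc n)"
      using free_ultrafilter_le_sequentially[OF U] by (simp add: filter_leD)
  qed
  have "ultra_haar U \<tau> (\<lambda>n. x n i)" if i: "i \<le> k" for i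
  proof -
    have h: "near_haar B n (x n i)" for n using x i by (simp add: near_path_def)
    have "((\<lambda>n. n2 (adj (x n i) * x n i - 1)) \<longlongrightarrow> 0) U" "((\<lambda>n. n2 (x n i * adj (x n i) - 1)) \<longlongrightarrow> 0) U"
      by (rule le[of 0]; use h in \<open>simp add: near_haar_def\<close>)+
    \<comment> \<open>Precision \<open>n\<close> controls the \<open>j\<close>-th moment only once
      \<open>n \<ge> j\<close>, hence the instance \<open>le[of j]\<close>.\<close>
    moreover have "((\<lambda>n. \<tau> (x n i ^ j)) \<longlongrightarrow> 0) U" if "j \<ge> 1" for j
      by (rule le[of j]) (use h that in \<open>simp add: near_haar_def\<close>)
    moreover have "(\<lambda>n. x n i) \<in> ell_inf" using h by (auto simp: ell_inf_def near_haar_def)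
    ultimately show ?thesis by (simp add: ultra_haar_def)
  qed
  moreover have "ultra_commute U \<tau> (\<lambda>n. x n i) (\<lambda>n. x n (Suc i))" if "i < k" for i
    unfolding ultra_commute_def by (rule le[of 0]) (use x that in \<open>simp add: near_path_def\<close>)
  ultimately show ?thesis
    unfolding comm_path_def using x by (intro exI[of _ "\<lambda>i n. x n i"]) (simp add: near_path_def)
qed

end

section \<open>The Cantor scheme\<close>

text \<open>One stage of the Cantor scheme. The pairs are treated one after the other:
  \<open>nowhere\<close> moves the two centres to an unrelated pair, \<open>closed\<close> gives
  balls that remain unrelated, and each later move is small enough to stay inside the balls found
  before.\<close>

lemma (in Metric_space) separate_pairs:
  assumes "finite P" "\<And>i j. (i, j) \<in> P \<Longrightarrow> i \<noteq> j"
    and closed: "\<And>x y. x \<in> M \<Longrightarrow> y \<in> M \<Longrightarrow> \<not> R x y \<Longrightarrow>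
      \<exists>e>0. \<forall>x'\<in>M. \<forall>y'\<in>M. d x x' < e \<longrightarrow> d y y' < e \<longrightarrow> \<not> R x' y'"
    and nowhere: "\<And>x y e. x \<in> M \<Longrightarrow> y \<in> M \<Longrightarrow> e > 0 \<Longrightarrow>
      \<exists>x'\<in>M. \<exists>y'\<in>M. d x x' < e \<and> d y y' < e \<and> \<not> R x' y'"
    and a: "\<And>i. a i \<in> M" and r: "r > 0"
  shows "\<exists>b s. s > 0 \<and> (\<forall>i. b i \<in> M \<and> d (a i) (b i) + s < r) \<and>
    (\<forall>(i, j)\<in>P. \<forall>x\<in>M. \<forall>y\<in>M. d (b i) x \<le> s \<longrightarrow> d (b j) y \<le> s \<longrightarrow> \<not> R x y)"
  using assms(1,2)
proof (induction P rule: finite_induct)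
  case empty
  then show ?case using a r by (intro exI[of _ a] exI[of _ "r / 2"]) auto
next
  case (insert p P)
  obtain i j where p: "p = (i, j)" by (cases p)
  then have ij: "i \<noteq> j" using insert.prems by blast
  obtain b s where s: "s > 0" and b: "\<And>i. b i \<in> M" "\<And>i. d (a i) (b i) + s < r"
    and sep: "\<And>i j x y. (i, j) \<in> P \<Longrightarrow> x \<in> M \<Longrightarrow> y \<in> M \<Longrightarrow> d (b i) x \<le> s \<Longrightarrow> d (b j) y \<le> s \<Longrightarrow> \<not> R x y"
    using insert.IH insert.prems by blast
  obtain u v where u: "u \<in> M" "v \<in> M" "d (b i) u < s / 4" "d (b j) v < s / 4" "\<not> R u v"
    using nowhere[of "b i" "b j" "s / 4"] b s by auto
  obtain e where e: "e > 0" "\<And>x y. x \<in> M \<Longrightarrow> y \<in> M \<Longrightarrow> d u x < e \<Longrightarrow> d v y < e \<Longrightarrow> \<not> R x y"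
    using closed[OF u(1,2,5)] by blast
  \<comment> \<open>The two updates do not interfere because \<open>i \<noteq> j\<close>.\<close>
  define b' where "b' = b(i := u, j := v)"
  \<comment> \<open>A displacement and a radius of at most \<open>s / 4\<close> each keep the new
    ball inside the old one of radius \<open>s\<close>; \<open>e / 2\<close> turns the strict
    inequality required by \<open>e\<close> into a closed ball.\<close>
  define t where "t = min (s / 4) (e / 2)"
  have t: "t > 0" "t \<le> s / 4" "t < e" using s e by (auto simp: t_def)
  have b'M: "b' l \<in> M" for l using b u by (simp add: b'_def)
  have bb': "d (b l) (b' l) \<le> s / 4" for l using b u s by (auto simp: b'_def)
  have small: "d (a l) (b' l) + t < r" for l
    using triangle[OF a[of l] b(1)[of l] b'M[of l]] bb'[of l] b(2)[of l] t s by linarith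
  have sep': "\<not> R x y" if P: "(k, l) \<in> insert p P" and xy: "x \<in> M" "y \<in> M" "d (b' k) x \<le> t" "d (b' l) y \<le> t" for k l x y
  proof (cases "(k, l) = p")
    case True
    then show ?thesis using e(2)[OF xy(1,2)] xy(3,4) t ij by (simp add: p b'_def)
  next
    case False
    have "d (b k) x \<le> s" "d (b l) y \<le> s"
      using triangle[OF b(1)[of k] b'M[of k] xy(1)] triangle[OF b(1)[of l] b'M[of l] xy(2)]
        bb'[of k] bb'[of l] xy(3,4) t s by linarith+
    then show ?thesis using sep P False xy by blast
  qed
  have "\<forall>(k, l)\<in>insert p P. \<forall>x\<in>M. \<forall>y\<in>M. d (b' k) x \<le> t \<longrightarrow> d (b' l) y \<le> t \<longrightarrow> \<not> R x y"
    using sep' by blast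
  then show ?case using t(1) b'M small by blast
qed

text \<open>The number of the node of level \<open>n\<close> on the branch \<open>A\<close>, where
  node \<open>j\<close> has children 2 j and 2 j + 1.\<close>

fun binary_code :: "nat set \<Rightarrow> nat \<Rightarrow> nat" where
  "binary_code A 0 = 0"
| "binary_code A (Suc n) = 2 * binary_code A n + (if n \<in> A then 1 else 0)"

lemma binary_code_less: "binary_code A n < 2 ^ n"
  by (induction n) auto

lemma binary_code_eqD: "binary_code A n = binary_code B n \<Longrightarrow> m < n \<Longrightarrow> m \<in> A \<longleftrightarrow> m \<in> B"
proof (induction n)
  case (Suc n)
  have "n \<in> A \<longleftrightarrow> n \<in> B"
    using arg_cong[OF Suc.prems(1), of odd] by (auto split: if_splits)
  moreover from this have "binary_code A n = binary_code B n" using Suc.prems(1) by simp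
  ultimately show ?case using Suc by (cases "m = n") auto
qed simp

text \<open>Stage \<open>n\<close> makes the nodes of level \<open>n + 1\<close> pairwise unrelated
  under \<open>R n\<close>. Distinct branches pass through distinct nodes on all late levels, so by
  monotonicity their limits are unrelated under every \<open>R k\<close>.\<close>

lemma (in Metric_space) cantor_scheme:
  fixes R :: "nat \<Rightarrow> 'a \<Rightarrow> 'a \<Rightarrow> bool"
  assumes complete: "mcomplete" and "M \<noteq> {}"
    and mono: "\<And>k l x y. k \<le> l \<Longrightarrow> R k x y \<Longrightarrow> R l x y"
    and closed: "\<And>k x y. x \<in> M \<Longrightarrow> y \<in> M \<Longrightarrow> \<not> R k x y \<Longrightarrow>
      \<exists>e>0. \<forall>x'\<in>M. \<forall>y'\<in>M. d x x' < e \<longrightarrow> d y y' < e \<longrightarrow> \<not> R k x' y'"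
    and nowhere: "\<And>k x y e. x \<in> M \<Longrightarrow> y \<in> M \<Longrightarrow> e > 0 \<Longrightarrow>
      \<exists>x'\<in>M. \<exists>y'\<in>M. d x x' < e \<and> d y y' < e \<and> \<not> R k x' y'"
  shows "\<exists>\<phi> :: nat set \<Rightarrow> 'a. (\<forall>A. \<phi> A \<in> M) \<and> (\<forall>A B. A \<noteq> B \<longrightarrow> (\<forall>k. \<not> R k (\<phi> A) (\<phi> B)))"
proof -
  define P where "P c \<longleftrightarrow> (\<forall>j. fst c j \<in> M) \<and> snd c > 0" for c :: "(nat \<Rightarrow> 'a) \<times> real"
  define Q where "Q n c c' \<longleftrightarrow> snd c' \<le> 1 / 2 ^ n \<and>
     (\<forall>j. d (fst c (j div 2)) (fst c' j) + snd c' < snd c) \<and>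
     (\<forall>i<2^Suc n. \<forall>j<2^Suc n. i \<noteq> j \<longrightarrow> (\<forall>x\<in>M. \<forall>y\<in>M. d (fst c' i) x \<le> snd c' \<longrightarrow> d (fst c' j) y \<le> snd c' \<longrightarrow> \<not> R n x y))"
    for n and c c' :: "(nat \<Rightarrow> 'a) \<times> real"
  have "\<exists>f. \<forall>n. P (f n) \<and> Q n (f n) (f (Suc n))"
  proof (rule dependent_nat_choice)
    obtain z where "z \<in> M" using \<open>M \<noteq> {}\<close> by blast
    then show "\<exists>c. P c" by (intro exI[of _ "(\<lambda>_. z, 1)"]) (simp add: P_def)
    fix c n assume c: "P c"
    \<comment> \<open>The first entry keeps the new balls inside that of the parent, the second
      drives the radii to 0.\<close>
    define r where "r = min (snd c) (1 / 2 ^ n)"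
    have r: "r > 0" using c by (simp add: r_def P_def)
    define T where "T = {(i, j). i < (2::nat) ^ Suc n \<and> j < 2 ^ Suc n \<and> i \<noteq> j}"
    have "T \<subseteq> {..<2^Suc n} \<times> {..<2^Suc n}" by (auto simp: T_def)
    then have fin: "finite T" by (rule finite_subset) simp
    have "\<exists>b s. s > 0 \<and> (\<forall>i. b i \<in> M \<and> d (fst c (i div 2)) (b i) + s < r) \<and>
      (\<forall>(i, j)\<in>T. \<forall>x\<in>M. \<forall>y\<in>M. d (b i) x \<le> s \<longrightarrow> d (b j) y \<le> s \<longrightarrow> \<not> R n x y)"
      by (rule separate_pairs[OF fin _ closed nowhere _ r]) (use c in \<open>auto simp: T_def P_def\<close>)
    then obtain b s where s: "s > 0" and b: "\<And>i. b i \<in> M" "\<And>i. d (fst c (i div 2)) (b i) + s < r"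
      and sep: "\<And>i j x y. (i, j) \<in> T \<Longrightarrow> x \<in> M \<Longrightarrow> y \<in> M \<Longrightarrow> d (b i) x \<le> s \<Longrightarrow> d (b j) y \<le> s \<Longrightarrow> \<not> R n x y"
      by blast
    have "s < r" using b(2)[of 0] nonneg[of "fst c (0 div 2)" "b 0"] by linarith
    then have "s \<le> 1 / 2 ^ n" by (simp add: r_def)
    moreover have "d (fst c (j div 2)) (b j) + s < snd c" for j using b(2)[of j] by (simp add: r_def)
    ultimately show "\<exists>c'. P c' \<and> Q n c c'"
      using s b(1) sep by (intro exI[of _ "(b, s)"]) (simp add: P_def Q_def T_def)
  qed
  then obtain f where f: "\<And>n. P (f n)" "\<And>n. Q n (f n) (f (Suc n))" by blast
  define c where "c n = fst (f n)" for n
  define r where "r n = snd (f n)" for n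
  have cM: "c n j \<in> M" and r0: "r n > 0" for n j using f(1)[of n] by (auto simp: P_def c_def r_def)
  have step: "d (c n (j div 2)) (c (Suc n) j) + r (Suc n) < r n" and rn: "r (Suc n) \<le> 1 / 2 ^ n"
    for n j using f(2)[of n] by (auto simp: Q_def c_def r_def)
  have sep: "\<not> R n x y" if "i < 2 ^ Suc n" "j < 2 ^ Suc n" "i \<noteq> j" "x \<in> M" "y \<in> M"
    "d (c (Suc n) i) x \<le> r (Suc n)" "d (c (Suc n) j) y \<le> r (Suc n)" for n i j x y
    using f(2)[of n] that unfolding Q_def c_def r_def by blast
  define z where "z A n = c n (binary_code A n)" for A n
  have zM: "z A n \<in> M" for A n by (simp add: z_def cM)
  have zstep: "d (z A n) (z A (Suc n)) + r (Suc n) < r n" for A n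
  proof -
    have "binary_code A (Suc n) div 2 = binary_code A n" by simp
    then show ?thesis using step[of n "binary_code A (Suc n)"] by (simp only: z_def)
  qed
  have zfar: "d (z A n) (z A (n + k)) + r (n + k) \<le> r n" for A n k
  proof (induction k)
    case (Suc k)
    then show ?case using triangle[OF zM[of A n] zM[of A "n + k"] zM[of A "n + Suc k"]] zstep[of A "n + k"] by simp
  qed (simp add: zM)
  have "\<exists>x. limitin mtopology (z A) x sequentially" for A
  proof -
    have "MCauchy (z A)"
      unfolding MCauchy_def
    proof (intro conjI allI impI)
      show "range (z A) \<subseteq> M" using zM by blast
      fix e :: real assume e: "e > 0"
      obtain N where N: "1 / 2 ^ N < e / 2" using dyadic_small[of "e / 2" 1] e by auto
      have near: "d (z A (Suc N)) (z A m) < e / 2" if m: "m \<ge> Suc N" for m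
      proof -
        obtain k where "m = Suc N + k" using le_Suc_ex[OF m] by metis
        then show ?thesis using zfar[of A "Suc N" k] r0[of m] rn[of N] N by simp
      qed
      have "d (z A m) (z A n) < e" if "m \<ge> Suc N" "n \<ge> Suc N" for m n
        using near[OF that(1)] near[OF that(2)] triangle[OF zM[of A m] zM[of A "Suc N"] zM[of A n]]
          commute[of "z A m" "z A (Suc N)"] by linarith
      then show "\<exists>N. \<forall>n n'. N \<le> n \<longrightarrow> N \<le> n' \<longrightarrow> d (z A n) (z A n') < e" by blast
    qed
    then show ?thesis using complete unfolding mcomplete_def by blast
  qed
  then obtain \<phi> where \<phi>: "\<And>A. limitin mtopology (z A) (\<phi> A) sequentially" by metis
  have \<phi>M: "\<phi> A \<in> M" for A using \<phi>[of A] by (simp add: limitin_metric)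
  have \<phi>d: "d (z A n) (\<phi> A) \<le> r n" for A n
  proof (rule field_le_epsilon)
    fix e :: real assume "e > 0"
    then have "\<forall>\<^sub>F m in sequentially. z A m \<in> M \<and> d (z A m) (\<phi> A) < e"
      using \<phi>[of A] by (simp add: limitin_metric)
    then obtain N where N: "\<And>m. m \<ge> N \<Longrightarrow> d (z A m) (\<phi> A) < e" by (auto simp: eventually_sequentially)
    show "d (z A n) (\<phi> A) \<le> r n + e"
      using N[of "n + N"] zfar[of A n N] r0[of "n + N"] triangle[OF zM[of A n] zM[of A "n + N"] \<phi>M[of A]] by simp
  qed
  have "\<not> R k (\<phi> A) (\<phi> B)" if AB: "A \<noteq> B" for A B k
  proof
    assume R: "R k (\<phi> A) (\<phi> B)"
    obtain m where m: "(m \<in> A) \<noteq> (m \<in> B)" using AB by blast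
    \<comment> \<open>From level \<open>m + 1\<close> on the branches are apart, and
      \<open>R k\<close> implies \<open>R n\<close> for \<open>n \<ge> k\<close>.\<close>
    define n where "n = max k m"
    have "m < Suc n" by (simp add: n_def)
    then have "binary_code A (Suc n) \<noteq> binary_code B (Suc n)"
      using binary_code_eqD[of A "Suc n" B m] m by blast
    then have "\<not> R n (\<phi> A) (\<phi> B)"
      using \<phi>d[of A "Suc n"] \<phi>d[of B "Suc n"] unfolding z_def
      by (intro sep[OF binary_code_less binary_code_less _ \<phi>M \<phi>M])
    then show False using mono[OF _ R, of n] by (simp add: n_def)
  qed
  then show ?thesis using \<phi>M by blast
qed

section \<open>Uniform bound or continuum many orbits\<close>

context tracial
begin

definition tree_closure :: "'a set" where
  "tree_closure = {u \<in> haar \<tau>. \<forall>e>0. \<exists>y\<in>tree_haar. n2 (u - y) < e}"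

lemma tree_haar_subset_closure: "tree_haar \<subseteq> tree_closure"
  using tree_haar_subset unfolding tree_closure_def by (auto intro!: bexI)

lemma metric_n2: "Metric_space Y (\<lambda>x y. n2 (x - y))"
  by standard (auto simp: n2_minus_commute n2_triangle_diff n2_eq_0_iff)

text \<open>Unitaries lie in the unit ball, which is 2-norm complete, and the moment conditions pass
  to the limit by \<open>conv2_haar\<close>.\<close>

lemma mcomplete_tree_closure:
  "Metric_space.mcomplete tree_closure (\<lambda>x y. n2 (x - y))"
proof -
  interpret Metric_space tree_closure "\<lambda>x y. n2 (x - y)" by (rule metric_n2)
  show ?thesis
    unfolding mcomplete_def
  proof (intro allI impI)
    fix f assume f: "MCauchy f"
    then have fY: "\<And>n. f n \<in> tree_closure" by (auto simp: MCauchy_def)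
    then have fh: "\<And>n. f n \<in> haar \<tau>" by (simp add: tree_closure_def)
    obtain x where x: "conv2 f x"
    proof (rule conv2_complete[of f])
      show "norm (f n) \<le> 1" for n using haarD(3)[OF fh] by simp
      show "\<exists>N. \<forall>m\<ge>N. \<forall>n\<ge>N. n2 (f m - f n) < e" if "e > 0" for e
      proof -
        have "\<exists>N. \<forall>n n'. N \<le> n \<longrightarrow> N \<le> n' \<longrightarrow> n2 (f n - f n') < e"
          using f that by (simp add: MCauchy_def)
        then obtain N where N: "\<forall>n n'. N \<le> n \<longrightarrow> N \<le> n' \<longrightarrow> n2 (f n - f n') < e" by (rule exE)
        then show ?thesis by (intro exI[of _ N] allI impI) simp
      qed
    qed
    have near: "\<exists>n. n2 (x - f n) < e" if "e > 0" for e
    proof -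
      have "\<forall>\<^sub>F n in sequentially. n2 (f n - x) < e"
        using x that unfolding conv2_def by (rule order_tendstoD(2))
      then show ?thesis by (auto simp: eventually_sequentially n2_minus_commute)
    qed
    have "x \<in> haar \<tau>"
    proof (rule conv2_haar[OF x])
      show "unitary (f n)" for n by (rule haarD(1)[OF fh])
      show "(\<lambda>n. \<tau> (f n ^ k)) \<longlonglongrightarrow> 0" if "k \<ge> 1" for k using haarD(2)[OF fh that] by simp
    qed
    moreover have "\<exists>y\<in>tree_haar. n2 (x - y) < e" if "e > 0" for e
    proof -
      obtain n where n: "n2 (x - f n) < e / 2" using near[of "e / 2"] \<open>e > 0\<close> by auto
      have "e / 2 > 0" using \<open>e > 0\<close> by simp
      then obtain y where "y \<in> tree_haar" "n2 (f n - y) < e / 2"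
        using fY[of n] unfolding tree_closure_def by blast
      then show ?thesis using n n2_triangle_diff[of x y "f n"] by (intro bexI[of _ y]) auto
    qed
    ultimately have xY: "x \<in> tree_closure" by (simp add: tree_closure_def)
    have "\<forall>\<^sub>F n in sequentially. f n \<in> tree_closure \<and> n2 (f n - x) < e" if "e > 0" for e
      using order_tendstoD(2)[OF x[unfolded conv2_def] that] fY by simp
    then have "limitin mtopology f x sequentially" using xY by (simp add: limitin_metric)
    then show "\<exists>x. limitin mtopology f x sequentially" by blast
  qed
qed

lemma n2_conj_near:
  assumes u: "unitary u" and g: "unitary g"
  shows "n2 (u - g * u * adj g) \<le> 2 * norm (g - 1)"
proof -
  have "u - g * u * adj g = (u * (g - 1) - (g - 1) * u) * adj g"
    by (simp add: algebra_simps unitary_cancel[OF g])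
  then have "n2 (u - g * u * adj g) = n2 (u * (g - 1) - (g - 1) * u)"
    by (simp add: n2_unitary_right unitary_adj[OF g])
  also have "\<dots> \<le> n2 (u * (g - 1)) + n2 ((g - 1) * u)" by (rule n2_triangle_minus)
  also have "\<dots> = 2 * n2 (g - 1)" by (simp add: n2_unitary_left[OF u] n2_unitary_right[OF u])
  also have "\<dots> \<le> 2 * norm (g - 1)" by (simp add: n2_le_norm)
  finally show ?thesis .
qed

text \<open>The path from \<open>u\<close> to its conjugate by \<open>h\<close> is conjugated by
  \<open>g\<close> and appended to the path from \<open>u\<close> to its conjugate by
  \<open>g\<close>.\<close>

lemma approx_path_conj_mult:
  assumes g: "unitary g" "approx_path k B u (g * u * adj g)" and h: "approx_path l B u (h * u * adj h)"
  shows "approx_path (k + l) B u (g * h * u * adj (g * h))"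
proof -
  have "approx_path l B (g * u * adj g) (g * (h * u * adj h) * adj g)"
    by (rule approx_path_conj[OF h g(1)])
  then have "approx_path l B (g * u * adj g) (g * h * u * adj (g * h))" by (simp add: adj_mult mult.assoc)
  then show ?thesis by (rule approx_path_trans[OF g(2)])
qed

lemma approx_path_conj_power:
  assumes u: "u \<in> haar \<tau>" "1 \<le> B" and g: "unitary g" "approx_path k B u (g * u * adj g)"
  shows "approx_path (n * k) B u (g ^ n * u * adj (g ^ n))"
proof (induction n)
  case 0
  then show ?case using approx_path_refl[OF u] by simp
next
  case (Suc n)
  then show ?case using approx_path_conj_mult[OF g Suc] by simp
qed

text \<open>Every unitary is a product of a fixed number of unitaries close to \<open>1\<close>.\<close>

lemma approx_path_all_conj:
  assumes u: "u \<in> tree_haar" and B: "1 \<le> B" and e: "e > 0"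
    and ball: "\<And>x. x \<in> tree_closure \<Longrightarrow> n2 (u - x) < e \<Longrightarrow> approx_path k B u x"
  shows "\<exists>K. \<forall>g. unitary g \<longrightarrow> approx_path K B u (g * u * adj g)"
proof -
  have uh: "u \<in> haar \<tau>" using u tree_haar_subset by blast
  \<comment> \<open>Conjugation by \<open>g\<close> moves \<open>u\<close> by at most 2
    \<open>norm (g - 1)\<close>, hence the bound \<open>e / 2\<close> for the roots.\<close>
  obtain l where l: "2 / 2 ^ l < (e / 2)\<^sup>2" using dyadic_small[of "(e / 2)\<^sup>2" 2] e by auto
  have near: "approx_path (2 ^ l * k) B u (h * u * adj h)" if h: "unitary h" "(norm (h - 1))\<^sup>2 \<le> 2" for h
  proof -
    obtain g where g: "unitary g" "g ^ (2 ^ l) = h" "(norm (g - 1))\<^sup>2 \<le> 2 / 2 ^ l"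
      using unitary_root[OF h] by blast
    have "(norm (g - 1))\<^sup>2 < (e / 2)\<^sup>2" using g(3) l by linarith
    then have "norm (g - 1) < e / 2" by (rule power2_less_imp_less) (use e in simp)
    then have "n2 (u - g * u * adj g) < e" using n2_conj_near[OF haarD(1)[OF uh] g(1)] by linarith
    moreover have "g * u * adj g \<in> tree_closure"
      using tree_haar_conj[OF u g(1)] tree_haar_subset_closure by blast
    ultimately have "approx_path k B u (g * u * adj g)" by (rule ball[rotated])
    then show ?thesis using approx_path_conj_power[OF uh B g(1), of k "2 ^ l"] g(2) by simp
  qed
  define K where "K = 2 ^ l * k"
  \<comment> \<open>One \<open>K\<close> for each of the factors \<open>a\<close>, \<open>c\<close>,
    \<open>c\<close>, \<open>b\<close>.\<close>
  have "approx_path (K + (K + K) + K) B u (g * u * adj g)" if g: "unitary g" for g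
  proof -
    obtain a b c where abc: "unitary a" "unitary b" "unitary c" "g = a * (c * c) * b"
      "(norm (a - 1))\<^sup>2 \<le> 2" "(norm (b - 1))\<^sup>2 \<le> 2" "(norm (c - 1))\<^sup>2 \<le> 2"
      using unitary_factorization[OF g] by metis
    have p: "approx_path K B u (x * u * adj x)" if "unitary x" "(norm (x - 1))\<^sup>2 \<le> 2" for x
      unfolding K_def by (rule near[OF that])
    show ?thesis
      unfolding abc(4) by (intro approx_path_conj_mult unitary_mult p abc)
  qed
  then show ?thesis by blast
qed

text \<open>The route from \<open>u\<close> to a tree-built \<open>w\<close> is: conjugate by
  \<open>g\<close> (length \<open>K\<close>), pass to the nearby \<open>y\<close> (length
  \<open>k\<close>), then to \<open>z\<close> commuting with \<open>y\<close> (length 1); closedness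
  replaces \<open>z\<close> by \<open>w\<close>. One further step reaches any Haar unitary, and two
  such routes meet at \<open>u\<close>.\<close>

lemma approx_path_uniform:
  assumes diffuse: "diffuse TYPE('a)" and u: "u \<in> tree_haar" and B: "1 \<le> B" and e: "e > 0"
    and ball: "\<And>x. x \<in> tree_closure \<Longrightarrow> n2 (u - x) < e \<Longrightarrow> approx_path k B u x"
  shows "\<exists>K. \<forall>v\<in>haar \<tau>. \<forall>w\<in>haar \<tau>. approx_path K B v w"
proof -
  have uh: "u \<in> haar \<tau>" using u tree_haar_subset by blast
  obtain K where K: "\<And>g. unitary g \<Longrightarrow> approx_path K B u (g * u * adj g)"
    using approx_path_all_conj[OF u B e ball] by blast
  have tree: "approx_path (K + k + 1) B u w" if w: "w \<in> tree_haar" for w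
  proof (rule approx_path_closed[OF uh _ _ B])
    show "w \<in> haar \<tau>" using w tree_haar_subset by blast
    fix r :: real assume r: "r > 0"
    then have "min r e > 0" using e by simp
    then obtain g y z where gyz: "unitary g" "y \<in> tree_haar" "z \<in> tree_haar" "commutes y z"
      "n2 (g * u * adj g - y) < min r e" "n2 (w - z) < min r e"
      using tree_haar_common[OF diffuse u w] by blast
    \<comment> \<open>The hypothesis concerns a ball around \<open>u\<close> only, so
      \<open>y\<close> is pulled back near \<open>u\<close> and the path is then conjugated by
      \<open>g\<close>.\<close>
    define x where "x = adj g * y * g"
    have gx: "g * x * adj g = y" by (simp add: x_def mult.assoc unitary_cancel[OF gyz(1)])
    have "g * (u - x) * adj g = g * u * adj g - y" by (simp add: gx[symmetric] algebra_simps)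
    then have "n2 (u - x) < e" using gyz(5) n2_conj[OF gyz(1), of "u - x"] by simp
    moreover have "x \<in> tree_closure"
      using tree_haar_conj[OF gyz(2) unitary_adj[OF gyz(1)]] tree_haar_subset_closure by (auto simp: x_def)
    ultimately have "approx_path k B u x" by (rule ball[rotated])
    from approx_path_conj[OF this gyz(1)] have "approx_path k B (g * u * adj g) y" unfolding gx .
    then have "approx_path (K + k) B u y" by (rule approx_path_trans[OF K[OF gyz(1)]])
    moreover have "approx_path 1 B y z"
      using gyz(2,3,4) tree_haar_subset B by (intro approx_path_commutes) auto
    ultimately have "approx_path (K + k + 1) B u z" by (rule approx_path_trans)
    then show "\<exists>u' v'. n2 (u - u') < r \<and> n2 (w - v') < r \<and> approx_path (K + k + 1) B u' v'"
      using gyz(6) r by (intro exI[of _ u] exI[of _ z]) simp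
  qed simp
  have all: "approx_path (K + k + 1 + 1) B u w" if w: "w \<in> haar \<tau>" for w
  proof -
    obtain y where y: "y \<in> tree_haar" "commutes w y" using haar_commutes_tree_haar[OF w] by blast
    have "approx_path 1 B y w"
      using y tree_haar_subset w B by (intro approx_path_commutes commutes_sym[OF y(2)]) auto
    then show ?thesis by (rule approx_path_trans[OF tree[OF y(1)]])
  qed
  then show ?thesis using approx_path_trans[OF approx_path_sym[OF all] all] by blast
qed

lemma uniform_or_continuum:
  assumes diffuse: "diffuse TYPE('a)"
  shows "(\<exists>K. \<exists>B\<ge>1. \<forall>v\<in>haar \<tau>. \<forall>w\<in>haar \<tau>. approx_path K B v w) \<or>
    (\<exists>\<phi> :: nat set \<Rightarrow> 'a. (\<forall>A. \<phi> A \<in> haar \<tau>) \<and>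
      (\<forall>A A'. A \<noteq> A' \<longrightarrow> (\<forall>k B. \<not> approx_path k B (\<phi> A) (\<phi> A'))))"
proof -
  \<comment> \<open>Length and norm bound share one index, which gives a single increasing sequence
    of relations; \<open>R_iff\<close> pads to the exact length for which closedness was
    shown.\<close>
  define R where "R n u v \<longleftrightarrow> u \<in> haar \<tau> \<and> v \<in> haar \<tau> \<and> (\<exists>k\<le>Suc n. approx_path k (real (Suc n)) u v)" for n u v
  have R_iff: "R n u v \<longleftrightarrow> approx_path (Suc n) (real (Suc n)) u v" if uv: "u \<in> haar \<tau>" "v \<in> haar \<tau>" for n u v
  proof
    assume "R n u v"
    then obtain k where k: "k \<le> Suc n" "approx_path k (real (Suc n)) u v" by (auto simp: R_def)
    have "approx_path (k + (Suc n - k)) (real (Suc n)) u v"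
      by (rule approx_path_trans[OF k(2) approx_path_refl[OF uv(2)]]) simp
    then show "approx_path (Suc n) (real (Suc n)) u v" using k(1) by simp
  qed (use uv in \<open>auto simp: R_def\<close>)
  have R_mono: "R n u v" if "m \<le> n" "R m u v" for m n u v
    using that approx_path_mono[of _ "real (Suc m)" u v "real (Suc n)"] le_trans[of _ "Suc m" "Suc n"]
    unfolding R_def by (metis Suc_le_mono of_nat_le_iff)
  interpret Metric_space tree_closure "\<lambda>x y. n2 (x - y)" by (rule metric_n2)
  have hY: "x \<in> haar \<tau>" if "x \<in> tree_closure" for x using that by (simp add: tree_closure_def)
  show ?thesis
  proof (cases "\<forall>n. \<forall>x\<in>tree_closure. \<forall>y\<in>tree_closure. \<forall>e>0.
      \<exists>x'\<in>tree_closure. \<exists>y'\<in>tree_closure. n2 (x - x') < e \<and> n2 (y - y') < e \<and> \<not> R n x' y'")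
    case True
    have "\<exists>\<phi> :: nat set \<Rightarrow> 'a. (\<forall>A. \<phi> A \<in> tree_closure) \<and> (\<forall>A A'. A \<noteq> A' \<longrightarrow> (\<forall>n. \<not> R n (\<phi> A) (\<phi> A')))"
    proof (rule cantor_scheme[OF mcomplete_tree_closure])
      show "tree_closure \<noteq> {}" using tree_haar_nonempty[OF diffuse] tree_haar_subset_closure by blast
      show "R n u v" if "m \<le> n" "R m u v" for m n u v by (rule R_mono[OF that])
      show "\<exists>x'\<in>tree_closure. \<exists>y'\<in>tree_closure. n2 (x - x') < e \<and> n2 (y - y') < e \<and> \<not> R n x' y'"
        if "x \<in> tree_closure" "y \<in> tree_closure" "e > 0" for n x y e
        using True that by blast
      show "\<exists>e>0. \<forall>x'\<in>tree_closure. \<forall>y'\<in>tree_closure. n2 (x - x') < e \<longrightarrow> n2 (y - y') < e \<longrightarrow> \<not> R n x' y'"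
        if xy: "x \<in> tree_closure" "y \<in> tree_closure" "\<not> R n x y" for n x y
      proof (rule ccontr)
        assume neg: "\<not> ?thesis"
        have "approx_path (Suc n) (real (Suc n)) x y"
        proof (rule approx_path_closed)
          show "\<exists>x' y'. n2 (x - x') < e \<and> n2 (y - y') < e \<and> approx_path (Suc n) (real (Suc n)) x' y'"
            if "e > 0" for e
            using neg that R_iff[OF hY hY] by blast
        qed (use hY xy in auto)
        then show False using xy R_iff[OF hY hY] by blast
      qed
    qed
    then obtain \<phi> :: "nat set \<Rightarrow> 'a" where
      "(\<forall>A. \<phi> A \<in> tree_closure) \<and> (\<forall>A A'. A \<noteq> A' \<longrightarrow> (\<forall>n. \<not> R n (\<phi> A) (\<phi> A')))" by (rule exE)
    then have \<phi>: "\<phi> A \<in> tree_closure" "A \<noteq> A' \<Longrightarrow> \<not> R n (\<phi> A) (\<phi> A')" for A A' n by simp_all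
    have "\<not> approx_path k B (\<phi> A) (\<phi> A')" if "A \<noteq> A'" for k B A A'
    proof
      assume p: "approx_path k B (\<phi> A) (\<phi> A')"
      obtain N where N: "B \<le> real N" using real_arch_simple by blast
      define n where "n = max k N"
      have "B \<le> real (Suc n)" "k \<le> Suc n" using N by (auto simp: n_def)
      then have "R n (\<phi> A) (\<phi> A')"
        using approx_path_mono[OF p] hY \<phi>(1) by (auto simp: R_def)
      then show False using \<phi>(2)[OF that] by blast
    qed
    then show ?thesis using hY[OF \<phi>(1)] by (intro disjI2 exI[of _ \<phi>]) simp
  next
    case False
    then obtain n x y e where xy: "x \<in> tree_closure" "y \<in> tree_closure" "e > 0"
      and inner: "\<And>x' y'. x' \<in> tree_closure \<Longrightarrow> y' \<in> tree_closure \<Longrightarrow> n2 (x - x') < e \<Longrightarrow> n2 (y - y') < e \<Longrightarrow> R n x' y'"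
      by blast
    define B where "B = real (Suc n)"
    \<comment> \<open>Every point near \<open>x\<close> is joined to the same \<open>y\<close>; two
      points near \<open>x\<close> are therefore joined through \<open>y\<close> at twice the
      length.\<close>
    have to_y: "approx_path (Suc n) B x' y" if "x' \<in> tree_closure" "n2 (x - x') < e" for x'
      using inner[OF that(1) xy(2) that(2)] xy R_iff[OF hY[OF that(1)] hY[OF xy(2)]] by (simp add: B_def)
    \<comment> \<open>Halving leaves room to recentre: the ball of radius \<open>e / 2\<close>
      around the tree-built \<open>u\<close> lies in the ball of radius \<open>e\<close> around
      \<open>x\<close>.\<close>
    have "e / 2 > 0" using xy by simp
    then obtain u where u: "u \<in> tree_haar" "n2 (x - u) < e / 2"
      using xy(1) unfolding tree_closure_def by blast
    have uY: "u \<in> tree_closure" using u tree_haar_subset_closure by blast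
    have "\<exists>K. \<forall>v\<in>haar \<tau>. \<forall>w\<in>haar \<tau>. approx_path K B v w"
    proof (rule approx_path_uniform[OF diffuse u(1) _ \<open>e / 2 > 0\<close>])
      fix x' assume x': "x' \<in> tree_closure" "n2 (u - x') < e / 2"
      have "n2 (x - x') < e" using x'(2) u(2) n2_triangle_diff[of x x' u] by simp
      moreover have "n2 (x - u) < e" using u(2) xy(3) by simp
      ultimately show "approx_path (Suc n + Suc n) B u x'"
        using approx_path_trans[OF to_y[OF uY] approx_path_sym[OF to_y[OF x'(1)]]] by blast
    qed (simp add: B_def)
    then obtain K where "\<forall>v\<in>haar \<tau>. \<forall>w\<in>haar \<tau>. approx_path K B v w" by (rule exE)
    then show ?thesis by (intro disjI1 exI[of _ K] exI[of _ B]) (simp add: B_def)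
  qed
qed

text \<open>An element is determined by the pairs \<open>(n, m)\<close> for which the
  \<open>m\<close>-th point of a dense sequence is within 1/(n + 1) of it.\<close>

lemma separable2_lepoll:
  assumes "separable2 \<tau>"
  shows "(UNIV :: 'a set) \<lesssim> (UNIV :: nat set set)"
proof -
  obtain D where D: "countable D" "\<And>x e. e > 0 \<Longrightarrow> \<exists>d\<in>D. n2 (x - d) < e"
    using assms unfolding separable2_def by blast
  have "D \<noteq> {}" using D(2)[of 1 0] by auto
  define f where "f = from_nat_into D"
  have f: "D = range f" unfolding f_def by (rule range_from_nat_into[OF \<open>D \<noteq> {}\<close> D(1), symmetric])
  define S where "S x = {prod_encode (n, m) | n m. n2 (x - f m) < 1 / real (Suc n)}" for x
  have "inj S"
  proof (rule injI)
    fix x y assume eq: "S x = S y"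
    have "n2 (x - y) < 2 / real (Suc n)" for n
    proof -
      obtain m where m: "n2 (x - f m) < 1 / real (Suc n)"
        using D(2)[of "1 / real (Suc n)" x] f by auto
      then have "prod_encode (n, m) \<in> S x" by (auto simp: S_def)
      then have "prod_encode (n, m) \<in> S y" by (simp only: eq)
      then have "n2 (y - f m) < 1 / real (Suc n)" by (auto simp: S_def prod_encode_eq)
      then show ?thesis using m n2_triangle_diff[of x y "f m"] n2_minus_commute[of y "f m"] by simp
    qed
    then have "n2 (x - y) \<le> 2 / real (Suc n)" for n by (simp add: less_imp_le)
    moreover have "(\<lambda>n. 2 / real (Suc n)) \<longlonglongrightarrow> 0"
      using LIMSEQ_Suc[OF lim_const_over_n[of 2]] by simp
    ultimately have "n2 (x - y) \<le> 0" by (intro LIMSEQ_le_const) auto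
    then have "n2 (x - y) = 0" using n2_nonneg[of "x - y"] by linarith
    then show "x = y" by simp
  qed
  then show ?thesis unfolding lepoll_def by blast
qed

lemma haar_equiv_imp_approx_path:
  assumes "U \<noteq> bot" "(u, v) \<in> haar_equiv U \<tau>" "u \<noteq> v"
  shows "\<exists>k B. approx_path k B u v"
proof -
  have "pdist U \<tau> u v < \<infinity>" using assms by (simp add: haar_equiv_def)
  then obtain k where "comm_path U \<tau> u v k"
    using assms(3) unfolding pdist_def by (auto split: if_splits)
  then show ?thesis using comm_path_imp_approx_path[OF assms(1)] assms(2) unfolding haar_equiv_def by blast
qed

lemma pdist_le:
  assumes U: "free_ultrafilter U" and p: "approx_path k B u v" and k: "1 \<le> k"
  shows "pdist U \<tau> u v \<le> enat k"
proof -
  have "comm_path U \<tau> u v k" by (rule approx_path_imp_comm_path[OF U p])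
  then have "(LEAST k. k \<ge> 1 \<and> comm_path U \<tau> u v k) \<le> k" "\<exists>k\<ge>1. comm_path U \<tau> u v k"
    using k by (auto intro: Least_le)
  then show ?thesis by (simp add: pdist_def)
qed

text \<open>If two classes agree, reflexivity at \<open>\<phi> A'\<close> puts
  \<open>\<phi> A'\<close> into the class of \<open>\<phi> A\<close>, and a path joins the
  two.\<close>

lemma nat_sets_lepoll_orbits:
  fixes \<phi> :: "nat set \<Rightarrow> 'a"
  assumes U: "U \<noteq> bot" and \<phi>: "\<And>A. \<phi> A \<in> haar \<tau>"
    "\<And>A A' k B. A \<noteq> A' \<Longrightarrow> \<not> approx_path k B (\<phi> A) (\<phi> A')"
  shows "(UNIV :: nat set set) \<lesssim> orbits U \<tau>"
  unfolding lepoll_def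
proof (intro exI conjI)
  show "inj (\<lambda>A. haar_equiv U \<tau> `` {\<phi> A})"
  proof (rule injI, rule ccontr)
    fix A A' assume eq: "haar_equiv U \<tau> `` {\<phi> A} = haar_equiv U \<tau> `` {\<phi> A'}" and "A \<noteq> A'"
    \<comment> \<open>Equal values would be joined by a path of length 0. Distinctness has to be
      known first, since \<open>pdist\<close> vanishes on equal arguments without reference to
      paths.\<close>
    have "\<phi> A \<noteq> \<phi> A'"
      using approx_path_refl[OF \<phi>(1)[of A], of 1 0] \<phi>(2)[OF \<open>A \<noteq> A'\<close>, of 0 1] by auto
    moreover have "(\<phi> A', \<phi> A') \<in> haar_equiv U \<tau>" using \<phi>(1) by (simp add: haar_equiv_def pdist_def zero_enat_def)
    then have "(\<phi> A, \<phi> A') \<in> haar_equiv U \<tau>" using eq by blast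
    ultimately show False using haar_equiv_imp_approx_path[OF U] \<phi>(2)[OF \<open>A \<noteq> A'\<close>] by blast
  qed
  show "range (\<lambda>A. haar_equiv U \<tau> `` {\<phi> A}) \<subseteq> orbits U \<tau>"
    using \<phi>(1) by (auto simp: orbits_def intro: quotientI)
qed

lemma orbits_lepoll: "orbits U \<tau> \<lesssim> (UNIV :: 'a set)"
proof -
  have "orbits U \<tau> = (\<lambda>u. haar_equiv U \<tau> `` {u}) ` haar \<tau>"
    by (auto simp: orbits_def quotient_def)
  then show ?thesis
    by (metis image_lepoll lepoll_trans subset_UNIV subset_imp_lepoll)
qed

end

theorem theorem6p3:
  fixes \<tau> :: "'a::cstar_algebra \<Rightarrow> complex" and U :: "nat filter"
  assumes "tracial_vna \<tau>"
    and "diffuse TYPE('a)"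
    and "free_ultrafilter U"
  shows "((\<exists>C. orbits U \<tau> = {C}) \<or> uncountable (orbits U \<tau>))
       \<and> (separable2 \<tau> \<longrightarrow>
            (\<exists>C. orbits U \<tau> = {C}) \<or> (\<exists>f. bij_betw f (orbits U \<tau>) (UNIV :: real set)))
       \<and> ((\<exists>C. orbits U \<tau> = {C}) \<longrightarrow> frakR U \<tau> < \<infinity>)"
proof -
  interpret tracial \<tau> by unfold_locales (rule assms(1))
  have U: "U \<noteq> bot" using assms(3) by (simp add: free_ultrafilter_def)
  show ?thesis
    using uniform_or_continuum[OF assms(2)]
  proof (elim disjE exE conjE)
    fix K B assume B: "1 \<le> B" and all: "\<forall>v\<in>haar \<tau>. \<forall>w\<in>haar \<tau>. approx_path K B v w"
    have le: "pdist U \<tau> v w \<le> enat (K + 1)" if vw: "v \<in> haar \<tau>" "w \<in> haar \<tau>" for v w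
    proof (rule pdist_le[OF assms(3)])
      \<comment> \<open>\<open>K\<close> may be 0, whereas \<open>pdist_le\<close> asks for positive
        length; the path is padded by one constant step.\<close>
      show "approx_path (K + 1) B v w"
        by (rule approx_path_trans[OF all[rule_format, OF vw] approx_path_refl[OF vw(2) B]])
    qed simp
    have "pdist U \<tau> v w < \<infinity>" if "v \<in> haar \<tau>" "w \<in> haar \<tau>" for v w
      by (rule le_less_trans[OF le[OF that]]) simp
    then have "(v, w) \<in> haar_equiv U \<tau> \<longleftrightarrow> v \<in> haar \<tau> \<and> w \<in> haar \<tau>" for v w
      unfolding haar_equiv_def by blast
    moreover have "haar \<tau> \<noteq> {}" using tree_haar_nonempty[OF assms(2)] tree_haar_subset by blast
    ultimately have "orbits U \<tau> = {haar \<tau>}"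
      by (auto simp: orbits_def quotient_def)
    moreover have "frakR U \<tau> \<le> enat (K + 1)"
      unfolding frakR_def haar_equiv_def by (rule Sup_least) (use le in blast)
    then have "frakR U \<tau> < \<infinity>" by (rule le_less_trans) simp
    ultimately show ?thesis by simp
  next
    fix \<phi> :: "nat set \<Rightarrow> 'a"
    assume \<phi>: "\<forall>A. \<phi> A \<in> haar \<tau>" "\<forall>A A'. A \<noteq> A' \<longrightarrow> (\<forall>k B. \<not> approx_path k B (\<phi> A) (\<phi> A'))"
    have ge: "(UNIV :: nat set set) \<lesssim> orbits U \<tau>"
      by (rule nat_sets_lepoll_orbits[OF U, of \<phi>]) (use \<phi> in simp_all)
    have reals: "(UNIV :: real set) \<lesssim> orbits U \<tau>"
      using ge nat_sets_eqpoll_reals by (meson eqpoll_imp_lepoll eqpoll_sym lepoll_trans)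
    then have unc: "uncountable (orbits U \<tau>)"
      using uncountable_UNIV_real countable_lepoll by blast
    have "\<exists>f. bij_betw f (orbits U \<tau>) (UNIV :: real set)" if "separable2 \<tau>"
    proof -
      have "orbits U \<tau> \<lesssim> (UNIV :: real set)"
        using orbits_lepoll separable2_lepoll[OF that] nat_sets_eqpoll_reals
        by (meson eqpoll_imp_lepoll lepoll_trans)
      then have "orbits U \<tau> \<approx> (UNIV :: real set)" using reals by (rule lepoll_antisym)
      then show ?thesis by (simp add: eqpoll_def)
    qed
    \<comment> \<open>In this case the claim on \<open>frakR\<close> holds vacuously.\<close>
    moreover have "\<nexists>C. orbits U \<tau> = {C}" using unc by auto
    ultimately show ?thesis using unc by blast
  qed
qed

end
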